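(* Assume that $\sqrt{d} \ll n-d \ll d$ as $n\to\infty$. Then $$ \frac{d^{3/2}}{n-d}\,H_{\mathrm{typ}} \xrightarrow{P} \sqrt{2/\pi}, $$ where $\xrightarrow{P}$ denotes convergence in probability.
   Context: Asymptotic setting: $\mathbb{N}\ni n\to\infty$ and $d=d(n)\in\{2,\ldots,n-1\}$ is a function of $n$ which is either constant or tends to infinity. All limits are as $n\to\infty$. The notation $f\ll g$ means $f(n)/g(n)\to0$. Let $X_1,\ldots,X_n$ be i.i.d. random vectors uniformly distributed on the unit sphere $\mathbb{S}^{d-1}\subset\mathbb{R}^d$, and let $P_{n,d}=[X_1,\ldots,X_n]$ be their convex hull. A facet ($(d-1)$-dimensional face) of $P_{n,d}$ has height $h\in[-1,1]$ if its supporting hyperplane is $\{x\in\mathbb{R}^d:\langle x,u\rangle=h\}$ for some $u\in\mathbb{S}^{d-1}$ and $P_{n,d}\subset\{x:\langle x,u\rangle\le h\}$ (heights can be negative). The typical height $H_{\mathrm{typ}}$ (depending on $n,d$) is the random variable with distribution $$\mathbb{P}(H_{\mathrm{typ}}\in\cdot)=\mathbb{P}\big([X_1,\ldots,X_d]\text{ has height in }\cdot \;\big|\; [X_1,\ldots,X_d]\text{ is a facet of }P_{n,d}\big).$$ *)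

theory Defs
  imports "HOL-Probability.Probability" "HOL-Library.Function_Algebras"
begin

text \<open>
  The dimension \<open>d\<close> varies with \<open>n\<close> inside a single statement, so it cannot be a type.  We use
  one ambient vector space, the functions \<open>nat \<Rightarrow> real\<close> with pointwise operations, and
  identify \<open>\<real>\<^sup>d\<close> with the subspace of functions that vanish outside \<open>{..<d}\<close>.  The notions of
  convex hull, affine hull and face are those of the library for arbitrary real vector spaces;
  the Borel sigma-algebra on \<open>nat \<Rightarrow> real\<close> is the product sigma-algebra and induces the usual
  Borel sets on \<open>\<real>\<^sup>d\<close>.
\<close>

instantiation "fun" :: (type, real_vector) real_vector
begin

definition scaleR_fun :: "real \<Rightarrow> ('a \<Rightarrow> 'b) \<Rightarrow> 'a \<Rightarrow> 'b" where
  "scaleR_fun c f = (\<lambda>x. c *\<^sub>R f x)"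

instance
  by standard (simp_all add: scaleR_fun_def fun_eq_iff plus_fun_def scaleR_add_left scaleR_add_right)

end

definition Rd :: "nat \<Rightarrow> (nat \<Rightarrow> real) set" where
  "Rd d = {x. \<forall>j\<ge>d. x j = 0}"

definition ip :: "nat \<Rightarrow> (nat \<Rightarrow> real) \<Rightarrow> (nat \<Rightarrow> real) \<Rightarrow> real" where
  "ip d x y = (\<Sum>j<d. x j * y j)"

definition nrm :: "nat \<Rightarrow> (nat \<Rightarrow> real) \<Rightarrow> real" where
  "nrm d x = sqrt (ip d x x)"

definition unit_sphere :: "nat \<Rightarrow> (nat \<Rightarrow> real) set" where
  "unit_sphere d = {x \<in> Rd d. nrm d x = 1}"

definition hyperplane :: "nat \<Rightarrow> (nat \<Rightarrow> real) \<Rightarrow> real \<Rightarrow> (nat \<Rightarrow> real) set" where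
  "hyperplane d u h = {x \<in> Rd d. ip d x u = h}"

text \<open>
  Normalised surface measure on the sphere, obtained as the cone measure: the image of the
  uniform distribution on the unit ball (with respect to \<open>d\<close>-dimensional Lebesgue measure) under
  radial projection \<open>x \<mapsto> x / |x|\<close>.  Thus a set \<open>A\<close> has measure
  \<open>vol {t x | x \<in> A, 0 \<le> t \<le> 1} / vol (ball)\<close>.  The if-expression only converts between
  extensional functions (the points of the product measure) and functions in \<open>Rd d\<close>.
\<close>

definition unit_ball :: "nat \<Rightarrow> (nat \<Rightarrow> real) set" where
  "unit_ball d = {x \<in> space (\<Pi>\<^sub>M j\<in>{..<d}. lborel). nrm d x \<le> 1}"

definition radial_proj :: "nat \<Rightarrow> (nat \<Rightarrow> real) \<Rightarrow> (nat \<Rightarrow> real)" where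
  "radial_proj d x = (\<lambda>j. if j < d then x j / nrm d x else 0)"

definition uniform_sphere :: "nat \<Rightarrow> (nat \<Rightarrow> real) measure" where
  "uniform_sphere d =
     distr (uniform_measure (\<Pi>\<^sub>M j\<in>{..<d}. lborel) (unit_ball d)) borel (radial_proj d)"

text \<open>\<open>aff_dim\<close> and \<open>facet_of\<close> of the library are restricted to the class \<open>euclidean_space\<close>,
  which \<open>nat \<Rightarrow> real\<close> does not belong to.\<close>

definition has_aff_dim :: "'a::real_vector set \<Rightarrow> nat \<Rightarrow> bool" where
  "has_aff_dim S k \<longleftrightarrow>
     (\<exists>B. finite B \<and> card B = k + 1 \<and> \<not> affine_dependent B \<and> affine hull B = affine hull S)"

definition is_facet :: "nat \<Rightarrow> (nat \<Rightarrow> real) set \<Rightarrow> (nat \<Rightarrow> real) set \<Rightarrow> bool" where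
  "is_facet d P F \<longleftrightarrow> F face_of P \<and> has_aff_dim F (d - 1)"

text \<open>The supporting hyperplane of \<open>F\<close> is the one that meets \<open>P\<close> exactly in \<open>F\<close>.
  For a facet of a full-dimensional polytope \<open>P\<close> the height is unique.\<close>

definition has_height :: "nat \<Rightarrow> (nat \<Rightarrow> real) set \<Rightarrow> (nat \<Rightarrow> real) set \<Rightarrow> real \<Rightarrow> bool" where
  "has_height d P F h \<longleftrightarrow>
     h \<in> {-1..1} \<and>
     (\<exists>u\<in>unit_sphere d. P \<inter> hyperplane d u h = F \<and> P \<subseteq> {x \<in> Rd d. ip d x u \<le> h})"

definition iid_uniform_sphere ::
  "nat \<Rightarrow> nat \<Rightarrow> 'a measure \<Rightarrow> (nat \<Rightarrow> 'a \<Rightarrow> nat \<Rightarrow> real) \<Rightarrow> bool" where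
  "iid_uniform_sphere n d M X \<longleftrightarrow>
     prob_space M \<and>
     prob_space.indep_vars M (\<lambda>_. borel) X {1..n} \<and>
     (\<forall>i\<in>{1..n}. distr M borel (X i) = uniform_sphere d)"

definition rand_poly :: "nat \<Rightarrow> (nat \<Rightarrow> 'a \<Rightarrow> nat \<Rightarrow> real) \<Rightarrow> 'a \<Rightarrow> (nat \<Rightarrow> real) set" where
  "rand_poly n X \<omega> = convex hull ((\<lambda>i. X i \<omega>) ` {1..n})"

text \<open>\<open>H\<close>, defined on the probability space \<open>N\<close>, is a typical height of the random polytope
  generated by \<open>X\<close> on the probability space \<open>M\<close>.  Note that \<open>rand_poly d X \<omega>\<close> is the simplex
  \<open>[X\<^sub>1, \<dots>, X\<^sub>d]\<close>.\<close>

definition typical_height ::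
  "nat \<Rightarrow> nat \<Rightarrow> 'a measure \<Rightarrow> (nat \<Rightarrow> 'a \<Rightarrow> nat \<Rightarrow> real) \<Rightarrow> 'b measure \<Rightarrow> ('b \<Rightarrow> real) \<Rightarrow> bool" where
  "typical_height n d M X N H \<longleftrightarrow>
     prob_space N \<and> H \<in> borel_measurable N \<and>
     (\<forall>B\<in>sets borel.
        \<P>(\<omega> in N. H \<omega> \<in> B) =
        \<P>(\<omega> in M. (\<exists>h\<in>B. has_height d (rand_poly n X \<omega>) (rand_poly d X \<omega>) h)
                \<bar> is_facet d (rand_poly n X \<omega>) (rand_poly d X \<omega>)))"

subsection \<open>Consistency of the uniform distribution\<close>

lemma ip_measurable [measurable]:
  "(\<lambda>x. ip d x x) \<in> borel_measurable (\<Pi>\<^sub>M j\<in>{..<d}. lborel)"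
  unfolding ip_def by measurable

lemma nrm_measurable [measurable]:
  "nrm d \<in> borel_measurable (\<Pi>\<^sub>M j\<in>{..<d}. lborel)"
  unfolding nrm_def by measurable

lemma unit_ball_sets [measurable]: "unit_ball d \<in> sets (\<Pi>\<^sub>M j\<in>{..<d}. lborel)"
  unfolding unit_ball_def by measurable

lemma radial_proj_measurable [measurable]:
  "radial_proj d \<in> borel_measurable (\<Pi>\<^sub>M j\<in>{..<d}. lborel)"
proof (rule measurable_coordinatewise_then_product)
  fix i
  show "(\<lambda>x. radial_proj d x i) \<in> borel_measurable (\<Pi>\<^sub>M j\<in>{..<d}. lborel)"
    unfolding radial_proj_def by (cases "i < d") simp_all
qed

lemma emeasure_unit_ball:
  shows "emeasure (\<Pi>\<^sub>M j\<in>{..<d}. lborel) (unit_ball d) \<noteq> 0"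
    and "emeasure (\<Pi>\<^sub>M j\<in>{..<d}. lborel) (unit_ball d) \<noteq> \<infinity>"
proof -
  interpret product_sigma_finite "\<lambda>_::nat. lborel :: real measure" ..
  let ?L = "\<Pi>\<^sub>M j\<in>{..<d}. lborel :: real measure"
  define r where "r = 1 / (real d + 1)"
  have r: "0 < r" "r \<le> 1" "real d * r \<le> 1" by (simp_all add: r_def field_simps)
  have box: "emeasure ?L (\<Pi>\<^sub>E j\<in>{..<d}. {-a..a}) = (\<Prod>j<d. ennreal (2 * a))" if "0 < a" for a
    using that by (subst emeasure_PiM) auto
  have "(\<Pi>\<^sub>E j\<in>{..<d}. {-r..r}) \<subseteq> unit_ball d"
  proof
    fix x assume x: "x \<in> (\<Pi>\<^sub>E j\<in>{..<d}. {-r..r})"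
    have "x j * x j \<le> r" if "j < d" for j
    proof -
      have "\<bar>x j\<bar> \<le> r" using x that by (auto simp: PiE_iff abs_le_iff minus_le_iff)
      then have "\<bar>x j\<bar> * \<bar>x j\<bar> \<le> r * 1" using r by (intro mult_mono) auto
      then show ?thesis by simp
    qed
    then have "ip d x x \<le> (\<Sum>j<d. r)" unfolding ip_def by (intro sum_mono) auto
    then have "nrm d x \<le> 1" using r by (simp add: nrm_def)
    then show "x \<in> unit_ball d" using x by (auto simp: unit_ball_def space_PiM PiE_iff)
  qed
  then have "(\<Prod>j<d. ennreal (2 * r)) \<le> emeasure ?L (unit_ball d)"
    using emeasure_mono[OF _ unit_ball_sets] box[OF r(1)] by metis
  moreover have "(\<Prod>j<d. ennreal (2 * r)) \<noteq> 0" using r by (simp add: prod_ennreal)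
  ultimately show "emeasure ?L (unit_ball d) \<noteq> 0" by auto
  have "unit_ball d \<subseteq> (\<Pi>\<^sub>E j\<in>{..<d}. {-1..1})"
  proof
    fix x assume x: "x \<in> unit_ball d"
    have "x j \<in> {-1..1}" if "j < d" for j
    proof -
      have "x j * x j \<le> ip d x x" unfolding ip_def
        using that by (intro member_le_sum) auto
      also have "ip d x x \<le> 1" using x by (auto simp: unit_ball_def nrm_def)
      finally have "(x j)\<^sup>2 \<le> 1" by (simp add: power2_eq_square)
      then show ?thesis by (auto simp: abs_square_le_1 abs_le_iff)
    qed
    then show "x \<in> (\<Pi>\<^sub>E j\<in>{..<d}. {-1..1})"
      using x by (auto simp: unit_ball_def space_PiM PiE_iff)
  qed
  then have "emeasure ?L (unit_ball d) \<le> (\<Prod>j<d. ennreal (2 * 1))"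
    by (subst box[symmetric]) (auto intro!: emeasure_mono sets_PiM_I_finite)
  also have "\<dots> < \<infinity>" by (simp add: power_less_top_ennreal)
  finally show "emeasure ?L (unit_ball d) \<noteq> \<infinity>" by simp
qed

lemma prob_space_uniform_sphere: "prob_space (uniform_sphere d)"
proof -
  interpret prob_space "uniform_measure (\<Pi>\<^sub>M j\<in>{..<d}. lborel) (unit_ball d)"
    by (rule prob_space_uniform_measure[OF emeasure_unit_ball])
  show ?thesis unfolding uniform_sphere_def by (rule prob_space_distr) simp
qed

lemma radial_proj_in_unit_sphere:
  assumes "nrm d x \<noteq> 0"
  shows "radial_proj d x \<in> unit_sphere d"
proof -
  have pos: "ip d x x > 0"
    using assms sum_nonneg[of "{..<d}" "\<lambda>j. x j * x j"] by (auto simp: nrm_def ip_def less_le)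
  have "ip d (radial_proj d x) (radial_proj d x) = (\<Sum>j<d. x j * x j / ip d x x)"
    unfolding ip_def[of d "radial_proj d x"] using pos
    by (intro sum.cong) (auto simp: radial_proj_def nrm_def)
  also have "\<dots> = 1" using pos by (simp add: sum_divide_distrib[symmetric] ip_def)
  finally show ?thesis by (simp add: unit_sphere_def nrm_def Rd_def radial_proj_def)
qed

lemma unit_sphere_borel [measurable]: "unit_sphere d \<in> sets borel"
proof -
  have coord [measurable]: "(\<lambda>x::nat \<Rightarrow> real. x j) \<in> borel_measurable borel" for j
    by (intro borel_measurable_continuous_onI continuous_on_product_coordinates)
  have "{x \<in> space borel. (\<forall>j. d \<le> j \<longrightarrow> x j = 0) \<and> sqrt (\<Sum>j<d. x j * x j) = 1}
          \<in> sets (borel :: (nat \<Rightarrow> real) measure)"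
    by measurable
  then show ?thesis by (simp add: unit_sphere_def Rd_def nrm_def ip_def)
qed

lemma AE_uniform_sphere:
  assumes "d \<ge> 1"
  shows "AE x in uniform_sphere d. x \<in> unit_sphere d"
proof -
  interpret product_sigma_finite "\<lambda>_::nat. lborel :: real measure" ..
  let ?L = "\<Pi>\<^sub>M j\<in>{..<d}. lborel :: real measure"
  have "emeasure ?L (\<Pi>\<^sub>E j\<in>{..<d}. {0}) = 0"
    using assms by (subst emeasure_PiM) auto
  then have null: "(\<Pi>\<^sub>E j\<in>{..<d}. {0}) \<in> null_sets ?L"
    by (rule null_setsI) (rule sets_PiM_I_finite, simp_all)
  have "x \<in> (\<Pi>\<^sub>E j\<in>{..<d}. {0})" if "x \<in> space ?L" "nrm d x = 0" for x
    unfolding PiE_iff using that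
    by (simp add: space_PiM PiE_iff nrm_def ip_def sum_nonneg_eq_0_iff)
  then have "AE x in ?L. nrm d x \<noteq> 0"
    by (intro AE_I'[OF null]) auto
  then have "AE x in uniform_measure ?L (unit_ball d). radial_proj d x \<in> unit_sphere d"
    by (intro AE_uniform_measureI) (auto intro: radial_proj_in_unit_sphere)
  then show ?thesis
    unfolding uniform_sphere_def by (subst AE_distr_iff) auto
qed

end

theory Submission
  imports Defs
begin

text \<open>
  Let \<open>(u, h)\<close> be the hyperplane spanned by the independent uniform points \<open>X\<^sub>1, \<dots>, X\<^sub>d\<close>. The Lorentz
  group acts on the sphere by conformal maps, it acts on hyperplanes compatibly, and the divergence
  of the infinitesimal boost in direction \<open>e\<^sub>j\<close> at \<open>x\<close> is \<open>- (d - 1) x\<^sub>j\<close>. Differentiating the change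
  of variables formula and summing over \<open>j\<close> gives Stein's identity
  \<open>E[(1 - h\<^sup>2) \<phi>'(h)] = (d - 1)\<^sup>2 E[h \<phi>(h)]\<close> for odd \<open>\<phi>\<close>, which replaces the affine
  Blaschke-Petkantschin formula. The same argument for one point identifies the distribution
  function \<open>F\<close> of \<open>\<langle>X, u\<rangle>\<close>.

  By independence the law of \<open>H\<^sub>t\<^sub>y\<^sub>p\<close> has density \<open>F\<^sup>m\<close>, \<open>m = n - d\<close>, with respect to the symmetrised
  law of \<open>h\<close>. Stein's identity for \<open>\<phi>(h) = (h - h\<^sub>0) F(h)\<^sup>m\<close>, made odd, yields
  \<open>E[(H - h\<^sub>0) ((d - 1)\<^sup>2 H - m g(H))] = E[1 - H\<^sup>2] \<le> 1\<close>, where \<open>g = (1 - h\<^sup>2) F' / F\<close> is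
  decreasing. With \<open>(d - 1)\<^sup>2 h\<^sub>0 = m g(0)\<close> this bounds the second moment of \<open>H - h\<^sub>0\<close> by
  \<open>1 / (d - 1)\<^sup>2\<close> plus \<open>o(h\<^sub>0\<^sup>2)\<close>. Finally \<open>g(0) \<sim> \<surd>(2 d / \<pi>)\<close> by Wallis' product, so that
  \<open>h\<^sub>0 \<sim> \<surd>(2 / \<pi>) m / d\<^sup>3\<^sup>/\<^sup>2\<close>, and \<open>1 / d\<close> is of smaller order because \<open>\<surd>d\<close> is smaller than \<open>m\<close>.
\<close>

section \<open>Lorentz boosts of the uniform distribution on the sphere\<close>

text \<open>Boosts are used because rotations leave \<open>h\<close> unchanged, whereas the boost in
  direction e_j moves \<open>h\<close> with speed u_j (1 - h^2), so that (u_j, h) obeys a closed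
  differential equation. The uniform law is a cone measure; its Jacobian is therefore computed in
  R^d without calculus on the sphere: a boost of the light cone changes a single coordinate, and the
  ball becomes a star-shaped set that is rescaled along rays. The pair (u, h) is determined only up
  to a common sign, and a facet may have either orientation. Both signs are carried along, which is
  why the law is symmetrised. The centre h_0 is the zero of the drift (d - 1)^2 h - m g(0), with
  \<open>g\<close> frozen at 0. Freezing costs at most m h_0 (g(0) - g(h_0)), which after division
  by (d - 1)^2 equals h_0^2 (1 - g(h_0) / g(0)). The ratio tends to 1 once d h_0^2 tends to 0, and
  this is where n - d must be small compared with d.\<close>

abbreviation Leb :: "nat set \<Rightarrow> (nat \<Rightarrow> real) measure" where
  "Leb K \<equiv> \<Pi>\<^sub>M j\<in>K. lborel"

text \<open>The density \<open>g'\<close> pushed forward by \<open>g\<close> agrees with Lebesgue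
  measure on intervals, by the fundamental theorem of calculus; passing from open to closed
  intervals changes only null sets. Strict monotonicity of \<open>g\<close> turns the right inverse
  \<open>k\<close> into a two-sided one.\<close>

lemma lborel_substitution:
  fixes g g' k :: "real \<Rightarrow> real"
  assumes der: "\<And>x. (g has_real_derivative g' x) (at x)" and pos: "\<And>x. 0 < g' x"
    and inv: "\<And>y. g (k y) = y" and [measurable]: "g' \<in> borel_measurable borel"
      "f \<in> borel_measurable borel"
  shows "(\<integral>\<^sup>+x. f x \<partial>lborel) = (\<integral>\<^sup>+x. f (g x) * ennreal (g' x) \<partial>lborel)"
proof -
  have "continuous_on UNIV g"
    using der by (intro continuous_at_imp_continuous_on) (auto intro: DERIV_isCont)
  then have [measurable]: "g \<in> borel_measurable borel"
    by (rule borel_measurable_continuous_onI)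
  have mono: "strict_mono g"
  proof (rule strict_monoI)
    fix x y :: real assume "x < y"
    then show "g x < g y" by (rule DERIV_pos_imp_increasing) (metis der pos)
  qed
  have iff: "g x < y \<longleftrightarrow> x < k y" "y < g x \<longleftrightarrow> k y < x" for x y
    using strict_mono_less[OF mono] inv by metis+
  have "lborel = distr (density lborel g') borel g"
  proof (rule lborel_eqI)
    fix l u :: real assume "\<And>b. b \<in> Basis \<Longrightarrow> l \<bullet> b \<le> u \<bullet> b"
    then have lu: "l \<le> u" by simp
    then have kk: "k l \<le> k u" using iff inv by (metis linorder_not_less)
    have vi: "g -` {l<..<u} = {k l<..<k u}" by (auto simp: iff)
    have "emeasure (distr (density lborel g') borel g) (box l u)
        = (\<integral>\<^sup>+x\<in>{k l<..<k u}. ennreal (g' x) \<partial>lborel)"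
      by (simp add: emeasure_distr vi emeasure_density)
    also have "\<dots> = (\<integral>\<^sup>+x\<in>{k l..k u}. ennreal (g' x) \<partial>lborel)"
    proof (rule nn_integral_cong_AE)
      have "AE x in lborel. x \<noteq> k l \<and> x \<noteq> k u" by (simp add: AE_lborel_singleton)
      then show "AE x in lborel. ennreal (g' x) * indicator {k l<..<k u} x =
          ennreal (g' x) * indicator {k l..k u} x"
        by eventually_elim (auto split: split_indicator)
    qed
    also have "\<dots> = ennreal (g (k u) - g (k l))"
      by (rule nn_integral_FTC_Icc) (use der pos kk in \<open>auto simp: less_imp_le\<close>)
    finally show "emeasure (distr (density lborel g') borel g) (box l u)
        = ennreal (prod ((\<bullet>) (u - l)) Basis)"
      by (simp add: inv)
  qed simp
  then have "(\<integral>\<^sup>+x. f x \<partial>lborel) = (\<integral>\<^sup>+x. f x \<partial>distr (density lborel g') borel g)" by metis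
  also have "\<dots> = (\<integral>\<^sup>+x. f (g x) * ennreal (g' x) \<partial>lborel)"
    by (simp add: nn_integral_distr nn_integral_density mult.commute)
  finally show ?thesis .
qed

lemma Leb_scale:
  assumes [measurable]: "f \<in> borel_measurable (Leb K)" and "finite K" "0 < s"
  shows "(\<integral>\<^sup>+z. f z \<partial>Leb K) = ennreal (s ^ card K) * (\<integral>\<^sup>+z. f (\<lambda>i\<in>K. s * z i) \<partial>Leb K)"
proof -
  interpret product_sigma_finite "\<lambda>_::nat. lborel :: real measure" ..
  let ?D = "distr (density (Leb K) (\<lambda>_. ennreal (s ^ card K))) (Leb K) (\<lambda>z. \<lambda>i\<in>K. s * z i)"
  have [measurable]: "(\<lambda>z. \<lambda>i\<in>K. s * z i) \<in> Leb K \<rightarrow>\<^sub>M Leb K"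
    by (rule measurable_restrict) simp
  have "?D = Leb K"
  proof (rule PiM_eqI)
    fix A :: "nat \<Rightarrow> real set" assume A: "\<And>i. i \<in> K \<Longrightarrow> A i \<in> sets lborel"
    have [measurable]: "Pi\<^sub>E K A \<in> sets (Leb K)"
      using A \<open>finite K\<close> by (intro sets_PiM_I_finite) auto
    have S: "(\<lambda>x. s * x) -` A i \<in> sets lborel" if "i \<in> K" for i
      using measurable_sets[of "\<lambda>x. s * x" borel borel "A i"] A[OF that] by simp
    have e: "emeasure lborel (A i) = ennreal s * emeasure lborel ((\<lambda>x. s * x) -` A i)" if "i \<in> K" for i
    proof -
      have "emeasure lborel (A i) = (\<integral>\<^sup>+x. indicator (A i) x \<partial>lborel)" using A[OF that] by simp
      also have "\<dots> = ennreal \<bar>s\<bar> * (\<integral>\<^sup>+x. indicator (A i) (0 + s * x) \<partial>lborel)"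
        using A[OF that] \<open>0 < s\<close> by (intro nn_integral_real_affine) auto
      also have "(\<integral>\<^sup>+x. indicator (A i) (0 + s * x) \<partial>lborel) =
          (\<integral>\<^sup>+x. indicator ((\<lambda>x. s * x) -` A i) x \<partial>lborel)"
        by (intro nn_integral_cong) (auto split: split_indicator)
      finally show ?thesis using S[OF that] \<open>0 < s\<close> by simp
    qed
    have "emeasure ?D (Pi\<^sub>E K A) = ennreal (s ^ card K) *
        emeasure (Leb K) ((\<lambda>z. \<lambda>i\<in>K. s * z i) -` Pi\<^sub>E K A \<inter> space (Leb K))"
      by (simp add: emeasure_distr emeasure_density nn_integral_cmult_indicator)
    also have "(\<lambda>z. \<lambda>i\<in>K. s * z i) -` Pi\<^sub>E K A \<inter> space (Leb K) =
        Pi\<^sub>E K (\<lambda>i. (\<lambda>x. s * x) -` A i)"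
      by (auto simp: space_PiM PiE_iff)
    also have "emeasure (Leb K) (Pi\<^sub>E K (\<lambda>i. (\<lambda>x. s * x) -` A i)) =
        (\<Prod>i\<in>K. emeasure lborel ((\<lambda>x. s * x) -` A i))"
      using S \<open>finite K\<close> by (intro emeasure_PiM) auto
    also have "ennreal (s ^ card K) * \<dots> = (\<Prod>i\<in>K. emeasure lborel (A i))"
      using \<open>0 < s\<close> by (simp add: e prod.distrib ennreal_power)
    finally show "emeasure ?D (Pi\<^sub>E K A) = (\<Prod>i\<in>K. emeasure lborel (A i))" .
  qed (use \<open>finite K\<close> in auto)
  then have "(\<integral>\<^sup>+z. f z \<partial>Leb K) = (\<integral>\<^sup>+z. f z \<partial>?D)" by simp
  also have "\<dots> = (\<integral>\<^sup>+z. ennreal (s ^ card K) * f (\<lambda>i\<in>K. s * z i) \<partial>Leb K)"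
    by (simp add: nn_integral_distr nn_integral_density)
  also have "\<dots> = ennreal (s ^ card K) * (\<integral>\<^sup>+z. f (\<lambda>i\<in>K. s * z i) \<partial>Leb K)"
    by (rule nn_integral_cmult) measurable
  finally show ?thesis .
qed

lemma AE_Leb_component_nonzero:
  assumes "finite K" "i \<in> K"
  shows "AE z in Leb K. z i \<noteq> 0"
proof -
  interpret product_sigma_finite "\<lambda>_::nat. lborel :: real measure" ..
  let ?A = "\<lambda>j. if j = i then {0} else UNIV :: real set"
  have "emeasure (Leb K) (Pi\<^sub>E K ?A) = (\<Prod>j\<in>K. emeasure lborel (?A j))"
    using assms by (intro emeasure_PiM) auto
  also have "\<dots> = 0" using assms by auto
  finally have "Pi\<^sub>E K ?A \<in> null_sets (Leb K)"
    using assms by (intro null_setsI sets_PiM_I_finite) auto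
  then show ?thesis by (rule AE_I') (auto simp: space_PiM PiE_iff extensional_def)
qed

lemma AE_Leb_nrm: "1 \<le> d \<Longrightarrow> AE z in Leb {..<d}. 0 < nrm d z"
proof -
  assume d: "1 \<le> d"
  have "AE z in Leb {..<d}. z 0 \<noteq> 0" using d by (intro AE_Leb_component_nonzero) auto
  then show ?thesis
  proof eventually_elim
    fix z :: "nat \<Rightarrow> real" assume "z 0 \<noteq> 0"
    moreover have "z 0 * z 0 \<le> ip d z z" unfolding ip_def
      using d by (intro member_le_sum) auto
    ultimately show "0 < nrm d z" unfolding nrm_def
      by (metis less_le_trans mult_eq_0_iff not_real_square_gt_zero real_sqrt_gt_zero)
  qed
qed

lemma ip_nonneg: "0 \<le> ip d x x"
  unfolding ip_def by (intro sum_nonneg) simp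

lemma nrm_nonneg: "0 \<le> nrm d x"
  unfolding nrm_def by (simp add: ip_nonneg)

lemma nrm_scale: "0 < s \<Longrightarrow> nrm d (\<lambda>i\<in>{..<d}. s * z i) = s * nrm d z"
proof -
  assume "0 < s"
  have "ip d (\<lambda>i\<in>{..<d}. s * z i) (\<lambda>i\<in>{..<d}. s * z i) = s\<^sup>2 * ip d z z"
    unfolding ip_def by (simp add: sum_distrib_left power2_eq_square ac_simps)
  then show ?thesis using \<open>0 < s\<close> by (simp add: nrm_def real_sqrt_mult)
qed

lemma radial_proj_scale: "0 < s \<Longrightarrow> radial_proj d (\<lambda>i\<in>{..<d}. s * z i) = radial_proj d z"
  unfolding radial_proj_def by (auto simp: nrm_scale)

text \<open>A substitute for polar coordinates: the set on the left is star-shaped with radial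
  function \<open>1 / \<rho>\<close>, so in each direction it has \<open>1 / \<rho> ^ d\<close>
  times the volume of the ball. The factor 1 = |z|^d times the integral of d / s^(d+1) over s >= |z|
  is inserted (\<open>out\<close>). After exchanging the integrals, \<open>z\<close> is replaced by
  \<open>s * z\<close> for fixed \<open>s\<close>, and after exchanging them back the remaining
  integral over \<open>s\<close> is elementary (\<open>inn\<close>).\<close>

lemma Leb_directional_scale:
  fixes G :: "(nat \<Rightarrow> real) \<Rightarrow> ennreal" and \<rho> :: "(nat \<Rightarrow> real) \<Rightarrow> real"
  assumes d: "1 \<le> d" and [measurable]: "G \<in> borel_measurable borel" "\<rho> \<in> borel_measurable borel"
    and \<rho>: "\<And>z. 0 < nrm d z \<Longrightarrow> 0 < \<rho> (radial_proj d z)"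
  shows "(\<integral>\<^sup>+z. G (radial_proj d z) * indicator {z. nrm d z * \<rho> (radial_proj d z) \<le> 1} z \<partial>Leb {..<d})
    = (\<integral>\<^sup>+z. G (radial_proj d z) * ennreal (1 / \<rho> (radial_proj d z) ^ d) * indicator {z. nrm d z \<le> 1} z
        \<partial>Leb {..<d})"
proof -
  let ?L = "Leb {..<d}" and ?p = "radial_proj d"
  let ?k = "\<lambda>z s. ennreal (real d * s ^ (d - 1)) * (if 0 < s \<and> s * nrm d z * \<rho> (?p z) \<le>
      1 then 1 else 0)"
  let ?f = "\<lambda>z s. G (?p z) * (if nrm d z * \<rho> (?p z) \<le> 1 then 1 else 0) * ennreal (nrm d z ^ d) *
       (ennreal (real d / s ^ (d + 1)) * (if 0 < s \<and> nrm d z \<le> s then 1 else 0))"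
  let ?g = "\<lambda>z s. G (?p z) * ennreal (nrm d z ^ d) * (if nrm d z \<le> 1 then 1 else 0) * ?k z s"
  interpret L: product_sigma_finite "\<lambda>_::nat. lborel :: real measure" ..
  interpret L: sigma_finite_measure ?L by (rule L.sigma_finite) simp
  interpret P: pair_sigma_finite ?L "lborel :: real measure" ..
  have [measurable]: "(\<lambda>z. \<lambda>i\<in>{..<d}. s * z i) \<in> ?L \<rightarrow>\<^sub>M ?L" for s :: real
    by (rule measurable_restrict) simp
  have [measurable]: "radial_proj d \<in> ?L \<rightarrow>\<^sub>M borel" "nrm d \<in> borel_measurable ?L" by measurable
  have out: "(\<integral>\<^sup>+s. ennreal (real d / s ^ (d + 1)) * indicator {r..} s \<partial>lborel) = ennreal (1 / r ^ d)"
    if "0 < r" for r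
  proof -
    have "((\<lambda>s::real. - (1 / s ^ d)) \<longlongrightarrow> - 0) at_top"
      using d by (intro tendsto_minus tendsto_divide_0[OF tendsto_const]
          filterlim_at_top_imp_at_infinity
          filterlim_pow_at_top filterlim_ident) auto
    then have "(\<integral>\<^sup>+s. ennreal (real d / s ^ (d + 1)) * indicator {r..} s \<partial>lborel) =
        ennreal (0 - (- (1 / r ^ d)))"
      using that
    proof (intro nn_integral_FTC_atLeast)
      fix x assume "r \<le> x"
      then have "0 < x" using that by simp
      have "(x * x ^ (d - 1)) * real d * x ^ d = real d * (x ^ d * x ^ d)"
        using d by (simp add: power_eq_if)
      then have "real d * x ^ (d - 1) / (x ^ d * x ^ d) = real d / x ^ (d + 1)"
        using \<open>0 < x\<close> by (simp add: frac_eq_eq ac_simps)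
      moreover have "((\<lambda>s. - (1 / s ^ d)) has_real_derivative real d * x ^ (d - 1) /
          (x ^ d * x ^ d)) (at x)"
        using \<open>0 < x\<close> by (auto intro!: derivative_eq_intros)
      ultimately show "((\<lambda>s. - (1 / s ^ d)) has_real_derivative real d / x ^ (d + 1)) (at x)"
        by simp
    qed auto
    then show ?thesis by simp
  qed
  have inn: "(\<integral>\<^sup>+s. ennreal (real d * s ^ (d - 1)) * indicator {0..a} s \<partial>lborel) = ennreal (a ^ d)"
    if "0 < a" for a
  proof -
    have "(\<integral>\<^sup>+s. ennreal (real d * s ^ (d - 1)) * indicator {0..a} s \<partial>lborel) = ennreal (a ^ d - 0 ^ d)"
      using that by (intro nn_integral_FTC_Icc) (auto intro!: derivative_eq_intros)
    then show ?thesis using d by (simp add: power_0_left)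
  qed
  have "(\<integral>\<^sup>+z. G (?p z) * indicator {z. nrm d z * \<rho> (?p z) \<le> 1} z \<partial>?L) =
    (\<integral>\<^sup>+z. (\<integral>\<^sup>+s. ?f z s \<partial>lborel) \<partial>?L)"
  proof (rule nn_integral_cong_AE)
    show "AE z in ?L. G (?p z) * indicator {z. nrm d z * \<rho> (?p z) \<le> 1} z =
      (\<integral>\<^sup>+s. ?f z s \<partial>lborel)"
      using AE_Leb_nrm[OF d]
    proof eventually_elim
      case (elim z)
      then have z: "0 < nrm d z" .
      have "(\<integral>\<^sup>+s. ennreal (real d / s ^ (d + 1)) * (if 0 < s \<and> nrm d z \<le> s then 1 else 0) \<partial>lborel) =
          (\<integral>\<^sup>+s. ennreal (real d / s ^ (d + 1)) * indicator {nrm d z..} s \<partial>lborel)"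
        using z by (intro nn_integral_cong) (auto split: split_indicator)
      also have "\<dots> = ennreal (1 / nrm d z ^ d)" by (rule out[OF z])
      finally show ?case using z
        by (subst nn_integral_cmult)
           (auto simp: indicator_def mult.assoc ennreal_mult[symmetric])
    qed
  qed
  also have "\<dots> = (\<integral>\<^sup>+s. (\<integral>\<^sup>+z. ?f z s \<partial>?L) \<partial>lborel)"
    by (rule P.Fubini'[symmetric]) measurable
  also have "\<dots> = (\<integral>\<^sup>+s. (\<integral>\<^sup>+z. ?g z s \<partial>?L) \<partial>lborel)"
  proof (rule nn_integral_cong)
    fix s :: real
    show "(\<integral>\<^sup>+z. ?f z s \<partial>?L) =
      (\<integral>\<^sup>+z. ?g z s \<partial>?L)"
    proof (cases "0 < s")
      case True
      obtain e where e: "d = Suc e" using d by (cases d) auto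
      have sc: "ennreal (s ^ d) * (ennreal ((s * r) ^ d) * ennreal (real d / s ^ (d + 1))) =
          ennreal (r ^ d) * ennreal (real d * s ^ (d - 1))" if "0 \<le> r" for r
        using True that
        by (simp add: ennreal_mult[symmetric] e field_simps del: of_nat_Suc)
      have sc': "ennreal (s ^ d) * (g * (if s * r * q \<le> 1 then 1 else 0) * ennreal ((s * r) ^ d) *
          (ennreal (real d / s ^ (d + 1)) * (if 0 < s \<and> s * r \<le> s then 1 else 0))) =
          g * ennreal (r ^ d) * (if r \<le> 1 then 1 else 0) *
          (ennreal (real d * s ^ (d - 1)) * (if 0 < s \<and> s * r * q \<le> 1 then 1 else 0))"
        if "0 \<le> r" for r q :: real and g :: ennreal
      proof -
        have c: "s * r \<le> s \<longleftrightarrow> r \<le> 1" using True by simp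
        have "ennreal (s ^ d) * (g * ennreal ((s * r) ^ d) * ennreal (real d / s ^ (d + 1))) =
            g * (ennreal (s ^ d) * (ennreal ((s * r) ^ d) * ennreal (real d / s ^ (d + 1))))"
          by (simp only: ac_simps)
        then show ?thesis by (simp only: c True sc[OF that]) (simp add: ac_simps)
      qed
      show ?thesis
        apply (subst Leb_scale[OF _ _ True])
          apply measurable
         apply simp
        apply (subst nn_integral_cmult[symmetric])
         apply measurable
        apply (rule nn_integral_cong)
        subgoal for z
          using sc'[OF nrm_nonneg[of d z], of "G (?p z)" "\<rho> (?p z)"]
          by (simp add: nrm_scale[OF True] radial_proj_scale[OF True])
        done
    qed simp
  qed
  also have "\<dots> = (\<integral>\<^sup>+z. (\<integral>\<^sup>+s. ?g z s \<partial>lborel) \<partial>?L)"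
    by (rule P.Fubini') measurable
  also have "\<dots> = (\<integral>\<^sup>+z. G (?p z) * ennreal (1 / \<rho> (?p z) ^ d) * indicator {z. nrm d z \<le> 1} z
        \<partial>?L)"
  proof (rule nn_integral_cong_AE)
    show "AE z in ?L. (\<integral>\<^sup>+s. ?g z s \<partial>lborel)
       = G (?p z) * ennreal (1 / \<rho> (?p z) ^ d) * indicator {z. nrm d z \<le> 1} z"
      using AE_Leb_nrm[OF d]
    proof eventually_elim
      case (elim z)
      then have z: "0 < nrm d z" .
      let ?a = "1 / (nrm d z * \<rho> (?p z))"
      have pos: "0 < ?a" "0 < \<rho> (?p z)" using z \<rho>[OF z] by auto
      have "(\<integral>\<^sup>+s. ?k z s \<partial>lborel) =
          (\<integral>\<^sup>+s. ennreal (real d * s ^ (d - 1)) * indicator {0..?a} s \<partial>lborel)"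
      proof (rule nn_integral_cong_AE)
        have "AE s in lborel. s \<noteq> (0::real)" by (rule AE_lborel_singleton)
        then show "AE s in lborel. ?k z s =
            ennreal (real d * s ^ (d - 1)) * indicator {0..?a} s"
          by eventually_elim (use z pos in \<open>auto simp: field_simps split: split_indicator\<close>)
      qed
      also have "\<dots> = ennreal (?a ^ d)" by (rule inn[OF pos(1)])
      finally have I: "(\<integral>\<^sup>+s. ?k z s \<partial>lborel) = ennreal (?a ^ d)" .
      have "ennreal (nrm d z ^ d) * ennreal (?a ^ d) = ennreal (1 / \<rho> (?p z) ^ d)"
        using z pos by (simp add: ennreal_mult[symmetric] power_mult_distrib power_divide)
      then show ?case
        by (subst nn_integral_cmult, measurable, simp only: I) (simp add: indicator_def mult.assoc)
    qed
  qed
  finally show ?thesis .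
qed


lemma coord_borel [measurable]: "(\<lambda>x::nat \<Rightarrow> real. x j) \<in> borel_measurable borel"
  by (intro borel_measurable_continuous_onI continuous_on_product_coordinates)

text \<open>The expression is a convex combination of \<open>exp t\<close> and
  \<open>exp (- t)\<close> with weights \<open>(1 + v) / 2\<close> and \<open>(1 - v) / 2\<close>.
  It is the conformal factor of a boost at a point whose coordinate is \<open>v\<close>.\<close>

lemma cosh_sinh_bounds:
  fixes v t :: real assumes "\<bar>v\<bar> \<le> 1"
  shows "exp (- \<bar>t\<bar>) \<le> cosh t + v * sinh t" "cosh t + v * sinh t \<le> exp \<bar>t\<bar>"
    "0 < cosh t + v * sinh t"
proof -
  have eq: "cosh t + v * sinh t = ((1 + v) / 2) * exp t + ((1 - v) / 2) * exp (- t)"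
    by (simp add: cosh_field_def sinh_field_def field_simps)
  have b: "exp (- \<bar>t\<bar>) \<le> exp t" "exp (- \<bar>t\<bar>) \<le> exp (- t)" "exp t \<le> exp \<bar>t\<bar>" "exp (- t) \<le> exp \<bar>t\<bar>"
    by auto
  have v: "0 \<le> (1 + v) / 2" "0 \<le> (1 - v) / 2" using assms by (auto simp: abs_le_iff)
  have "((1 + v) / 2) * exp (- \<bar>t\<bar>) + ((1 - v) / 2) * exp (- \<bar>t\<bar>) \<le> cosh t + v * sinh t"
    unfolding eq by (intro add_mono mult_left_mono b v)
  then show 1: "exp (- \<bar>t\<bar>) \<le> cosh t + v * sinh t" by (simp add: field_simps)
  have "cosh t + v * sinh t \<le> ((1 + v) / 2) * exp \<bar>t\<bar> + ((1 - v) / 2) * exp \<bar>t\<bar>"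
    unfolding eq by (intro add_mono mult_left_mono b v)
  then show "cosh t + v * sinh t \<le> exp \<bar>t\<bar>" by (simp add: field_simps)
  show "0 < cosh t + v * sinh t" using 1 by (meson exp_gt_zero less_le_trans)
qed

lemma nrm_fun_upd:
  assumes "j < d"
  shows "nrm d (z(j := y)) = sqrt (y\<^sup>2 + (\<Sum>i\<in>{..<d} - {j}. (z i)\<^sup>2))"
proof -
  have "ip d (z(j := y)) (z(j := y)) = y * y + (\<Sum>i\<in>{..<d} - {j}. (z(j := y)) i * (z(j := y)) i)"
    unfolding ip_def using assms by (subst sum.remove[of _ j]) auto
  also have "(\<Sum>i\<in>{..<d} - {j}. (z(j := y)) i * (z(j := y)) i) = (\<Sum>i\<in>{..<d} - {j}. (z i)\<^sup>2)"
    by (intro sum.cong) (auto simp: power2_eq_square)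
  finally show ?thesis by (simp only: nrm_def power2_eq_square)
qed

text \<open>The map below is the Lorentz boost of the light cone, parametrised by its projection to
  \<open>\<real>\<^sup>d\<close>. It moves only one coordinate.\<close>

lemma Leb_boost:
  assumes d: "2 \<le> d" "j < d" and [measurable]: "g \<in> borel_measurable (Leb {..<d})"
  shows "(\<integral>\<^sup>+z. g z \<partial>Leb {..<d}) =
    (\<integral>\<^sup>+z. g (z(j := z j * cosh t + nrm d z * sinh t)) * ennreal (cosh t + z j / nrm d z *
        sinh t) \<partial>Leb {..<d})"
proof -
  interpret product_sigma_finite "\<lambda>_::nat. lborel :: real measure" ..
  define K where "K = {..<d} - {j}"
  have ins: "{..<d} = insert j K" "j \<notin> K" "finite K" using d by (auto simp: K_def)
  let ?r = "\<lambda>z y. sqrt (y\<^sup>2 + (\<Sum>i\<in>K. (z i)\<^sup>2))"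
  have zj [measurable]: "(\<lambda>z. z j) \<in> borel_measurable (Leb {..<d})"
    using d measurable_component_singleton[of j "{..<d}" "\<lambda>_. lborel"] by simp
  have c: "(\<lambda>z. z j * cosh t + nrm d z * sinh t) \<in> Leb {..<d} \<rightarrow>\<^sub>M lborel"
    by measurable
  have [measurable]: "(\<lambda>z. z(j := z j * cosh t + nrm d z * sinh t)) \<in> Leb {..<d} \<rightarrow>\<^sub>M Leb {..<d}"
    using d c by (intro measurable_fun_upd[where J = "{..<d}"]) auto
  have m: "(\<lambda>z. g (z(j := z j * cosh t + nrm d z * sinh t)) * ennreal (cosh t + z j / nrm d z * sinh t))
      \<in> borel_measurable (Leb {..<d})"
    by measurable
  \<comment> \<open>A coordinate \<open>i\<close> other than \<open>j\<close> exists because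
    \<open>2 \<le> d\<close>. It is almost everywhere nonzero, so that \<open>a > 0\<close> below
    and the square root is differentiable at every \<open>y\<close>.\<close>
  have "(if j = 0 then 1 else 0) \<in> K" using d by (auto simp: K_def)
  then obtain i where i: "i \<in> K" ..
  have "(\<integral>\<^sup>+z. g z \<partial>Leb {..<d}) = (\<integral>\<^sup>+x. (\<integral>\<^sup>+y. g (x(j := y)) \<partial>lborel) \<partial>Leb K)"
    unfolding ins(1) using ins assms(3) by (intro product_nn_integral_insert) auto
  also have "\<dots> = (\<integral>\<^sup>+x. (\<integral>\<^sup>+y. g (x(j := y * cosh t + ?r x y * sinh t)) *
      ennreal (cosh t + y / ?r x y * sinh t) \<partial>lborel) \<partial>Leb K)"
  proof (rule nn_integral_cong_AE)
    have "AE x in Leb K. x i \<noteq> 0" using i ins by (intro AE_Leb_component_nonzero) auto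
    then show "AE x in Leb K. (\<integral>\<^sup>+y. g (x(j := y)) \<partial>lborel) =
        (\<integral>\<^sup>+y. g (x(j := y * cosh t + ?r x y * sinh t)) *
      ennreal (cosh t + y / ?r x y * sinh t) \<partial>lborel)"
      using AE_space
    proof eventually_elim
      case (elim x)
      define a where "a = (\<Sum>i\<in>K. (x i)\<^sup>2)"
      have "(x i)\<^sup>2 \<le> a" unfolding a_def using i ins by (intro member_le_sum) auto
      then have a: "0 < a" using elim by (meson less_le_trans zero_less_power2)
      have r: "0 < sqrt (y\<^sup>2 + a)" "\<bar>y / sqrt (y\<^sup>2 + a)\<bar> \<le> 1" for y
      proof -
        show 1: "0 < sqrt (y\<^sup>2 + a)" using a by (simp add: add_nonneg_pos)
        have "\<bar>y\<bar> \<le> sqrt (y\<^sup>2 + a)" using a by (simp add: real_le_rsqrt)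
        then show "\<bar>y / sqrt (y\<^sup>2 + a)\<bar> \<le> 1" using 1 by (simp add: abs_divide)
      qed
      have m': "(\<lambda>y. g (x(j := y))) \<in> borel_measurable borel"
      proof -
        have "(\<lambda>y. x(j := y)) \<in> lborel \<rightarrow>\<^sub>M Leb {..<d}"
          unfolding ins(1) using elim ins by (intro measurable_component_update) auto
        then show ?thesis by simp
      qed
      \<comment> \<open>The inverse substitution is the boost with rapidity \<open>- t\<close>. It
        rests on \<open>sqrt ((?k y)^2 + a) = ?s * cosh t - y * sinh t\<close>, where the sign of
        the root is settled by \<open>cosh_sinh_bounds\<close>.\<close>
      let ?k = "\<lambda>y. y * cosh t - sqrt (y\<^sup>2 + a) * sinh t"
      have "(\<integral>\<^sup>+y. g (x(j := y)) \<partial>lborel) = (\<integral>\<^sup>+y. g (x(j := y * cosh t + sqrt (y\<^sup>2 + a) * sinh t)) *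
          ennreal (cosh t + y / sqrt (y\<^sup>2 + a) * sinh t) \<partial>lborel)"
      proof (rule lborel_substitution[where k = ?k])
        fix y :: real
        have p: "0 < y\<^sup>2 + a" using a by (simp add: add_nonneg_pos)
        show "((\<lambda>y. y * cosh t + sqrt (y\<^sup>2 + a) * sinh t) has_real_derivative
            cosh t + y / sqrt (y\<^sup>2 + a) * sinh t) (at y)"
          by (rule derivative_eq_intros refl | use p in \<open>force simp: field_simps\<close>)+
        show "0 < cosh t + y / sqrt (y\<^sup>2 + a) * sinh t"
          by (rule cosh_sinh_bounds[OF r(2)])
        let ?s = "sqrt (y\<^sup>2 + a)"
        have s2: "?s\<^sup>2 = y\<^sup>2 + a" using p by simp
        have cs: "(cosh t)\<^sup>2 = (sinh t)\<^sup>2 + 1" using cosh_square_eq[of t] by simp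
        have "0 \<le> cosh t + (- (y / ?s)) * sinh t"
          using cosh_sinh_bounds(3)[of "- (y / ?s)" t] r(2)[of y] by simp
        then have "0 \<le> ?s * (cosh t + (- (y / ?s)) * sinh t)" using r(1)[of y] by simp
        then have nn: "0 \<le> ?s * cosh t - y * sinh t" using r(1)[of y] by (simp add: algebra_simps)
        have "(?k y)\<^sup>2 + a = (?s * cosh t - y * sinh t)\<^sup>2"
          using s2 cs by algebra
        then have "sqrt ((?k y)\<^sup>2 + a) = ?s * cosh t - y * sinh t" using nn by simp
        then have "?k y * cosh t + sqrt ((?k y)\<^sup>2 + a) * sinh t = y * ((cosh t)\<^sup>2 - (sinh t)\<^sup>2)"
          by (simp only:) (simp add: algebra_simps power2_eq_square)
        then show "?k y * cosh t + sqrt ((?k y)\<^sup>2 + a) * sinh t = y" by (simp add: cs)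
      qed (use m' in measurable)
      then show ?case by (simp add: a_def)
    qed
  qed
  also have "\<dots> = (\<integral>\<^sup>+z. g (z(j := z j * cosh t + nrm d z * sinh t)) * ennreal (cosh t + z j / nrm d z *
      sinh t) \<partial>Leb {..<d})"
    using m ins unfolding ins(1)
    by (subst product_nn_integral_insert) (auto simp: nrm_fun_upd[OF d(2)] K_def)
  finally show ?thesis .
qed

text \<open>The boost with rapidity \<open>t\<close> in direction \<open>e\<^sub>j\<close>.\<close>

definition boost :: "nat \<Rightarrow> real \<Rightarrow> (nat \<Rightarrow> real) \<Rightarrow> nat \<Rightarrow> real" where
  "boost j t x = (\<lambda>i. (if i = j then x j * cosh t + sinh t else x i) / (cosh t + x j * sinh t))"

lemma boost_measurable [measurable]: "boost j t \<in> borel_measurable borel"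
proof (rule measurable_coordinatewise_then_product)
  show "(\<lambda>x. boost j t x i) \<in> borel_measurable borel" for i
    unfolding boost_def by (cases "i = j") simp_all
qed

lemma radial_proj_component: "0 < nrm d z \<Longrightarrow> \<bar>radial_proj d z i\<bar> \<le> 1"
proof (cases "i < d")
  case True
  assume n: "0 < nrm d z"
  have "z i * z i \<le> ip d z z" unfolding ip_def using True by (intro member_le_sum) auto
  then have "\<bar>z i\<bar> \<le> nrm d z" unfolding nrm_def by (simp add: real_le_rsqrt power2_eq_square)
  then show ?thesis using True n by (simp add: radial_proj_def abs_divide)
qed (simp add: radial_proj_def)

lemma nn_integral_uniform_sphere:
  assumes [measurable]: "f \<in> borel_measurable borel"
  shows "(\<integral>\<^sup>+x. f x \<partial>uniform_sphere d) =
    (\<integral>\<^sup>+z. f (radial_proj d z) * indicator {z. nrm d z \<le> 1} z \<partial>Leb {..<d}) /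
        emeasure (Leb {..<d}) (unit_ball d)"
proof -
  have "(\<integral>\<^sup>+x. f x \<partial>uniform_sphere d) =
    (\<integral>\<^sup>+z. f (radial_proj d z) * indicator (unit_ball d) z \<partial>Leb {..<d}) /
        emeasure (Leb {..<d}) (unit_ball d)"
    unfolding uniform_sphere_def
    by (subst nn_integral_distr, simp, simp, subst nn_integral_uniform_measure) simp_all
  also have "(\<integral>\<^sup>+z. f (radial_proj d z) * indicator (unit_ball d) z \<partial>Leb {..<d}) =
      (\<integral>\<^sup>+z. f (radial_proj d z) * indicator {z. nrm d z \<le> 1} z \<partial>Leb {..<d})"
    by (intro nn_integral_cong) (auto simp: unit_ball_def split: split_indicator)
  finally show ?thesis .
qed

text \<open>Boosting R^d has Jacobian \<open>\<rho> = cosh t + x j * sinh t\<close> and multiplies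
  norms by the same factor. The unit ball thus pulls back to the star-shaped set of
  \<open>Leb_directional_scale\<close>, which contributes \<open>1 / \<rho> ^ d\<close>; the product
  of both factors has exponent \<open>d - 1\<close>, the dimension of the sphere.\<close>

lemma nn_integral_boost:
  assumes d: "2 \<le> d" "j < d" and [measurable]: "f \<in> borel_measurable borel"
  shows "(\<integral>\<^sup>+x. f x \<partial>uniform_sphere d) =
    (\<integral>\<^sup>+x. f (boost j t x) * ennreal (1 / (cosh t + x j * sinh t) ^ (d - 1)) \<partial>uniform_sphere d)"
proof -
  let ?L = "Leb {..<d}" and ?\<rho> = "\<lambda>x::nat \<Rightarrow> real. cosh t + x j * sinh t"
  have [measurable]: "radial_proj d \<in> ?L \<rightarrow>\<^sub>M borel" "nrm d \<in> borel_measurable ?L" by measurable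
  have "(\<integral>\<^sup>+z. f (radial_proj d z) * indicator {z. nrm d z \<le> 1} z \<partial>?L) =
    (\<integral>\<^sup>+z. f (radial_proj d (z(j := z j * cosh t + nrm d z * sinh t))) *
      indicator {z. nrm d z \<le> 1} (z(j := z j * cosh t + nrm d z * sinh t)) *
      ennreal (cosh t + z j / nrm d z * sinh t) \<partial>?L)"
    by (rule Leb_boost[OF d]) measurable
  also have "\<dots> = (\<integral>\<^sup>+z. (f (boost j t (radial_proj d z)) * ennreal (?\<rho> (radial_proj d z))) *
      indicator {z. nrm d z * ?\<rho> (radial_proj d z) \<le> 1} z \<partial>?L)"
  proof (rule nn_integral_cong_AE)
    have "AE z in ?L. 0 < nrm d z" using d by (intro AE_Leb_nrm) simp
    then show "AE z in ?L. f (radial_proj d (z(j := z j * cosh t + nrm d z * sinh t))) *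
      indicator {z. nrm d z \<le> 1} (z(j := z j * cosh t + nrm d z * sinh t)) *
      ennreal (cosh t + z j / nrm d z * sinh t) =
      (f (boost j t (radial_proj d z)) * ennreal (?\<rho> (radial_proj d z))) *
      indicator {z. nrm d z * ?\<rho> (radial_proj d z) \<le> 1} z"
    proof eventually_elim
      case (elim z)
      let ?r = "nrm d z" and ?z = "z(j := z j * cosh t + nrm d z * sinh t)"
      have zj: "radial_proj d z j = z j / ?r" using d by (simp add: radial_proj_def)
      have pos: "0 < ?\<rho> (radial_proj d z)"
        by (rule cosh_sinh_bounds[OF radial_proj_component[OF elim]])
      have r2: "?r\<^sup>2 = (z j)\<^sup>2 + (\<Sum>i\<in>{..<d} - {j}. (z i)\<^sup>2)"
        using nrm_fun_upd[OF d(2), of z "z j"] by (simp add: sum_nonneg)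
      have cs: "(cosh t)\<^sup>2 = (sinh t)\<^sup>2 + 1" using cosh_square_eq[of t] by simp
      have e: "?r * ?\<rho> (radial_proj d z) = ?r * cosh t + z j * sinh t"
        using elim by (simp add: zj field_simps)
      \<comment> \<open>The boosted vector stays on the light cone: its new time coordinate
        \<open>?r * cosh t + z j * sinh t\<close> is again the norm of its space part.\<close>
      have "(z j * cosh t + ?r * sinh t)\<^sup>2 + (\<Sum>i\<in>{..<d} - {j}. (z i)\<^sup>2) = (?r * cosh t +
          z j * sinh t)\<^sup>2"
        using r2 cs by algebra
      moreover have "0 \<le> ?r * cosh t + z j * sinh t" using e pos elim
          by (metis less_imp_le mult_pos_pos)
      ultimately have n: "nrm d ?z = ?r * ?\<rho> (radial_proj d z)"
        using e by (simp add: nrm_fun_upd[OF d(2)])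
      have "z j * cosh t + ?r * sinh t = ?r * (z j / ?r * cosh t + sinh t)"
        using elim by (simp add: field_simps)
      then have "radial_proj d ?z i = boost j t (radial_proj d z) i" for i
        using elim d unfolding radial_proj_def[of d ?z] n boost_def
        by (cases "i = j") (simp_all add: zj, simp_all add: radial_proj_def)
      then have "radial_proj d ?z = boost j t (radial_proj d z)" by auto
      then show ?case
        by (simp only: n zj indicator_def mem_Collect_eq) (simp only: ac_simps)
    qed
  qed
  also have "\<dots> = (\<integral>\<^sup>+z. (f (boost j t (radial_proj d z)) * ennreal (?\<rho> (radial_proj d z))) *
      ennreal (1 / ?\<rho> (radial_proj d z) ^ d) * indicator {z. nrm d z \<le> 1} z \<partial>?L)"
    using d by (intro Leb_directional_scale) (auto intro!: cosh_sinh_bounds radial_proj_component)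
  also have "\<dots> = (\<integral>\<^sup>+z. f (boost j t (radial_proj d z)) *
      ennreal (1 / ?\<rho> (radial_proj d z) ^ (d - 1)) * indicator {z. nrm d z \<le> 1} z \<partial>?L)"
  proof (rule nn_integral_cong_AE)
    have "AE z in ?L. 0 < nrm d z" using d by (intro AE_Leb_nrm) simp
    then show "AE z in ?L. (f (boost j t (radial_proj d z)) * ennreal (?\<rho> (radial_proj d z))) *
      ennreal (1 / ?\<rho> (radial_proj d z) ^ d) * indicator {z. nrm d z \<le> 1} z =
      f (boost j t (radial_proj d z)) * ennreal (1 / ?\<rho> (radial_proj d z) ^ (d - 1)) *
          indicator {z. nrm d z \<le> 1} z"
    proof eventually_elim
      case (elim z)
      let ?p = "?\<rho> (radial_proj d z)"
      have pos: "0 < ?p" by (rule cosh_sinh_bounds[OF radial_proj_component[OF elim]])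
      obtain e where e: "d = Suc e" using d by (cases d) auto
      have "ennreal ?p * ennreal (1 / ?p ^ d) = ennreal (1 / ?p ^ (d - 1))"
        using pos by (simp add: ennreal_mult[symmetric] e)
      then show ?case by (simp add: mult.assoc)
    qed
  qed
  finally show ?thesis by (simp add: nn_integral_uniform_sphere)
qed

section \<open>Simultaneous boosts of independent points on the sphere\<close>

abbreviation Sph :: "nat \<Rightarrow> nat set \<Rightarrow> (nat \<Rightarrow> nat \<Rightarrow> real) measure" where
  "Sph d I \<equiv> \<Pi>\<^sub>M i\<in>I. uniform_sphere d"

lemma sets_uniform_sphere [measurable_cong, simp]: "sets (uniform_sphere d) = sets borel"
  by (simp add: uniform_sphere_def)

lemma space_uniform_sphere [simp]: "space (uniform_sphere d) = UNIV"
  by (simp add: uniform_sphere_def)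

lemma product_prob_space_Sph: "product_prob_space (\<lambda>_::nat. uniform_sphere d)"
proof -
  interpret prob_space "uniform_sphere d" by (rule prob_space_uniform_sphere)
  show ?thesis ..
qed

lemma prob_space_Sph: "prob_space (Sph d I)"
  by (intro prob_space_PiM prob_space_uniform_sphere)

lemma AE_Sph:
  assumes "1 \<le> d" "finite I"
  shows "AE x in Sph d I. \<forall>i\<in>I. x i \<in> unit_sphere d"
  by (intro AE_finite_allI[OF \<open>finite I\<close>] AE_PiM_component AE_uniform_sphere prob_space_uniform_sphere
      assms)

lemma unit_sphere_ip: "x \<in> unit_sphere d \<Longrightarrow> ip d x x = 1"
  using ip_nonneg[of d x] by (simp add: unit_sphere_def nrm_def)

lemma unit_sphere_component: "x \<in> unit_sphere d \<Longrightarrow> \<bar>x i\<bar> \<le> 1"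
proof (cases "i < d")
  case True
  assume x: "x \<in> unit_sphere d"
  have "x i * x i \<le> ip d x x" unfolding ip_def using True by (intro member_le_sum) auto
  then have "(x i)\<^sup>2 \<le> 1" using unit_sphere_ip[OF x] by (simp add: power2_eq_square)
  then show ?thesis by (simp add: abs_square_le_1)
qed (auto simp: unit_sphere_def Rd_def)

lemma ip_commute: "ip d x y = ip d y x"
  by (simp add: ip_def mult.commute)

lemma ip_boost:
  assumes "j < d"
  shows "ip d (boost j t x) u = (ip d x u + u j * (x j * (cosh t - 1) + sinh t)) / (cosh t +
      x j * sinh t)"
proof -
  have "ip d (boost j t x) u = (\<Sum>i<d. (x i * u i + (if i = j then u j * (x j * (cosh t - 1) +
      sinh t) else 0)) / (cosh t + x j * sinh t))"
    unfolding ip_def boost_def by (intro sum.cong) (auto simp: field_simps)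
  also have "\<dots> = (ip d x u + u j * (x j * (cosh t - 1) + sinh t)) / (cosh t + x j * sinh t)"
    unfolding sum_divide_distrib[symmetric] sum.distrib using assms by (simp add: ip_def)
  finally show ?thesis .
qed

lemma boost_unit_sphere:
  assumes "j < d" "x \<in> unit_sphere d"
  shows "boost j t x \<in> unit_sphere d"
proof -
  have p: "0 < cosh t + x j * sinh t"
    using assms by (intro cosh_sinh_bounds unit_sphere_component)
  have cs: "(cosh t)\<^sup>2 = (sinh t)\<^sup>2 + 1" using cosh_square_eq[of t] by simp
  have gen: "(A / p + B / p * C) / p = (A + B * C) / p\<^sup>2" if "p \<noteq> 0" for A B C p :: real
    using that by (simp add: field_simps power2_eq_square)
  have "ip d x (boost j t x) = (1 + x j * (x j * (cosh t - 1) + sinh t)) / (cosh t + x j * sinh t)"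
    using ip_boost[OF assms(1)] unit_sphere_ip[OF assms(2)] by (simp add: ip_commute)
  then have "ip d (boost j t x) (boost j t x) =
     ((1 + x j * (x j * (cosh t - 1) + sinh t)) / (cosh t + x j * sinh t) +
      (x j * cosh t + sinh t) / (cosh t + x j * sinh t) * (x j * (cosh t - 1) + sinh t)) / (cosh t +
          x j * sinh t)"
    by (subst ip_boost[OF assms(1)]) (simp add: boost_def)
  also have "\<dots> = ((1 + x j * (x j * (cosh t - 1) + sinh t)) +
      (x j * cosh t + sinh t) * (x j * (cosh t - 1) + sinh t)) / (cosh t + x j * sinh t)\<^sup>2"
    by (rule gen) (use p in simp)
  also have "(1 + x j * (x j * (cosh t - 1) + sinh t)) +
      (x j * cosh t + sinh t) * (x j * (cosh t - 1) + sinh t) = (cosh t + x j * sinh t)\<^sup>2"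
    using cs by algebra
  finally have "ip d (boost j t x) (boost j t x) = 1" using p by simp
  moreover have "boost j t x \<in> Rd d" using assms by (auto simp: Rd_def boost_def unit_sphere_def)
  ultimately show ?thesis by (simp add: unit_sphere_def nrm_def)
qed

text \<open>The power \<open>1 / (cosh t + x j * sinh t) ^ (d - 1)\<close> is written as an
  exponential, so that the product over all points becomes the exponential of a sum, which is easy
  to bound and to differentiate in \<open>t\<close>.\<close>

definition jac :: "nat \<Rightarrow> nat \<Rightarrow> real \<Rightarrow> (nat \<Rightarrow> real) \<Rightarrow> real" where
  "jac d j t x = exp (- (real (d - 1) * ln (cosh t + x j * sinh t)))"

lemma jac_measurable [measurable]: "jac d j t \<in> borel_measurable borel"
  unfolding jac_def by measurable

lemma nn_integral_boost_jac:
  assumes d: "2 \<le> d" "j < d" and [measurable]: "f \<in> borel_measurable borel"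
  shows "(\<integral>\<^sup>+x. f x \<partial>uniform_sphere d) =
    (\<integral>\<^sup>+x. f (boost j t x) * ennreal (jac d j t x) \<partial>uniform_sphere d)"
proof (rule trans[OF nn_integral_boost[OF assms, of t] nn_integral_cong_AE])
  have "AE x in uniform_sphere d. x \<in> unit_sphere d" using d by (intro AE_uniform_sphere) simp
  then show "AE x in uniform_sphere d. f (boost j t x) * ennreal (1 / (cosh t + x j * sinh t) ^ (d -
      1)) =
    f (boost j t x) * ennreal (jac d j t x)"
  proof eventually_elim
    case (elim x)
    then have "0 < cosh t + x j * sinh t" by (intro cosh_sinh_bounds unit_sphere_component)
    then have "1 / (cosh t + x j * sinh t) ^ (d - 1) = jac d j t x"
      by (simp add: jac_def exp_minus exp_of_nat_mult field_simps)
    then show ?case by simp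
  qed
qed

definition boosts :: "nat set \<Rightarrow> nat \<Rightarrow> real \<Rightarrow> (nat \<Rightarrow> nat \<Rightarrow> real) \<Rightarrow> nat \<Rightarrow> nat \<Rightarrow> real" where
  "boosts I j t x = (\<lambda>i\<in>I. boost j t (x i))"

lemma boosts_measurable [measurable]: "boosts I j t \<in> Sph d I \<rightarrow>\<^sub>M Sph d I"
  unfolding boosts_def by measurable

lemma boosts_0: "x \<in> space (Sph d I) \<Longrightarrow> boosts I j 0 x = x"
  by (auto simp: boosts_def boost_def space_PiM PiE_iff extensional_def fun_eq_iff)

lemma Sph_boosts:
  assumes d: "2 \<le> d" "j < d" and fin: "finite I"
  shows "distr (density (Sph d I) (\<lambda>x. ennreal (\<Prod>i\<in>I. jac d j t (x i)))) (Sph d I) (boosts I j t) =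
      Sph d I"
proof -
  interpret product_prob_space "\<lambda>_::nat. uniform_sphere d" by (rule product_prob_space_Sph)
  have jm [measurable]: "(\<lambda>x. \<Prod>i\<in>I. jac d j t (x i)) \<in> borel_measurable (Sph d I)"
    by measurable
  show ?thesis
  proof (rule PiM_eqI[OF fin])
    fix A :: "nat \<Rightarrow> (nat \<Rightarrow> real) set" assume A: "\<And>i. i \<in> I \<Longrightarrow> A i \<in> sets (uniform_sphere d)"
    have [measurable]: "Pi\<^sub>E I A \<in> sets (Sph d I)"
      using A fin by (intro sets_PiM_I_finite) auto
    have "emeasure (distr (density (Sph d I) (\<lambda>x. ennreal (\<Prod>i\<in>I. jac d j t (x i)))) (Sph d I)
        (boosts I j t)) (Pi\<^sub>E I A)
       = (\<integral>\<^sup>+x. ennreal (\<Prod>i\<in>I. jac d j t (x i)) * indicator (Pi\<^sub>E I A) (boosts I j t x) \<partial>Sph d I)"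
      by (subst emeasure_distr) (auto simp: emeasure_density indicator_def intro!: nn_integral_cong)
    also have "\<dots> = (\<integral>\<^sup>+x. (\<Prod>i\<in>I. indicator (A i) (boost j t (x i)) * ennreal (jac d j t (x i))) \<partial>Sph d
        I)"
    proof (rule nn_integral_cong)
      fix x
      have "indicator (Pi\<^sub>E I A) (boosts I j t x) =
          (\<Prod>i\<in>I. indicator (A i) (boost j t (x i)) :: ennreal)"
        using fin by (auto simp: indicator_def PiE_iff boosts_def prod_zero_iff)
      then show "ennreal (\<Prod>i\<in>I. jac d j t (x i)) * indicator (Pi\<^sub>E I A) (boosts I j t x) =
          (\<Prod>i\<in>I. indicator (A i) (boost j t (x i)) * ennreal (jac d j t (x i)))"
        by (simp add: prod.distrib prod_ennreal jac_def mult.commute)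
    qed
    also have "\<dots> = (\<Prod>i\<in>I. \<integral>\<^sup>+x. indicator (A i) (boost j t x) * ennreal (jac d j t x) \<partial>uniform_sphere
        d)"
      using A fin by (intro product_nn_integral_prod) auto
    also have "\<dots> = (\<Prod>i\<in>I. emeasure (uniform_sphere d) (A i))"
    proof (rule prod.cong)
      fix i assume "i \<in> I"
      then have [measurable]: "A i \<in> sets borel" using A by simp
      show "(\<integral>\<^sup>+x. indicator (A i) (boost j t x) * ennreal (jac d j t x) \<partial>uniform_sphere d) =
          emeasure (uniform_sphere d) (A i)"
        using nn_integral_boost_jac[OF d, of "indicator (A i)" t] by simp
    qed simp
    finally show "emeasure (distr (density (Sph d I) (\<lambda>x. ennreal (\<Prod>i\<in>I. jac d j t (x i)))) (Sph d I)
        (boosts I j t)) (Pi\<^sub>E I A)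
      = (\<Prod>i\<in>I. emeasure (uniform_sphere d) (A i))" .
  qed simp
qed

lemma integral_boosts:
  fixes \<Phi> :: "(nat \<Rightarrow> nat \<Rightarrow> real) \<Rightarrow> real"
  assumes d: "2 \<le> d" "j < d" and fin: "finite I" and [measurable]: "\<Phi> \<in> borel_measurable (Sph d I)"
  shows "(\<integral>x. \<Phi> x \<partial>Sph d I) = (\<integral>x. (\<Prod>i\<in>I. jac d j t (x i)) * \<Phi> (boosts I j t x) \<partial>Sph d I)"
proof -
  have "(\<integral>x. \<Phi> x \<partial>Sph d I) =
     (\<integral>x. \<Phi> x \<partial>distr (density (Sph d I) (\<lambda>x. ennreal (\<Prod>i\<in>I. jac d j t (x i)))) (Sph d I)
         (boosts I j t))"
    unfolding Sph_boosts[OF d fin] ..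
  also have "\<dots> = (\<integral>x. \<Phi> (boosts I j t x) \<partial>density (Sph d I) (\<lambda>x. ennreal (\<Prod>i\<in>I. jac d j t (x i))))"
    by (rule integral_distr) measurable
  also have "\<dots> = (\<integral>x. (\<Prod>i\<in>I. jac d j t (x i)) *\<^sub>R \<Phi> (boosts I j t x) \<partial>Sph d I)"
    by (rule integral_density) (auto simp: jac_def prod_nonneg)
  finally show ?thesis by simp
qed

lemma abs_exp_minus_one_le:
  fixes x :: real shows "\<bar>exp x - 1\<bar> \<le> \<bar>x\<bar> * exp \<bar>x\<bar>"
proof (cases "0 \<le> x")
  case True
  have "1 - x \<le> exp (- x)" using exp_ge_add_one_self[of "- x"] by simp
  then have "(1 - x) * exp x \<le> exp (- x) * exp x" by (intro mult_right_mono) auto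
  then show ?thesis using True by (simp add: mult_exp_exp algebra_simps)
next
  case False
  then have "exp x \<le> 1" by simp
  then have "\<bar>exp x - 1\<bar> \<le> - x" using exp_ge_add_one_self[of x] by linarith
  also have "\<dots> \<le> \<bar>x\<bar> * exp \<bar>x\<bar>" using False by simp
  finally show ?thesis .
qed

text \<open>Stein's identity for the infinitesimal boost: the field \<open>e\<^sub>j - \<langle>e\<^sub>j, x\<rangle> x\<close> on the sphere has
  divergence \<open>- (d - 1) x\<^sub>j\<close>.\<close>

lemma Sph_stein:
  fixes \<Phi> \<Psi> :: "(nat \<Rightarrow> nat \<Rightarrow> real) \<Rightarrow> real"
  assumes d: "2 \<le> d" "j < d" and fin: "finite I"
    and [measurable]: "\<Phi> \<in> borel_measurable (Sph d I)" "\<Psi> \<in> borel_measurable (Sph d I)"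
    and bnd: "\<And>x. (\<forall>i\<in>I. x i \<in> unit_sphere d) \<Longrightarrow> \<bar>\<Phi> x\<bar> \<le> B"
    and lip: "AE x in Sph d I. \<forall>t\<in>{-1..1}. \<bar>\<Phi> (boosts I j t x) - \<Phi> x\<bar> \<le> C * \<bar>t\<bar>"
    and der: "AE x in Sph d I. ((\<lambda>t. \<Phi> (boosts I j t x)) has_real_derivative \<Psi> x) (at 0)"
  shows "(\<integral>x. \<Psi> x - real (d - 1) * \<Phi> x * (\<Sum>i\<in>I. x i j) \<partial>Sph d I) = 0"
proof -
  interpret S: prob_space "Sph d I" by (rule prob_space_Sph)
  \<comment> \<open>A sequence of rapidities in \<open>{-1..1}\<close> that tends to 0, since
    dominated convergence is applied along sequences.\<close>
  define t where "t n = 1 / real (Suc n)" for n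
  have t: "0 < t n" "t n \<le> 1" for n by (auto simp: t_def)
  have tlim: "t \<longlonglongrightarrow> 0" unfolding t_def by (rule LIMSEQ_Suc) (rule lim_1_over_n)
  define W where "W s x = (\<Prod>i\<in>I. jac d j s (x i))" for s x
  have [measurable]: "W s \<in> borel_measurable (Sph d I)" for s unfolding W_def by measurable
  define c where "c = real (d - 1) * real (card I)"
  have c: "0 \<le> c" by (simp add: c_def)
  have sph: "AE x in Sph d I. \<forall>i\<in>I. x i \<in> unit_sphere d" using d fin by (intro AE_Sph) auto
  have sphb: "\<forall>i\<in>I. boosts I j s x i \<in> unit_sphere d" if "\<forall>i\<in>I. x i \<in> unit_sphere d" for s x
    using that d by (auto simp: boosts_def intro: boost_unit_sphere)
  have B: "0 \<le> B"
  proof -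
    obtain v where v: "v \<in> unit_sphere d" using eventually_happens[OF AE_uniform_sphere[of d]] d
      by (auto simp: trivial_limit_def[symmetric] prob_space.ae_filter_bot[OF
          prob_space_uniform_sphere])
    show ?thesis using bnd[of "\<lambda>_. v"] v by force
  qed
  have Wexp: "W s x = exp (- (real (d - 1) * (\<Sum>i\<in>I. ln (cosh s + x i j * sinh s))))" for s x
    unfolding W_def jac_def by (simp add: exp_sum[OF fin, symmetric] sum_negf sum_distrib_left)
  have Wabs: "\<bar>real (d - 1) * (\<Sum>i\<in>I. ln (cosh s + x i j * sinh s))\<bar> \<le> c * \<bar>s\<bar>"
    if x: "\<forall>i\<in>I. x i \<in> unit_sphere d" for s x
  proof -
    have "\<bar>ln (cosh s + x i j * sinh s)\<bar> \<le> \<bar>s\<bar>" if i: "i \<in> I" for i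
    proof -
      have "\<bar>x i j\<bar> \<le> 1" using x i by (intro unit_sphere_component[of _ d]) auto
      note b = cosh_sinh_bounds[OF this, of s]
      have "ln (cosh s + x i j * sinh s) \<le> \<bar>s\<bar>" using b by (metis ln_le_cancel_iff exp_gt_zero ln_exp)
      moreover have "- \<bar>s\<bar> \<le> ln (cosh s + x i j * sinh s)" using b
          by (metis ln_le_cancel_iff exp_gt_zero ln_exp)
      ultimately show ?thesis by linarith
    qed
    then have "\<bar>\<Sum>i\<in>I. ln (cosh s + x i j * sinh s)\<bar> \<le> (\<Sum>i\<in>I. \<bar>s\<bar>)"
      by (intro order_trans[OF sum_abs] sum_mono) auto
    then have "real (d - 1) * \<bar>\<Sum>i\<in>I. ln (cosh s + x i j * sinh s)\<bar> \<le> real (d - 1) * (\<Sum>i\<in>I. \<bar>s\<bar>)"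
      by (intro mult_left_mono) auto
    then show ?thesis by (simp add: c_def abs_mult mult.assoc)
  qed
  have W1: "\<bar>W s x - 1\<bar> \<le> c * exp c * \<bar>s\<bar>" "\<bar>W s x\<bar> \<le> exp c"
    if x: "\<forall>i\<in>I. x i \<in> unit_sphere d" and s: "\<bar>s\<bar> \<le> 1" for s x
  proof -
    let ?y = "- (real (d - 1) * (\<Sum>i\<in>I. ln (cosh s + x i j * sinh s)))"
    have y: "\<bar>?y\<bar> \<le> c * \<bar>s\<bar>" using Wabs[OF x] by simp
    also have "\<dots> \<le> c" using s c by (simp add: mult_left_le)
    finally have y2: "\<bar>?y\<bar> \<le> c" .
    have "\<bar>W s x - 1\<bar> \<le> \<bar>?y\<bar> * exp \<bar>?y\<bar>" unfolding Wexp by (rule abs_exp_minus_one_le)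
    also have "\<dots> \<le> (c * \<bar>s\<bar>) * exp c" using y y2 by (intro mult_mono) auto
    finally show "\<bar>W s x - 1\<bar> \<le> c * exp c * \<bar>s\<bar>" by (simp add: ac_simps)
    show "\<bar>W s x\<bar> \<le> exp c" unfolding Wexp using y2 by (simp add: abs_le_iff)
  qed
  \<comment> \<open>The integral of the weighted function
    \<open>W s x * \<Phi> (boosts I j s x)\<close> does not depend on \<open>s\<close>, so these
    difference quotients have mean 0. Their pointwise limit is given by the product rule; the
    derivative of the weight contributes
    \<open>- real (d - 1) * (\<Sum>i\<in>I. x i j)\<close>.\<close>
  let ?q = "\<lambda>n x. (W (t n) x * \<Phi> (boosts I j (t n) x) - \<Phi> x) / t n"
  have intPhi: "integrable (Sph d I) \<Phi>"
    using sph bnd by (intro S.integrable_const_bound[of _ B]) (auto elim!: eventually_mono)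
  have zero: "(\<integral>x. ?q n x \<partial>Sph d I) = 0" for n
  proof -
    have "integrable (Sph d I) (\<lambda>x. W (t n) x * \<Phi> (boosts I j (t n) x))"
    proof (rule S.integrable_const_bound[of _ "exp c * B"])
      show "AE x in Sph d I. norm (W (t n) x * \<Phi> (boosts I j (t n) x)) \<le> exp c * B"
        using sph
      proof eventually_elim
        case (elim x)
        have "\<bar>W (t n) x\<bar> \<le> exp c" using W1(2)[OF elim, of "t n"] t[of n] by auto
        then show ?case using bnd[OF sphb[OF elim]] B by (simp add: abs_mult mult_mono)
      qed
    qed measurable
    then have "(\<integral>x. ?q n x \<partial>Sph d I) =
      ((\<integral>x. W (t n) x * \<Phi> (boosts I j (t n) x) \<partial>Sph d I) - (\<integral>x. \<Phi> x \<partial>Sph d I)) / t n"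
      using intPhi by simp
    also have "\<dots> = 0"
      using integral_boosts[OF d fin, of \<Phi> "t n"] by (simp add: W_def)
    finally show ?thesis .
  qed
  have "(\<lambda>n. \<integral>x. ?q n x \<partial>Sph d I) \<longlonglongrightarrow> (\<integral>x. \<Psi> x - real (d - 1) * \<Phi> x * (\<Sum>i\<in>I. x i j) \<partial>Sph d I)"
  proof (rule integral_dominated_convergence[where w = "\<lambda>_. exp c * C + B * (c * exp c)"])
    show "AE x in Sph d I. (\<lambda>n. ?q n x) \<longlonglongrightarrow> \<Psi> x - real (d - 1) * \<Phi> x * (\<Sum>i\<in>I. x i j)"
      using sph der AE_space
    proof eventually_elim
      case (elim x)
      have p0: "cosh (0::real) + x i j * sinh 0 = 1" for i by simp
      have "((\<lambda>s. ln (cosh s + x i j * sinh s)) has_real_derivative x i j) (at 0)" for i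
        by (auto intro!: derivative_eq_intros)
      then have "((\<lambda>s. \<Sum>i\<in>I. ln (cosh s + x i j * sinh s)) has_real_derivative (\<Sum>i\<in>I. x i j)) (at 0)"
        by (intro DERIV_sum)
      then have DW: "((\<lambda>s. W s x) has_real_derivative - (real (d - 1) * (\<Sum>i\<in>I. x i j))) (at 0)"
        unfolding Wexp by (auto intro!: derivative_eq_intros)
      have W0: "W 0 x = 1" by (simp add: Wexp)
      have "((\<lambda>s. W s x * \<Phi> (boosts I j s x)) has_real_derivative
          \<Psi> x - real (d - 1) * \<Phi> x * (\<Sum>i\<in>I. x i j)) (at 0)"
        using DERIV_mult[OF DW elim(2)] boosts_0[OF elim(3)] by (simp add: W0 algebra_simps)
      then have L: "((\<lambda>s. (W s x * \<Phi> (boosts I j s x) - \<Phi> x) / s) \<longlongrightarrow>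
          \<Psi> x - real (d - 1) * \<Phi> x * (\<Sum>i\<in>I. x i j)) (at 0)"
        using boosts_0[OF elim(3)] by (simp add: has_field_derivative_iff W0)
      have "filterlim t (at 0) sequentially"
        using tlim t(1) by (auto simp: filterlim_at less_imp_neq[symmetric] intro!: always_eventually)
      then show ?case by (rule filterlim_compose[OF L])
    qed
    show "AE x in Sph d I. norm (?q n x) \<le> exp c * C + B * (c * exp c)" for n
      using sph lip
    proof eventually_elim
      case (elim x)
      let ?s = "t n"
      have s: "\<bar>?s\<bar> \<le> 1" "0 < ?s" "?s \<in> {-1..1}" using t[of n] by auto
      have "W ?s x * \<Phi> (boosts I j ?s x) - \<Phi> x = W ?s x * (\<Phi> (boosts I j ?s x) - \<Phi> x) + \<Phi> x * (W ?s x -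
          1)"
        by (simp add: algebra_simps)
      also have "\<bar>\<dots>\<bar> \<le> \<bar>W ?s x\<bar> * \<bar>\<Phi> (boosts I j ?s x) - \<Phi> x\<bar> + \<bar>\<Phi> x\<bar> * \<bar>W ?s x - 1\<bar>"
        by (metis abs_mult abs_triangle_ineq)
      also have "\<dots> \<le> exp c * (C * \<bar>?s\<bar>) + B * (c * exp c * \<bar>?s\<bar>)"
        using bspec[OF elim(2) s(3)] W1[OF elim(1) s(1)] bnd[OF elim(1)] B
            by (intro add_mono mult_mono) auto
      also have "\<dots> = (exp c * C + B * (c * exp c)) * ?s" using s by (simp add: algebra_simps)
      finally show ?case using s by (simp add: abs_divide divide_le_eq)
    qed
  qed measurable
  then show ?thesis unfolding zero by (simp add: LIMSEQ_const_iff)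
qed

section \<open>The law of a one-dimensional projection\<close>

text \<open>Supplies the Lipschitz hypothesis of \<open>Sph_stein\<close> from a derivative bound
  along the whole orbit.\<close>

lemma lipschitz_from_derivative:
  fixes f f' :: "real \<Rightarrow> real"
  assumes "\<And>s. \<bar>s\<bar> \<le> 1 \<Longrightarrow> (f has_real_derivative f' s) (at s)"
    and "\<And>s. \<bar>s\<bar> \<le> 1 \<Longrightarrow> \<bar>f' s\<bar> \<le> C" and "\<bar>t\<bar> \<le> 1"
  shows "\<bar>f t - f 0\<bar> \<le> C * \<bar>t\<bar>"
proof -
  have "norm (f t - f 0) \<le> C * norm (t - 0)"
    by (rule field_differentiable_bound[of "{-1..1}" f f'])
       (use assms in \<open>auto intro: has_field_derivative_at_within simp: abs_le_iff\<close>)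
  then show ?thesis by simp
qed

text \<open>On \<open>{-1..1}\<close> the Taylor polynomials of the characteristic function, whose
  coefficients are the moments, approximate it with error at most
  \<open>2 * \<bar>t\<bar> ^ n / fact n\<close>. Equal moments therefore give equal characteristic
  functions.\<close>

lemma moments_unique:
  assumes M1: "real_distribution M1" and M2: "real_distribution M2"
    and b1: "AE x in M1. \<bar>x\<bar> \<le> 1" and b2: "AE x in M2. \<bar>x\<bar> \<le> 1"
    and eq: "\<And>k::nat. (\<integral>x. x ^ k \<partial>M1) = (\<integral>x. x ^ k \<partial>M2)"
  shows "M1 = M2"
proof -
  have approx: "cmod (char M t - (\<Sum>k\<le>n. (\<i> * complex_of_real t) ^ k / fact k *
      complex_of_real (\<integral>x. x ^ k \<partial>M)))
      \<le> 2 * \<bar>t\<bar> ^ n / fact n"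
    if M: "real_distribution M" and b: "AE x in M. \<bar>x\<bar> \<le> 1" for M t n
  proof -
    interpret real_distribution M by fact
    have [measurable_cong]: "sets M = sets borel" by simp
    have i: "integrable M (\<lambda>x. x ^ k)" for k
      using b by (intro integrable_const_bound[of _ 1]) (auto simp: power_abs power_le_one elim!:
          eventually_mono)
    have "(\<integral>x. \<bar>x\<bar> ^ n \<partial>M) \<le> (\<integral>x. 1 \<partial>M)"
      using b integrable_abs[OF i[of n]]
          by (intro integral_mono_AE) (auto simp: power_abs power_le_one elim!: eventually_mono)
    then have "(\<integral>x. \<bar>x\<bar> ^ n \<partial>M) \<le> 1" using prob_space by simp
    then have le: "2 * \<bar>t\<bar> ^ n / fact n * (\<integral>x. \<bar>x\<bar> ^ n \<partial>M) \<le> 2 * \<bar>t\<bar> ^ n / fact n * 1"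
      by (rule mult_left_mono) simp
    have "cmod (char M t - (\<Sum>k\<le>n. (\<i> * complex_of_real t) ^ k / fact k *
        complex_of_real (\<integral>x. x ^ k \<partial>M)))
      \<le> 2 * \<bar>t\<bar> ^ n / fact n * (\<integral>x. \<bar>x\<bar> ^ n \<partial>M)"
      by (rule char_approx1) (rule i)
    also note le
    finally show ?thesis by simp
  qed
  have "char M1 t = char M2 t" for t
  proof -
    have "cmod (char M1 t - char M2 t) \<le> 4 * (\<bar>t\<bar> ^ n / fact n)" for n
    proof -
      let ?S = "\<Sum>k\<le>n. (\<i> * complex_of_real t) ^ k / fact k * complex_of_real (\<integral>x. x ^ k \<partial>M2)"
      have "cmod (char M1 t - char M2 t) \<le> cmod (char M1 t - ?S) + cmod (char M2 t - ?S)"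
        using norm_triangle_ineq4[of "char M1 t - ?S" "char M2 t - ?S"] by simp
      then show ?thesis using approx[OF M1 b1, of t n] approx[OF M2 b2, of t n] by (simp add: eq)
    qed
    moreover have "(\<lambda>n. 4 * (\<bar>t\<bar> ^ n / fact n)) \<longlonglongrightarrow> 4 * 0"
      using summable_LIMSEQ_zero[OF summable_exp[of "\<bar>t\<bar>"]]
          by (intro tendsto_mult tendsto_const) (simp add: divide_inverse mult.commute)
    ultimately have "cmod (char M1 t - char M2 t) \<le> 0"
      by (intro LIMSEQ_le_const) auto
    then show ?thesis by simp
  qed
  then show ?thesis by (intro Levy_uniqueness M1 M2) auto
qed

lemma ip_measurable_borel [measurable]: "(\<lambda>x. ip d x u) \<in> borel_measurable borel"
  unfolding ip_def by measurable

lemma ip_Cauchy_Schwarz: "\<bar>ip d x y\<bar> \<le> nrm d x * nrm d y"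
proof -
  have "\<bar>ip d x y\<bar> \<le> (\<Sum>i<d. \<bar>x i\<bar> * \<bar>y i\<bar>)" unfolding ip_def
    by (rule order_trans[OF sum_abs]) (simp add: abs_mult)
  also have "\<dots> \<le> L2_set x {..<d} * L2_set y {..<d}" by (rule L2_set_mult_ineq)
  finally show ?thesis by (simp add: nrm_def ip_def L2_set_def power2_eq_square)
qed

lemma unit_sphere_ip_le: "x \<in> unit_sphere d \<Longrightarrow> u \<in> unit_sphere d \<Longrightarrow> \<bar>ip d x u\<bar> \<le> 1"
  using ip_Cauchy_Schwarz[of d x u] by (simp add: unit_sphere_def)

text \<open>Boosts form a flow, so the derivative at any \<open>t\<close> is the generator evaluated
  at the boosted point. Having it for all \<open>t\<close>, not only at 0, is what yields uniform
  Lipschitz bounds.\<close>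

lemma ip_boost_derivative:
  assumes "j < d" "x \<in> unit_sphere d"
  shows "((\<lambda>t. ip d (boost j t x) u) has_real_derivative u j - boost j t x j * ip d (boost j t x) u)
      (at t)"
proof -
  have p: "0 < cosh t + x j * sinh t" using assms by (intro cosh_sinh_bounds unit_sphere_component)
  have gen: "u j - (b / p) * (a / p) = ((u j * p) * p - a * b) / (p * p)" if "p \<noteq> 0" for a b p :: real
    using that by (simp add: field_simps)
  have num: "((\<lambda>t. ip d x u + u j * (x j * (cosh t - 1) + sinh t)) has_real_derivative u j * (cosh t +
      x j * sinh t)) (at t)"
    by (auto intro!: derivative_eq_intros)
  have den: "((\<lambda>t. cosh t + x j * sinh t) has_real_derivative x j * cosh t + sinh t) (at t)"
    by (auto intro!: derivative_eq_intros)
  have b: "boost j t x j = (x j * cosh t + sinh t) / (cosh t + x j * sinh t)" by (simp add: boost_def)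
  show ?thesis unfolding ip_boost[OF assms(1)] b using p
    by (subst gen) (auto intro!: DERIV_divide num den)
qed

text \<open>Stein's identity for a single point and the function \<open>ip d x u ^ k * u j\<close>,
  summed over \<open>j\<close>. For \<open>k = 0\<close> the truncated \<open>k - 1\<close> is
  multiplied by 0, and the statement says that the first moment vanishes.\<close>

lemma sphere_moments:
  assumes d: "2 \<le> d" and u: "u \<in> unit_sphere d"
  defines "m \<equiv> \<lambda>k::nat. \<integral>x. ip d x u ^ k \<partial>uniform_sphere d"
  shows "real k * (m (k - 1) - m (k + 1)) = real (d - 1) * m (k + 1)"
proof -
  interpret U: prob_space "uniform_sphere d" by (rule prob_space_uniform_sphere)
  interpret product_prob_space "\<lambda>_::nat. uniform_sphere d" by (rule product_prob_space_Sph)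
  have sph: "AE x in uniform_sphere d. x \<in> unit_sphere d" using d by (intro AE_uniform_sphere) simp
  have sph0: "AE x in Sph d {0}. x 0 \<in> unit_sphere d" using AE_Sph[of d "{0}"] d by simp
  have comp: "\<bar>v l\<bar> \<le> 1" if "v \<in> unit_sphere d" for v l using unit_sphere_component[OF that] .
  have int: "integrable (uniform_sphere d) (\<lambda>x. ip d x u ^ l * f x)"
    if [measurable]: "f \<in> borel_measurable borel" and f: "\<And>x. x \<in> unit_sphere d \<Longrightarrow> \<bar>f x\<bar> \<le> 1"
        for l and f :: "_ \<Rightarrow> real"
    using sph by (intro U.integrable_const_bound[of _ 1])
      (auto simp: abs_mult power_abs f intro!: mult_le_one power_le_one unit_sphere_ip_le[OF _ u] elim!:
          eventually_mono)
  have coord: "(\<integral>x. real k * ip d x u ^ (k - 1) * (u j * u j - u j * x j * ip d x u) - real (d - 1) *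
      ip d x u ^ k * (u j * x j) \<partial>uniform_sphere d) = 0"
    if j: "j < d" for j
  proof -
    let ?g = "\<lambda>x. real k * ip d x u ^ (k - 1) * (u j * u j - u j * x j * ip d x u) - real (d - 1) *
        ip d x u ^ k * (u j * x j)"
    let ?\<Phi> = "\<lambda>x::nat \<Rightarrow> nat \<Rightarrow> real. ip d (x 0) u ^ k * u j"
    let ?\<Psi> = "\<lambda>x::nat \<Rightarrow> nat \<Rightarrow> real. real k * ip d (x 0) u ^ (k - 1) * (u j - x 0 j * ip d (x 0) u) *
        u j"
    have der: "((\<lambda>t. ?\<Phi> (boosts {0} j t x)) has_real_derivative ?\<Psi> (boosts {0} j t x)) (at t)"
      if "x 0 \<in> unit_sphere d" for x t
      using DERIV_cmult_right[OF DERIV_power[OF ip_boost_derivative[OF j that, of u t], of k], of "u j"]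
      by (simp add: boosts_def ac_simps)
    have "(\<integral>x. ?\<Psi> x - real (d - 1) * ?\<Phi> x * (\<Sum>i\<in>{0}. x i j) \<partial>Sph d {0}) = 0"
    proof (rule Sph_stein[OF d j, where B = 1 and C = "2 * real k"])
      show "\<bar>?\<Phi> x\<bar> \<le> 1" if "\<forall>i\<in>{0}. x i \<in> unit_sphere d" for x
        using that unit_sphere_ip_le[of "x 0" d u] u comp[OF u, of j]
        by (auto simp: abs_mult power_abs intro!: mult_le_one power_le_one)
      show "AE x in Sph d {0}. \<forall>t\<in>{- 1..1}. \<bar>?\<Phi> (boosts {0} j t x) - ?\<Phi> x\<bar> \<le> 2 * real k * \<bar>t\<bar>"
        using sph0 AE_space
      proof eventually_elim
        case (elim x)
        have "\<bar>?\<Phi> (boosts {0} j t x) - ?\<Phi> (boosts {0} j 0 x)\<bar> \<le> 2 * real k * \<bar>t\<bar>" if t: "\<bar>t\<bar> \<le> 1" for t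
        proof (rule lipschitz_from_derivative[where f = "\<lambda>s. ?\<Phi> (boosts {0} j s x)" and f' =
            "\<lambda>s. ?\<Psi> (boosts {0} j s x)"])
          show "\<bar>t\<bar> \<le> 1" by (rule t)
          fix s :: real
          show "((\<lambda>s. ?\<Phi> (boosts {0} j s x)) has_real_derivative ?\<Psi> (boosts {0} j s x)) (at s)"
            by (rule der) (rule elim(1))
          let ?y = "boosts {0} j s x"
          have y: "?y 0 \<in> unit_sphere d" using boost_unit_sphere[OF j elim(1)] by (simp add: boosts_def)
          have i: "\<bar>ip d (?y 0) u\<bar> \<le> 1" by (rule unit_sphere_ip_le[OF y u])
          have a: "\<bar>u j - ?y 0 j * ip d (?y 0) u\<bar> \<le> 2"
          proof -
            have "\<bar>?y 0 j * ip d (?y 0) u\<bar> \<le> 1" unfolding abs_mult using comp[OF y, of j] i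
                by (intro mult_le_one) auto
            then show ?thesis using comp[OF u, of j] by linarith
          qed
          have "\<bar>ip d (?y 0) u\<bar> ^ (k - 1) * (\<bar>u j - ?y 0 j * ip d (?y 0) u\<bar> * \<bar>u j\<bar>) \<le> 1 * (2 * 1)"
            by (rule mult_mono[OF power_le_one[OF _ i] mult_mono[OF a comp[OF u, of j]]]) simp_all
          then have "real k * (\<bar>ip d (?y 0) u\<bar> ^ (k - 1) * (\<bar>u j - ?y 0 j * ip d (?y 0) u\<bar> * \<bar>u j\<bar>)) \<le>
              real k * 2"
            by (intro mult_left_mono) simp_all
          then show "\<bar>?\<Psi> ?y\<bar> \<le> 2 * real k" by (simp only: abs_mult power_abs abs_of_nat ac_simps)
        qed
        then show ?case unfolding boosts_0[OF elim(2)]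
            by (intro ballI) (simp only: atLeastAtMost_iff abs_le_iff minus_le_iff)
      qed
      show "AE x in Sph d {0}. ((\<lambda>t. ?\<Phi> (boosts {0} j t x)) has_real_derivative ?\<Psi> x) (at 0)"
        using sph0 AE_space
      proof eventually_elim
        case (elim x)
        have "((\<lambda>t. ?\<Phi> (boosts {0} j t x)) has_real_derivative ?\<Psi> (boosts {0} j 0 x)) (at 0)"
          by (rule der) (rule elim(1))
        then show ?case unfolding boosts_0[OF elim(2)] .
      qed
    qed measurable
    also have "(\<lambda>x. ?\<Psi> x - real (d - 1) * ?\<Phi> x * (\<Sum>i\<in>{0}. x i j)) = (\<lambda>x. ?g (x 0))"
      by (auto simp: algebra_simps)
    also have "(\<integral>x. ?g (x 0) \<partial>Sph d {0}) = (\<integral>x. ?g x \<partial>uniform_sphere d)"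
      by (rule product_integral_singleton) measurable
    finally show ?thesis .
  qed
  \<comment> \<open>Summation over \<open>j\<close> removes the coordinates, because the sum of
    \<open>u j * u j\<close> is 1 and the sum of \<open>u j * x j\<close> is
    \<open>ip d x u\<close>.\<close>
  have "0 = (\<Sum>j<d. \<integral>x. real k * ip d x u ^ (k - 1) * (u j * u j - u j * x j * ip d x u) - real (d - 1) *
      ip d x u ^ k * (u j * x j) \<partial>uniform_sphere d)"
    using coord by simp
  also have "\<dots> = (\<integral>x. (\<Sum>j<d. real k * ip d x u ^ (k - 1) * (u j * u j - u j * x j * ip d x u) -
      real (d - 1) * ip d x u ^ k * (u j * x j)) \<partial>uniform_sphere d)"
  proof (rule Bochner_Integration.integral_sum[symmetric])
    fix j
    have m: "\<bar>u j * x j\<bar> \<le> 1" "\<bar>u j * u j\<bar> \<le> 1" if "x \<in> unit_sphere d" for x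
      unfolding abs_mult by (intro mult_le_one comp[OF that] comp[OF u] abs_ge_zero)+
    have "integrable (uniform_sphere d) (\<lambda>x. real k * (ip d x u ^ (k - 1) * (u j * u j)) -
        real k * (ip d x u ^ Suc (k - 1) * (u j * x j)) - real (d - 1) * (ip d x u ^ k * (u j * x j)))"
      using m by (intro Bochner_Integration.integrable_diff integrable_mult_right int) auto
    then show "integrable (uniform_sphere d) (\<lambda>x. real k * ip d x u ^ (k - 1) * (u j * u j - u j * x j *
        ip d x u) - real (d - 1) * ip d x u ^ k * (u j * x j))"
      by (rule back_subst[of "integrable _"]) (auto simp: algebra_simps)
  qed
  also have "\<dots> = (\<integral>x. real k * ip d x u ^ (k - 1) - (real k + real (d - 1)) * ip d x u ^ (k +
      1) \<partial>uniform_sphere d)"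
  proof (rule Bochner_Integration.integral_cong)
    fix x
    have s: "(\<Sum>j<d. u j * u j) = 1" "(\<Sum>j<d. u j * x j) = ip d x u"
      using unit_sphere_ip[OF u] by (simp_all add: ip_def mult.commute)
    have "(\<Sum>j<d. real k * ip d x u ^ (k - 1) * (u j * u j - u j * x j * ip d x u) - real (d - 1) *
        ip d x u ^ k * (u j * x j)) =
      real k * ip d x u ^ (k - 1) * ((\<Sum>j<d. u j * u j) - (\<Sum>j<d. u j * x j) * ip d x u) - real (d - 1) *
          ip d x u ^ k * (\<Sum>j<d. u j * x j)"
      by (simp add: sum_subtractf sum_distrib_left sum_distrib_right right_diff_distrib mult.assoc)
    also have "\<dots> = real k * ip d x u ^ (k - 1) - (real k + real (d - 1)) * ip d x u ^ (k + 1)"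
      unfolding s by (cases k) (simp_all add: algebra_simps)
    finally show "(\<Sum>j<d. real k * ip d x u ^ (k - 1) * (u j * u j - u j * x j * ip d x u) -
        real (d - 1) * ip d x u ^ k * (u j * x j)) =
      real k * ip d x u ^ (k - 1) - (real k + real (d - 1)) * ip d x u ^ (k + 1)" .
  qed simp
  also have "\<dots> = real k * m (k - 1) - (real k + real (d - 1)) * m (k + 1)"
    using int[of "\<lambda>_. 1"] unfolding m_def
    by (subst Bochner_Integration.integral_diff) (auto simp del: power_Suc)
  finally show ?thesis by (simp add: algebra_simps)
qed

section \<open>Density and distribution function of the projection of a uniform point\<close>

definition sdens :: "nat \<Rightarrow> real \<Rightarrow> real" where
  "sdens d t = max 0 (1 - t\<^sup>2) powr ((real d - 3) / 2)"

definition snorm :: "nat \<Rightarrow> real" where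
  "snorm d = integral {-1..1} (sdens d)"

definition cap :: "nat \<Rightarrow> real \<Rightarrow> real" where
  "cap d h = integral {-1..h} (sdens d) / snorm d"

lemma sdens_nonneg: "0 \<le> sdens d t"
  by (simp add: sdens_def)

lemma sdens_even: "sdens d (- t) = sdens d t"
  by (simp add: sdens_def)

lemma one_minus_square_pos: "\<bar>t\<bar> < 1 \<Longrightarrow> 0 < 1 - (t::real)\<^sup>2"
  by (simp add: abs_square_less_1)

lemma sdens_pos: "\<bar>t\<bar> < 1 \<Longrightarrow> 0 < sdens d t"
  using one_minus_square_pos[of t] by (simp add: sdens_def)

lemma sdens_outside: "t \<notin> {-1..1} \<Longrightarrow> sdens d t = 0"
proof -
  assume "t \<notin> {-1..1}"
  then have "\<not> \<bar>t\<bar> \<le> 1" by auto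
  then have "\<not> t\<^sup>2 \<le> 1" by (simp add: abs_square_le_1)
  then show ?thesis by (simp add: sdens_def)
qed

text \<open>The exponent \<open>(d - 3) / 2\<close> is positive from \<open>d = 4\<close> on, and
  only then is the density continuous at the end points. This is the origin of the assumption
  \<open>4 \<le> d\<close> in what follows.\<close>

lemma sdens_continuous: "4 \<le> d \<Longrightarrow> continuous_on S (sdens d)"
  unfolding sdens_def by (intro continuous_on_powr' continuous_intros) auto

lemma sdens_measurable [measurable]: "sdens d \<in> borel_measurable borel"
  unfolding sdens_def by measurable

lemma sdens_integrable: "4 \<le> d \<Longrightarrow> sdens d integrable_on {a..b}"
  by (intro integrable_continuous_real sdens_continuous)

lemma snorm_pos: assumes "4 \<le> d" shows "0 < snorm d"
proof -
  have "0 \<le> snorm d" unfolding snorm_def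
    by (intro integral_nonneg sdens_integrable assms) (simp add: sdens_nonneg)
  moreover have "snorm d \<noteq> 0"
  proof
    assume "snorm d = 0"
    then have "\<forall>x\<in>{-1..1}. sdens d x = 0"
      unfolding snorm_def using assms
      by (subst (asm) integral_eq_0_iff) (auto intro: sdens_continuous sdens_nonneg)
    then show False using sdens_pos[of 0 d] by simp
  qed
  ultimately show ?thesis by simp
qed

lemma nn_integral_sdens:
  assumes "4 \<le> d"
  shows "(\<integral>\<^sup>+t\<in>{a..b}. ennreal (sdens d t / snorm d) \<partial>lborel) = ennreal (integral {a..b} (sdens d) /
      snorm d)"
proof -
  have c: "continuous_on {a..b} (\<lambda>t. sdens d t / snorm d)"
    using snorm_pos[OF assms] by (intro continuous_intros sdens_continuous assms) auto
  have s: "set_integrable lborel {a..b} (\<lambda>t. sdens d t / snorm d)"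
    by (rule borel_integrable_atLeastAtMost'[OF c])
  have "(\<integral>\<^sup>+t\<in>{a..b}. ennreal (sdens d t / snorm d) \<partial>lborel) =
      (\<integral>\<^sup>+t. ennreal (indicator {a..b} t *\<^sub>R (sdens d t / snorm d)) \<partial>lborel)"
    by (intro nn_integral_cong) (auto split: split_indicator)
  also have "\<dots> = ennreal (LINT t:{a..b}|lborel. sdens d t / snorm d)"
    using s snorm_pos[OF assms] unfolding set_integrable_def set_lebesgue_integral_def
    by (intro nn_integral_eq_integral) (auto simp: sdens_nonneg indicator_def)
  also have "(LINT t:{a..b}|lborel. sdens d t / snorm d) = integral {a..b} (\<lambda>t. sdens d t / snorm d)"
    by (rule set_borel_integral_eq_integral[OF s])
  finally show ?thesis by simp
qed

abbreviation Tlaw :: "nat \<Rightarrow> real measure" where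
  "Tlaw d \<equiv> density lborel (\<lambda>t. ennreal (sdens d t / snorm d))"

text \<open>Only the trace of \<open>A\<close> on \<open>{-1..1}\<close> matters, so the same
  statement serves for half-lines and for \<open>UNIV\<close>.\<close>

lemma emeasure_Tlaw:
  assumes "4 \<le> d" and [measurable]: "A \<in> sets borel" and A: "A \<inter> {-1..1} = {-1..h}"
  shows "emeasure (Tlaw d) A = ennreal (cap d h)"
proof -
  have "emeasure (Tlaw d) A = (\<integral>\<^sup>+t\<in>{-1..h}. ennreal (sdens d t / snorm d) \<partial>lborel)"
    unfolding A[symmetric]
    by (subst emeasure_density) (auto intro!: nn_integral_cong simp: sdens_outside indicator_def)
  then show ?thesis by (simp add: nn_integral_sdens[OF assms(1)] cap_def)
qed

lemma cap_1: "4 \<le> d \<Longrightarrow> cap d 1 = 1"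
  using snorm_pos[of d] by (simp add: cap_def snorm_def)

lemma prob_space_Tlaw: "4 \<le> d \<Longrightarrow> prob_space (Tlaw d)"
  by (rule prob_spaceI) (simp add: emeasure_Tlaw[of d UNIV 1] cap_1)

text \<open>The function differentiated here is \<open>1 - t^2\<close> to the power
  \<open>(d - 1) / 2\<close>. This first-order equation drives both the moment recursion and the
  monotonicity of \<open>hazard\<close>.\<close>

lemma one_minus_square_sdens_derivative:
  assumes "\<bar>t\<bar> < 1"
  shows "((\<lambda>t. (1 - t\<^sup>2) * sdens d t) has_real_derivative - ((real d - 1) * t * sdens d t)) (at t)"
proof -
  have p: "0 < 1 - s\<^sup>2" if "\<bar>s\<bar> < 1" for s :: real using one_minus_square_pos[OF that] .
  have s: "(1 - s\<^sup>2) powr ((real d - 1) / 2) = (1 - s\<^sup>2) * sdens d s" if "\<bar>s\<bar> < 1" for s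
  proof -
    have "(1 - s\<^sup>2) powr ((real d - 1) / 2) = (1 - s\<^sup>2) powr (1 + (real d - 3) / 2)"
      by (simp add: field_simps)
    also have "\<dots> = (1 - s\<^sup>2) * sdens d s" using p[OF that]
        by (simp only: powr_add) (simp add: sdens_def)
    finally show ?thesis .
  qed
  have sd: "(1 - t\<^sup>2) powr ((real d - 1) / 2 - 1) = sdens d t"
    using p[OF assms] by (simp add: sdens_def field_simps)
  have "((\<lambda>t. (1 - t\<^sup>2) powr ((real d - 1) / 2)) has_real_derivative
      (real d - 1) / 2 * (1 - t\<^sup>2) powr ((real d - 1) / 2 - 1) * (- (2 * t))) (at t)"
    using p[OF assms] by (auto intro!: derivative_eq_intros)
  then have "((\<lambda>t. (1 - t\<^sup>2) powr ((real d - 1) / 2)) has_real_derivative -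
      ((real d - 1) * t * sdens d t)) (at t)"
    by (rule DERIV_cong) (simp only: sd, simp)
  then show ?thesis
    by (rule has_field_derivative_transform_within_open[where S = "{-1<..<1}"])
       (use assms s in \<open>auto simp: abs_less_iff\<close>)
qed

text \<open>Integration by parts, with boundary terms that vanish through the factor
  \<open>1 - t^2\<close>. The recursion is the one of \<open>sphere_moments\<close>.\<close>

lemma sdens_moments:
  assumes d: "4 \<le> d"
  defines "m \<equiv> \<lambda>k::nat. integral {-1..1} (\<lambda>t. t ^ k * sdens d t)"
  shows "real k * (m (k - 1) - m (k + 1)) = real (d - 1) * m (k + 1)"
proof -
  let ?q = "\<lambda>t::real. t ^ k * ((1 - t\<^sup>2) * sdens d t)"
  let ?q' = "\<lambda>t::real. real k * (t ^ (k - 1) * sdens d t) - (real k + real (d - 1)) * (t ^ (k + 1) *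
      sdens d t)"
  have "(?q' has_integral ?q 1 - ?q (- 1)) {-1..1}"
  proof (rule fundamental_theorem_of_calculus_interior)
    show "continuous_on {- 1..1} ?q" by (intro continuous_intros sdens_continuous d)
    fix t :: real assume t: "t \<in> {- 1<..<1}"
    have "(?q has_real_derivative real k * t ^ (k - 1) * ((1 - t\<^sup>2) * sdens d t) +
        - ((real d - 1) * t * sdens d t) * t ^ k) (at t)"
      using DERIV_mult[OF DERIV_pow one_minus_square_sdens_derivative[of t d]] t
          by (auto simp: abs_less_iff)
    also have "real k * t ^ (k - 1) * ((1 - t\<^sup>2) * sdens d t) + - ((real d - 1) * t * sdens d t) *
        t ^ k = ?q' t"
      using d by (cases k) (simp_all add: of_nat_diff algebra_simps power2_eq_square)
    finally show "(?q has_vector_derivative ?q' t) (at t)"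
      by (simp add: has_real_derivative_iff_has_vector_derivative)
  qed simp
  then have "integral {-1..1} ?q' = 0" by (auto dest: integral_unique)
  moreover have i: "(\<lambda>t. t ^ l * sdens d t) integrable_on {-1..1}" for l
    by (intro integrable_continuous_real continuous_intros sdens_continuous d)
  have "integral {-1..1} ?q' = real k * m (k - 1) - (real k + real (d - 1)) * m (k + 1)"
    unfolding m_def
    by (subst Henstock_Kurzweil_Integration.integral_diff)
       (auto intro!: integrable_on_mult_right i simp del: power_Suc)
  ultimately show ?thesis by (simp add: algebra_simps)
qed

lemma moments_Tlaw:
  assumes d: "4 \<le> d"
  shows "(\<integral>t. t ^ k \<partial>Tlaw d) = integral {-1..1} (\<lambda>t. t ^ k * sdens d t) / snorm d"
proof -
  have c: "continuous_on {-1..1} (\<lambda>t. t ^ k * sdens d t / snorm d)"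
    using snorm_pos[OF d] by (intro continuous_intros sdens_continuous d) auto
  have s: "set_integrable lborel {-1..1} (\<lambda>t. t ^ k * sdens d t / snorm d)"
    by (rule borel_integrable_atLeastAtMost'[OF c])
  have "(\<integral>t. t ^ k \<partial>Tlaw d) = (\<integral>t. (sdens d t / snorm d) *\<^sub>R t ^ k \<partial>lborel)"
    using snorm_pos[OF d] by (intro integral_density) (auto simp: sdens_nonneg)
  also have "\<dots> = (LINT t:{-1..1}|lborel. t ^ k * sdens d t / snorm d)"
    unfolding set_lebesgue_integral_def
    by (intro Bochner_Integration.integral_cong) (auto simp: sdens_outside indicator_def)
  also have "\<dots> = integral {-1..1} (\<lambda>t. t ^ k * sdens d t / snorm d)"
    by (rule set_borel_integral_eq_integral[OF s])
  finally show ?thesis by simp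
qed

text \<open>Both laws live on \<open>{-1..1}\<close> and their moments obey the same recursion,
  which leads from \<open>k - 1\<close> to \<open>k + 1\<close>. It starts at the total mass 1, and
  its case \<open>k = 0\<close> settles the first moment, hence all odd ones.\<close>

lemma distr_ip_uniform_sphere:
  assumes d: "4 \<le> d" and u: "u \<in> unit_sphere d"
  shows "distr (uniform_sphere d) borel (\<lambda>x. ip d x u) = Tlaw d"
proof -
  interpret U: prob_space "uniform_sphere d" by (rule prob_space_uniform_sphere)
  interpret T: prob_space "Tlaw d" by (rule prob_space_Tlaw[OF d])
  interpret D: prob_space "distr (uniform_sphere d) borel (\<lambda>x. ip d x u)"
    by (rule U.prob_space_distr) simp
  have sph: "AE x in uniform_sphere d. x \<in> unit_sphere d" using d by (intro AE_uniform_sphere) simp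
  show ?thesis
  proof (rule moments_unique)
    show "real_distribution (distr (uniform_sphere d) borel (\<lambda>x. ip d x u))" by standard auto
    show "real_distribution (Tlaw d)" by standard auto
    show "AE x in distr (uniform_sphere d) borel (\<lambda>x. ip d x u). \<bar>x\<bar> \<le> 1"
      using sph unit_sphere_ip_le[OF _ u] by (subst AE_distr_iff) (auto elim!: eventually_mono)
    show "AE x in Tlaw d. \<bar>x\<bar> \<le> 1"
    proof (subst AE_density)
      show "AE x in lborel. 0 < ennreal (sdens d x / snorm d) \<longrightarrow> \<bar>x\<bar> \<le> 1"
      proof (intro AE_I2 impI)
        fix x assume "0 < ennreal (sdens d x / snorm d)"
        then have "x \<in> {-1..1}" using sdens_outside[of x d] by (cases "x \<in> {-1..1}") auto
        then show "\<bar>x\<bar> \<le> 1" by auto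
      qed
    qed simp
    define a where "a k = (\<integral>x. ip d x u ^ k \<partial>uniform_sphere d)" for k
    define b where "b k = integral {-1..1} (\<lambda>t. t ^ k * sdens d t) / snorm d" for k
    have ra: "(real k + real (d - 1)) * a (k + 1) = real k * a (k - 1)" for k
      using sphere_moments[of d u k] d u unfolding a_def by (simp add: algebra_simps)
    have rb: "(real k + real (d - 1)) * b (k + 1) = real k * b (k - 1)" for k
      using sdens_moments[OF d, of k] snorm_pos[OF d] unfolding b_def by (simp add: field_simps)
    have "a k = b k" for k
    proof (induction k rule: less_induct)
      case (less k)
      show ?case
      proof (cases k)
        case 0
        have "a 0 = 1" by (simp add: a_def U.prob_space[simplified])
        moreover have "b 0 = 1" using snorm_pos[OF d] by (simp add: b_def snorm_def)
        ultimately show ?thesis using 0 by simp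
      next
        case (Suc l)
        have "real l * a (l - 1) = real l * b (l - 1)" using less[of "l - 1"] Suc by (cases l) auto
        then have "(real l + real (d - 1)) * a (l + 1) = (real l + real (d - 1)) * b (l + 1)"
          using ra rb by simp
        moreover have "real l + real (d - 1) \<noteq> 0" using d by simp
        ultimately show ?thesis using Suc by simp
      qed
    qed
    then show "(\<integral>x. x ^ k \<partial>distr (uniform_sphere d) borel (\<lambda>x. ip d x u)) = (\<integral>x. x ^ k \<partial>Tlaw d)" for k
      by (simp add: integral_distr moments_Tlaw[OF d] a_def b_def)
  qed
qed


section \<open>Probabilities of spherical caps\<close>

lemma emeasure_halfspace:
  assumes d: "4 \<le> d" and u: "u \<in> unit_sphere d" and h: "\<bar>h\<bar> \<le> 1"
  shows "emeasure (uniform_sphere d) {x. ip d x u \<le> h} = ennreal (cap d h)"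
proof -
  have "emeasure (uniform_sphere d) {x. ip d x u \<le> h} =
      emeasure (distr (uniform_sphere d) borel (\<lambda>x. ip d x u)) {..h}"
    by (subst emeasure_distr) (auto intro!: arg_cong2[where f = emeasure])
  also have "\<dots> = ennreal (cap d h)"
    unfolding distr_ip_uniform_sphere[OF d u] using h by (intro emeasure_Tlaw[OF d]) auto
  finally show ?thesis .
qed

lemma AE_not_on_hyperplane:
  assumes d: "4 \<le> d" and u: "u \<in> unit_sphere d"
  shows "AE x in uniform_sphere d. ip d x u \<noteq> h"
proof -
  have "AE t in Tlaw d. t \<noteq> h"
    using AE_lborel_singleton[of h] by (subst AE_density) (auto elim!: eventually_mono)
  then have "AE t in distr (uniform_sphere d) borel (\<lambda>x. ip d x u). t \<noteq> h"
    unfolding distr_ip_uniform_sphere[OF d u] .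
  then show ?thesis by (subst (asm) AE_distr_iff) auto
qed

lemma cap_nonneg: "4 \<le> d \<Longrightarrow> 0 \<le> cap d h"
  unfolding cap_def using snorm_pos[of d]
  by (intro divide_nonneg_pos integral_nonneg sdens_integrable) (auto simp: sdens_nonneg)

lemma cap_minus_1: "cap d (- 1) = 0"
  by (simp add: cap_def)

lemma cap_derivative:
  assumes "4 \<le> d" "\<bar>h\<bar> < 1"
  shows "(cap d has_real_derivative sdens d h / snorm d) (at h)"
proof -
  have "((\<lambda>x. integral {-1..x} (sdens d)) has_real_derivative sdens d h) (at h within {-1..1})"
    using assms by (intro integral_has_real_derivative sdens_continuous) auto
  moreover have "at h within {-1..1} = at h"
    using assms by (intro at_within_interior) (auto simp: abs_less_iff)
  ultimately have "((\<lambda>x. integral {-1..x} (sdens d)) has_real_derivative sdens d h) (at h)" by simp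
  then show ?thesis unfolding cap_def by (rule DERIV_cdivide)
qed

lemma cap_continuous: "4 \<le> d \<Longrightarrow> continuous_on {-1..1} (cap d)"
  unfolding cap_def using snorm_pos[of d]
  by (intro continuous_intros indefinite_integral_continuous_1 sdens_integrable) auto

lemma cap_reflect:
  assumes "4 \<le> d" "\<bar>h\<bar> \<le> 1"
  shows "cap d (- h) = 1 - cap d h"
proof -
  have "integral {-1..h} (sdens d) + integral {h..1} (sdens d) = snorm d"
    unfolding snorm_def using assms
    by (intro Henstock_Kurzweil_Integration.integral_combine sdens_integrable) auto
  moreover have "integral {h..1} (sdens d) = integral {- 1..- h} (sdens d)"
    using Henstock_Kurzweil_Integration.integral_reflect_real[of 1 h "sdens d"]
        by (simp add: sdens_even)
  ultimately have "integral {-1..- h} (sdens d) = snorm d - integral {-1..h} (sdens d)" by simp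
  then show ?thesis using snorm_pos[OF assms(1)] by (simp add: cap_def diff_divide_distrib)
qed

lemma cap_0: "4 \<le> d \<Longrightarrow> cap d 0 = 1 / 2"
  using cap_reflect[of d 0] by simp

lemma cap_mono:
  assumes "4 \<le> d" "-1 \<le> h" "h \<le> k" "k \<le> 1"
  shows "cap d h \<le> cap d k"
proof (rule DERIV_nonneg_imp_increasing_open[where f = "cap d", OF \<open>h \<le> k\<close>])
  fix x assume x: "h < x" "x < k"
  have "(cap d has_real_derivative sdens d x / snorm d) (at x)"
    using assms x by (intro cap_derivative) auto
  moreover have "0 \<le> sdens d x / snorm d" using sdens_nonneg snorm_pos[OF assms(1)] by simp
  ultimately show "\<exists>y. (cap d has_real_derivative y) (at x) \<and> 0 \<le> y" by blast
qed (rule continuous_on_subset[OF cap_continuous], use assms in auto)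

lemma cap_le_1: "4 \<le> d \<Longrightarrow> \<bar>h\<bar> \<le> 1 \<Longrightarrow> cap d h \<le> 1"
  using cap_mono[of d h 1] cap_1[of d] by auto

lemma cap_pos:
  assumes "4 \<le> d" "\<bar>h\<bar> < 1"
  shows "0 < cap d h"
proof -
  have "cap d ((h - 1) / 2) < cap d h"
  proof (rule DERIV_pos_imp_increasing[where f = "cap d"])
    show "(h - 1) / 2 < h" using assms by (simp add: field_simps abs_less_iff)
    fix x assume x: "(h - 1) / 2 \<le> x" "x \<le> h"
    then have x1: "\<bar>x\<bar> < 1" using assms by (auto simp: abs_less_iff field_simps)
    then have "(cap d has_real_derivative sdens d x / snorm d) (at x)"
      using assms by (intro cap_derivative) auto
    moreover have "0 < sdens d x / snorm d" using sdens_pos[OF x1] snorm_pos[OF assms(1)] by simp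
    ultimately show "\<exists>y. (cap d has_real_derivative y) (at x) \<and> 0 < y" by blast
  qed
  then show ?thesis using cap_nonneg[OF assms(1), of "(h - 1) / 2"] by linarith
qed

text \<open>The reversed hazard rate of the distribution function \<open>cap d\<close>, weighted by
  \<open>1 - h^2\<close>, the speed factor with which boosts move a height. This weight is the one
  that occurs in Stein's identity.\<close>

definition hazard :: "nat \<Rightarrow> real \<Rightarrow> real" where
  "hazard d h = (1 - h\<^sup>2) * (sdens d h / snorm d) / cap d h"

text \<open>With \<open>?N\<close> the numerator of \<open>hazard\<close>, the equation
  \<open>?N' = - (d - 1) x cap'\<close> turns the quotient rule into
  \<open>hazard' = - cap' * ?K / cap^2\<close>, so everything depends on the sign of
  \<open>?K\<close>.\<close>

lemma hazard_antimono:
  assumes d: "4 \<le> d" and hk: "-1 < h" "h \<le> k" "k < 1"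
  shows "hazard d k \<le> hazard d h"
proof -
  let ?N = "\<lambda>x. (1 - x\<^sup>2) * sdens d x / snorm d"
  let ?K = "\<lambda>x. ?N x + (real d - 1) * (x * cap d x)"
  have Z: "0 < snorm d" by (rule snorm_pos[OF d])
  have dN: "(?N has_real_derivative - ((real d - 1) * x * sdens d x) / snorm d) (at x)" if "\<bar>x\<bar> < 1"
      for x
    by (rule DERIV_cdivide[OF one_minus_square_sdens_derivative[OF that]])
  \<comment> \<open>\<open>?K\<close> vanishes at -1, and its derivative collapses to
    \<open>(real d - 1) * cap d y\<close>, which is nonnegative. Thus the sign is right for negative
    \<open>x\<close> as well.\<close>
  have K: "0 \<le> ?K x" if x: "\<bar>x\<bar> < 1" for x
  proof -
    have "?K (- 1) \<le> ?K x"
    proof (rule DERIV_nonneg_imp_increasing_open[where f = ?K])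
      fix y assume y: "- 1 < y" "y < x"
      then have y1: "\<bar>y\<bar> < 1" using x by auto
      have "(?K has_real_derivative - ((real d - 1) * y * sdens d y) / snorm d +
         (real d - 1) * (1 * cap d y + sdens d y / snorm d * y)) (at y)"
        by (intro DERIV_add dN DERIV_cmult DERIV_mult DERIV_ident cap_derivative d y1)
      also have "- ((real d - 1) * y * sdens d y) / snorm d + (real d - 1) * (1 * cap d y + sdens d y /
          snorm d * y)
          = (real d - 1) * cap d y"
        using Z by (simp add: field_simps)
      finally show "\<exists>z. (?K has_real_derivative z) (at y) \<and> 0 \<le> z"
        using cap_nonneg[OF d, of y] d by (intro exI[of _ "(real d - 1) * cap d y"]) auto
    next
      show "continuous_on {-1..x} ?K"
        using Z x by (intro continuous_intros sdens_continuous d continuous_on_subset[OF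
            cap_continuous[OF d]]) auto
    qed (use x in auto)
    then show ?thesis by (simp add: cap_minus_1)
  qed
  show ?thesis
  proof (rule DERIV_nonpos_imp_nonincreasing[where f = "hazard d", OF hk(2)])
    fix x assume "h \<le> x" "x \<le> k"
    then have x: "\<bar>x\<bar> < 1" using hk by auto
    have c: "0 < cap d x" by (rule cap_pos[OF d x])
    have "((\<lambda>x. ?N x / cap d x) has_real_derivative
      (- ((real d - 1) * x * sdens d x) / snorm d * cap d x - ?N x * (sdens d x / snorm d)) /
          (cap d x * cap d x)) (at x)"
      using c by (intro DERIV_divide dN cap_derivative d x) auto
    also have "- ((real d - 1) * x * sdens d x) / snorm d * cap d x - ?N x * (sdens d x / snorm d) =
        - (sdens d x / snorm d * ?K x)"
      using Z by (simp add: field_simps)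
    finally have "(hazard d has_real_derivative - (sdens d x / snorm d * ?K x) / (cap d x * cap d x))
        (at x)"
      unfolding hazard_def by simp
    moreover have "- (sdens d x / snorm d * ?K x) / (cap d x * cap d x) \<le> 0"
      using K[OF x] sdens_nonneg[of d x] Z c
          by (intro divide_nonpos_pos) (auto intro!: mult_nonneg_nonneg)
    ultimately show "\<exists>y. (hazard d has_real_derivative y) (at x) \<and> y \<le> 0" by blast
  qed
qed

section \<open>The hyperplane spanned by \<open>d\<close> points\<close>

text \<open>For pairwise orthogonal \<open>r i\<close> this is the projection of \<open>y\<close>
  onto their orthogonal complement. A null vector \<open>r i\<close> drops out because division by 0
  gives 0, so linear independence need not be presupposed.\<close>

definition residual :: "nat \<Rightarrow> (nat \<Rightarrow> nat \<Rightarrow> real) \<Rightarrow> nat \<Rightarrow> (nat \<Rightarrow> real) \<Rightarrow> nat \<Rightarrow> real" where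
  "residual d r k y = (\<lambda>l. y l - (\<Sum>i<k. ip d y (r i) / ip d (r i) (r i) * r i l))"

context notes sum.cong [fundef_cong]
begin
function gram_schmidt :: "nat \<Rightarrow> (nat \<Rightarrow> nat \<Rightarrow> real) \<Rightarrow> nat \<Rightarrow> nat \<Rightarrow> real" where
  "gram_schmidt d v k = (\<lambda>l. v k l - (\<Sum>i<k. ip d (v k) (gram_schmidt d v i) /
      ip d (gram_schmidt d v i) (gram_schmidt d v i) * gram_schmidt d v i l))"
  by pat_completeness auto
termination by (relation "Wellfounded.measure (\<lambda>(d, v, k). k)") auto
end

declare gram_schmidt.simps [simp del]

lemma gram_schmidt_residual: "gram_schmidt d v k = residual d (gram_schmidt d v) k (v k)"
  by (subst gram_schmidt.simps) (simp add: residual_def)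

lemma gram_schmidt_cong: "(\<And>i. i \<le> k \<Longrightarrow> v i = v' i) \<Longrightarrow> gram_schmidt d v k = gram_schmidt d v' k"
proof (induction k rule: less_induct)
  case (less k)
  have "v i = v' i" if "i \<le> k" for i using less.prems that .
  moreover from this have "gram_schmidt d v i = gram_schmidt d v' i" if "i < k" for i
    using that by (intro less.IH) auto
  ultimately show ?case unfolding gram_schmidt.simps[of d v k] gram_schmidt.simps[of d v' k] by simp
qed

lemma ip_diff_left: "ip d (\<lambda>l. a l - b l) y = ip d a y - ip d b y"
  by (simp add: ip_def left_diff_distrib sum_subtractf)

lemma ip_sum_left: "ip d (\<lambda>l. \<Sum>i\<in>A. c i * r i l) y = (\<Sum>i\<in>A. c i * ip d (r i) y)"
  unfolding ip_def sum_distrib_left sum_distrib_right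
  by (subst sum.swap) (simp add: mult.assoc)

lemma ip_residual: "ip d (residual d r k y) w = ip d y w - (\<Sum>i<k. ip d y (r i) / ip d (r i) (r i) *
  ip d (r i) w)"
  unfolding residual_def ip_diff_left ip_sum_left ..

lemma ip_eq_0_if_null: "ip d w w = 0 \<Longrightarrow> ip d y w = 0"
  using ip_Cauchy_Schwarz[of d y w] by (simp add: nrm_def)

text \<open>If \<open>r i\<close> is null, then its coefficient is 0 and
  \<open>ip d y (r i) = 0\<close> by Cauchy-Schwarz, so the claim survives in the degenerate
  case.\<close>

lemma ip_residual_basis:
  assumes "\<And>i j. i < k \<Longrightarrow> j < k \<Longrightarrow> i \<noteq> j \<Longrightarrow> ip d (r i) (r j) = 0" and "i < k"
  shows "ip d (residual d r k y) (r i) = 0"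
proof -
  have "(\<Sum>j<k. ip d y (r j) / ip d (r j) (r j) * ip d (r j) (r i)) =
      (\<Sum>j<k. if j = i then ip d y (r i) / ip d (r i) (r i) * ip d (r i) (r i) else 0)"
    using assms by (intro sum.cong) auto
  also have "\<dots> = ip d y (r i)"
    using assms(2) ip_eq_0_if_null[of d "r i" y] by auto
  finally show ?thesis by (simp add: ip_residual)
qed

lemma gram_schmidt_orthogonal: "i < k \<Longrightarrow> ip d (gram_schmidt d v k) (gram_schmidt d v i) = 0"
proof (induction k arbitrary: i rule: less_induct)
  case (less k)
  show ?case
  proof (subst gram_schmidt_residual, rule ip_residual_basis)
    fix i j assume "i < k" "j < k" "i \<noteq> j"
    then show "ip d (gram_schmidt d v i) (gram_schmidt d v j) = 0"
      using less.IH[of i j] less.IH[of j i] by (cases "i < j") (auto simp: ip_commute)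
  qed fact
qed

lemma gram_schmidt_orthogonal': "i \<noteq> k \<Longrightarrow> ip d (gram_schmidt d v k) (gram_schmidt d v i) = 0"
  using gram_schmidt_orthogonal[of i k d v] gram_schmidt_orthogonal[of k i d v]
  by (cases "i < k") (auto simp: ip_commute)

text \<open>The two families have the same span; it is expressed through orthogonal complements, the
  only form in which it is used.\<close>

lemma gram_schmidt_orthogonal_iff:
  "(\<forall>i<k. ip d (gram_schmidt d v i) w = 0) \<longleftrightarrow> (\<forall>i<k. ip d (v i) w = 0)"
proof (induction k)
  case (Suc k)
  have "ip d (gram_schmidt d v k) w = ip d (v k) w" if "\<forall>i<k. ip d (gram_schmidt d v i) w = 0"
    using that by (subst gram_schmidt_residual) (simp add: ip_residual)
  then show ?case using Suc by (auto simp: less_Suc_eq)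
qed simp

lemma ip_gram_schmidt:
  "ip d (gram_schmidt d v k) w = ip d (v k) w - (\<Sum>i<k. ip d (v k) (gram_schmidt d v i) /
     ip d (gram_schmidt d v i) (gram_schmidt d v i) * ip d (gram_schmidt d v i) w)"
  by (subst gram_schmidt_residual) (rule ip_residual)

lemma ip_gram_schmidt_self: "ip d (gram_schmidt d v k) (gram_schmidt d v k) =
  ip d (v k) (gram_schmidt d v k)"
  by (subst ip_gram_schmidt) (simp add: gram_schmidt_orthogonal' ip_commute)

definition unit_vec :: "nat \<Rightarrow> nat \<Rightarrow> real" where
  "unit_vec j = (\<lambda>l. if l = j then 1 else 0)"

lemma ip_unit_vec: "j < d \<Longrightarrow> ip d (unit_vec j) w = w j"
  by (simp add: ip_def unit_vec_def if_distrib[of "\<lambda>a. a * _"] cong: if_cong)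

text \<open>The projection of the \<open>j\<close>-th basis vector onto the complement of the first
  \<open>k\<close> vectors. Normal vectors are taken from these projections, which depend measurably
  on the data.\<close>

definition perp :: "nat \<Rightarrow> (nat \<Rightarrow> nat \<Rightarrow> real) \<Rightarrow> nat \<Rightarrow> nat \<Rightarrow> nat \<Rightarrow> real" where
  "perp d v k j = residual d (gram_schmidt d v) k (unit_vec j)"

lemma perp_orthogonal: "i < k \<Longrightarrow> ip d (perp d v k j) (gram_schmidt d v i) = 0"
  unfolding perp_def by (rule ip_residual_basis) (auto intro: gram_schmidt_orthogonal')

lemma ip_perp:
  assumes "\<forall>i<k. ip d (gram_schmidt d v i) w = 0" "j < d"
  shows "ip d (perp d v k j) w = w j"
  using assms by (simp add: perp_def ip_residual ip_unit_vec)

text \<open>The sum is the trace of the orthogonal projection onto the complement, hence its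
  dimension. This replaces extension to a basis: for \<open>k < d\<close> the trace is positive, so
  some projection is nonzero.\<close>

lemma sum_perp:
  "(\<Sum>j<d. ip d (perp d v k j) (perp d v k j)) =
     real d - real (card {i. i < k \<and> ip d (gram_schmidt d v i) (gram_schmidt d v i) \<noteq> 0})"
proof -
  let ?r = "gram_schmidt d v"
  have "ip d (perp d v k j) (perp d v k j) = 1 - (\<Sum>i<k. ?r i j * ?r i j / ip d (?r i) (?r i))"
      if "j < d" for j
  proof -
    have "ip d (perp d v k j) (perp d v k j) = perp d v k j j"
      using that perp_orthogonal by (intro ip_perp) (auto simp: ip_commute)
    also have "\<dots> = 1 - (\<Sum>i<k. ?r i j * ?r i j / ip d (?r i) (?r i))"
      using that by (simp add: perp_def residual_def ip_unit_vec) (simp add: unit_vec_def)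
    finally show ?thesis .
  qed
  then have "(\<Sum>j<d. ip d (perp d v k j) (perp d v k j)) =
      (\<Sum>j<d. 1 - (\<Sum>i<k. ?r i j * ?r i j / ip d (?r i) (?r i)))" by simp
  also have "\<dots> = real d - (\<Sum>i<k. ip d (?r i) (?r i) / ip d (?r i) (?r i))"
    unfolding sum_subtractf by (subst sum.swap) (simp add: sum_divide_distrib[symmetric] ip_def)
  also have "(\<Sum>i<k. ip d (?r i) (?r i) / ip d (?r i) (?r i)) =
      (\<Sum>i<k. if ip d (?r i) (?r i) \<noteq> 0 then 1 else 0)"
    by (intro sum.cong) auto
  also have "\<dots> = real (card {i. i < k \<and> ip d (?r i) (?r i) \<noteq> 0})"
    by (simp add: sum.If_cases Int_def lessThan_def)
  finally show ?thesis .
qed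

lemma ip_radial_proj: "ip d (radial_proj d z) w = ip d z w / nrm d z"
  unfolding ip_def sum_divide_distrib by (intro sum.cong) (auto simp: radial_proj_def)

lemma nrm_eq_0_iff: "nrm d z = 0 \<longleftrightarrow> ip d z z = 0"
  by (simp add: nrm_def)

lemma exists_perp:
  assumes "k < d"
  shows "\<exists>j<d. nrm d (perp d v k j) \<noteq> 0"
proof (rule ccontr)
  assume "\<not> ?thesis"
  then have "(\<Sum>j<d. ip d (perp d v k j) (perp d v k j)) = 0" by (simp add: nrm_eq_0_iff)
  moreover have "card {i. i < k \<and> ip d (gram_schmidt d v i) (gram_schmidt d v i) \<noteq> 0} \<le> card {..<k}"
    by (intro card_mono) auto
  ultimately show False using assms by (simp add: sum_perp)
qed

lemma exists_unit_orthogonal: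
  assumes "k < d"
  shows "\<exists>u\<in>unit_sphere d. \<forall>i<k. ip d (gram_schmidt d v i) u = 0"
proof -
  obtain j where "nrm d (perp d v k j) \<noteq> 0" using exists_perp[OF assms] by blast
  then show ?thesis
    by (intro bexI[of _ "radial_proj d (perp d v k j)"])
       (auto simp: ip_commute[of d "gram_schmidt d v _"] ip_radial_proj perp_orthogonal intro:
           radial_proj_in_unit_sphere)
qed

text \<open>The shift by 2 numbers the \<open>d - 1\<close> edge vectors at \<open>x 1\<close> from
  0, as Gram-Schmidt expects, while the points are numbered from 1.\<close>

definition edges :: "(nat \<Rightarrow> nat \<Rightarrow> real) \<Rightarrow> nat \<Rightarrow> nat \<Rightarrow> real" where
  "edges x k = (\<lambda>l. x (k + 2) l - x 1 l)"

text \<open>Affine independence of \<open>x 1\<close>, ..., \<open>x d\<close>, in a form that is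
  evidently measurable and can be verified by adding one point at a time.\<close>

definition generic :: "nat \<Rightarrow> (nat \<Rightarrow> nat \<Rightarrow> real) \<Rightarrow> bool" where
  "generic d x \<longleftrightarrow> (\<forall>k<d - 1. ip d (gram_schmidt d (edges x) k) (gram_schmidt d (edges x) k) \<noteq> 0)"

text \<open>At most one summand is nonzero, that of the first nonvanishing projection.\<close>

definition hnormal :: "nat \<Rightarrow> (nat \<Rightarrow> nat \<Rightarrow> real) \<Rightarrow> nat \<Rightarrow> real" where
  "hnormal d x = (\<lambda>l. \<Sum>j<d. if nrm d (perp d (edges x) (d - 1) j) \<noteq> 0 \<and>
      (\<forall>i<j. nrm d (perp d (edges x) (d - 1) i) = 0)
     then radial_proj d (perp d (edges x) (d - 1) j) l else 0)"

definition height :: "nat \<Rightarrow> (nat \<Rightarrow> nat \<Rightarrow> real) \<Rightarrow> real" where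
  "height d x = ip d (x 1) (hnormal d x)"

definition spanning :: "nat \<Rightarrow> (nat \<Rightarrow> nat \<Rightarrow> real) \<Rightarrow> (nat \<Rightarrow> real) \<Rightarrow> real \<Rightarrow> bool" where
  "spanning d x u h \<longleftrightarrow> u \<in> unit_sphere d \<and> (\<forall>i\<in>{1..d}. ip d (x i) u = h)"

lemma spanning_iff_orthogonal:
  assumes "2 \<le> d"
  shows "spanning d x u h \<longleftrightarrow> u \<in> unit_sphere d \<and> h = ip d (x 1) u \<and>
    (\<forall>k<d - 1. ip d (gram_schmidt d (edges x) k) u = 0)"
proof -
  have "(\<forall>i\<in>{1..d}. ip d (x i) u = h) \<longleftrightarrow> h = ip d (x 1) u \<and> (\<forall>k<d - 1. ip d (x (k + 2)) u =
      ip d (x 1) u)"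
    (is "?L \<longleftrightarrow> ?R")
  proof
    assume ?R
    show ?L
    proof
      fix i assume "i \<in> {1..d}"
      then have "i = 1 \<or> (i = (i - 2) + 2 \<and> i - 2 < d - 1)" by auto
      then show "ip d (x i) u = h" using \<open>?R\<close> by metis
    qed
  qed (use assms in auto)
  then show ?thesis
    unfolding spanning_def gram_schmidt_orthogonal_iff by (auto simp: edges_def ip_diff_left)
qed

lemma hnormal_cases:
  assumes "1 \<le> d"
  obtains j where "j < d" "nrm d (perp d (edges x) (d - 1) j) \<noteq> 0" "hnormal d x =
      radial_proj d (perp d (edges x) (d - 1) j)"
proof -
  let ?P = "\<lambda>j. nrm d (perp d (edges x) (d - 1) j) \<noteq> 0"
  obtain j0 where j0: "j0 < d" "?P j0" using exists_perp[of "d - 1" d] assms by auto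
  define j where "j = (LEAST j. ?P j)"
  have j: "?P j" "j \<le> j0" "\<forall>i<j. \<not> ?P i"
    unfolding j_def using LeastI[of ?P j0] Least_le[of ?P j0] j0(2) by (auto dest: not_less_Least)
  have "(?P i \<and> (\<forall>i'<i. \<not> ?P i')) \<longleftrightarrow> i = j" for i
    using j(1,3) by (cases i j rule: linorder_cases) auto
  then have "hnormal d x = radial_proj d (perp d (edges x) (d - 1) j)"
    unfolding hnormal_def using j(2) j0(1) by (auto simp: fun_eq_iff)
  then show ?thesis using that[of j] j j0 by auto
qed

text \<open>Holds for all configurations: the edges leave at least one orthogonal direction, and any
  nonzero projection onto the complement is normal to them. Genericity enters only for
  uniqueness.\<close>

lemma spanning_hnormal:
  assumes "2 \<le> d"
  shows "spanning d x (hnormal d x) (height d x)"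
proof -
  obtain j where j: "nrm d (perp d (edges x) (d - 1) j) \<noteq> 0" "hnormal d x =
      radial_proj d (perp d (edges x) (d - 1) j)"
    using hnormal_cases[of d x] assms by auto
  show ?thesis unfolding spanning_iff_orthogonal[OF assms] height_def j(2)
    using j(1) by (auto intro: radial_proj_in_unit_sphere
        simp: ip_commute[of d "gram_schmidt d _ _"] ip_radial_proj perp_orthogonal)
qed

lemma ip_diff_scale_self:
  "ip d (\<lambda>l. y l - c * u l) (\<lambda>l. y l - c * u l) = ip d y y - 2 * c * ip d y u + c\<^sup>2 * ip d u u"
  unfolding ip_def sum_distrib_left sum_subtractf[symmetric] sum.distrib[symmetric]
  by (intro sum.cong) (auto simp: algebra_simps power2_eq_square)

text \<open>Since \<open>u\<^sub>j = \<langle>N\<^sub>j, u\<rangle>\<close> for the projections \<open>N\<^sub>j\<close> of the basis vectors, and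
  \<open>\<Sum>\<^sub>j |N\<^sub>j|\<^sup>2 = 1 = \<Sum>\<^sub>j u\<^sub>j\<^sup>2\<close>, the Cauchy-Schwarz inequality is an equality for every \<open>j\<close>.\<close>

lemma generic_perp:
  assumes d: "2 \<le> d" and g: "generic d x" and s: "spanning d x u h" and jl: "j < d" "l < d"
  shows "perp d (edges x) (d - 1) j l = u j * u l"
proof -
  let ?N = "perp d (edges x) (d - 1)"
  have u: "ip d u u = 1" and o: "\<forall>k<d - 1. ip d (gram_schmidt d (edges x) k) u = 0"
    using s unfolding spanning_iff_orthogonal[OF d] by (auto intro: unit_sphere_ip)
  have "{i. i < d - 1 \<and> ip d (gram_schmidt d (edges x) i) (gram_schmidt d (edges x) i) \<noteq> 0} =
      {..<d - 1}"
    using g by (auto simp: generic_def)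
  then have S: "(\<Sum>j<d. ip d (?N j) (?N j)) = 1" using d by (simp add: sum_perp of_nat_diff)
  have e: "ip d (\<lambda>l. ?N j l - u j * u l) (\<lambda>l. ?N j l - u j * u l) = ip d (?N j) (?N j) - u j * u j"
      if "j < d" for j
  proof -
    have c: "ip d (?N j) u = u j" by (rule ip_perp[OF o that])
    show ?thesis unfolding ip_diff_scale_self c u by (simp add: power2_eq_square)
  qed
  have "(\<Sum>j<d. ip d (\<lambda>l. ?N j l - u j * u l) (\<lambda>l. ?N j l - u j * u l)) =
      (\<Sum>j<d. ip d (?N j) (?N j) - u j * u j)"
    by (intro sum.cong refl e) simp
  also have "\<dots> = 1 - ip d u u" by (simp only: sum_subtractf S ip_def[of d u])
  finally have "(\<Sum>j<d. ip d (\<lambda>l. ?N j l - u j * u l) (\<lambda>l. ?N j l - u j * u l)) = 1 - ip d u u" .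
  then have "ip d (\<lambda>l. ?N j l - u j * u l) (\<lambda>l. ?N j l - u j * u l) = 0"
    using jl u by (simp add: sum_nonneg_eq_0_iff ip_nonneg)
  then have "(?N j l - u j * u l) * (?N j l - u j * u l) = 0"
    using jl unfolding ip_def[of d "\<lambda>l. ?N j l - u j * u l"] by (subst (asm) sum_nonneg_eq_0_iff) auto
  then show ?thesis by simp
qed

text \<open>By \<open>generic_perp\<close> all products \<open>u j * u l\<close> are determined by
  the points, which fixes \<open>u\<close> up to a sign; \<open>h\<close> follows as
  \<open>ip d (x 1) u\<close>.\<close>

lemma generic_unique:
  assumes d: "2 \<le> d" and g: "generic d x" and s: "spanning d x u h" "spanning d x u' h'"
  shows "(u' = u \<and> h' = h) \<or> (u' = (\<lambda>l. - u l) \<and> h' = - h)"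
proof -
  have eq: "u' j * u' l = u j * u l" if "j < d" "l < d" for j l
    using generic_perp[OF d g s(1) that] generic_perp[OF d g s(2) that] by simp
  have us: "u \<in> unit_sphere d" "u' \<in> unit_sphere d" and hh: "h = ip d (x 1) u" "h' = ip d (x 1) u'"
    using s d by (auto simp: spanning_def)
  have z: "u l = 0" "u' l = 0" if "\<not> l < d" for l using us that by (auto simp: unit_sphere_def Rd_def)
  have "ip d u u \<noteq> 0" using unit_sphere_ip[OF us(1)] by simp
  then obtain j where j: "j < d" "u j \<noteq> 0"
      by (auto simp: ip_def elim: sum.not_neutral_contains_not_neutral)
  have "u' j * u' j = u j * u j" using eq j by simp
  then consider "u' j = u j" | "u' j = - u j" by (auto simp: square_eq_iff)
  then show ?thesis
  proof cases
    case 1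
    then have "u' l = u l" for l using eq[of j l] j z[of l] by (cases "l < d") auto
    then have "u' = u" by auto
    then show ?thesis using hh by simp
  next
    case 2
    then have "u' l = - u l" for l
    proof (cases "l < d")
      case True
      then have "u j * (u' l + u l) = 0" using eq[of j l] j 2 by (simp add: algebra_simps)
      then show ?thesis using j by simp
    qed (use z in auto)
    then have "u' = (\<lambda>l. - u l)" by auto
    then show ?thesis using hh by (simp add: ip_def sum_negf)
  qed
qed

text \<open>A hyperplane at distance 1 touches the sphere in the single point \<open>h * u\<close>.
  Then \<open>x 1\<close> and \<open>x 2\<close> coincide and the first edge is null.\<close>

lemma generic_height:
  assumes d: "2 \<le> d" and g: "generic d x" and s: "spanning d x u h" and x: "x 1 \<in> unit_sphere d" "x 2 \<in>
      unit_sphere d"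
  shows "\<bar>h\<bar> < 1"
proof (rule ccontr)
  assume "\<not> \<bar>h\<bar> < 1"
  have u: "u \<in> unit_sphere d" and h: "ip d (x 1) u = h" "ip d (x 2) u = h" using s d
      by (auto simp: spanning_def)
  have "\<bar>h\<bar> \<le> 1" using unit_sphere_ip_le[OF x(1) u] h by simp
  then have h2: "h * h = 1" using \<open>\<not> \<bar>h\<bar> < 1\<close> by (auto simp: abs_if split: if_splits)
  have Z: "ip d (\<lambda>l. y l - h * u l) (\<lambda>l. y l - h * u l) = 0" if "y \<in> unit_sphere d" "ip d y u = h" for y
    using that h2 unit_sphere_ip[OF u] unit_sphere_ip[OF that(1)]
    by (simp add: ip_diff_scale_self power2_eq_square)
  have yl: "y l = h * u l" if "y \<in> unit_sphere d" "ip d y u = h" "l < d" for y l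
    using Z[OF that(1,2)] that(3) unfolding ip_def[of d "\<lambda>l. y l - h * u l"]
        by (simp add: sum_nonneg_eq_0_iff)
  have "x 2 l = x 1 l" if "l < d" for l using yl[OF x(1) h(1) that] yl[OF x(2) h(2) that] by simp
  then have "ip d (edges x 0) (edges x 0) = 0" by (simp add: edges_def ip_def numeral_2_eq_2[symmetric])
  moreover have "gram_schmidt d (edges x) 0 = edges x 0" by (subst gram_schmidt.simps) simp
  moreover have "0 < d - 1" using d by simp
  ultimately show False using g unfolding generic_def by metis
qed

section \<open>Measurability and almost sure affine independence\<close>

lemma ip_measurable2:
  assumes "f \<in> M \<rightarrow>\<^sub>M borel" "g \<in> M \<rightarrow>\<^sub>M borel"
  shows "(\<lambda>x. ip d (f x) (g x)) \<in> borel_measurable M"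
proof -
  have "(\<lambda>x. f x j) \<in> borel_measurable M" "(\<lambda>x. g x j) \<in> borel_measurable M" for j
    using measurable_compose[OF assms(1) coord_borel] measurable_compose[OF assms(2) coord_borel]
        by auto
  then show ?thesis unfolding ip_def by (intro borel_measurable_sum borel_measurable_times)
qed

lemma nrm_measurable2:
  assumes "f \<in> M \<rightarrow>\<^sub>M borel"
  shows "(\<lambda>x. nrm d (f x)) \<in> borel_measurable M"
proof -
  have "(\<lambda>y. sqrt y) \<in> borel_measurable borel" by measurable
  then show ?thesis unfolding nrm_def
    by (rule measurable_compose[rotated]) (intro ip_measurable2 assms)
qed

lemma residual_measurable:
  assumes "y \<in> M \<rightarrow>\<^sub>M borel" and r: "\<And>i. i < k \<Longrightarrow> (\<lambda>x. r x i) \<in> M \<rightarrow>\<^sub>M borel"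
  shows "(\<lambda>x. residual d (r x) k (y x)) \<in> M \<rightarrow>\<^sub>M borel"
proof (rule measurable_coordinatewise_then_product)
  fix l
  have "(\<lambda>x. r x i l) \<in> borel_measurable M" if "i < k" for i
    using measurable_compose[OF r[OF that] coord_borel] .
  moreover have "(\<lambda>x. y x l) \<in> borel_measurable M"
    using measurable_compose[OF assms(1) coord_borel] .
  ultimately show "(\<lambda>x. residual d (r x) k (y x) l) \<in> borel_measurable M"
    unfolding residual_def using r assms(1)
    by (intro borel_measurable_diff borel_measurable_sum borel_measurable_times borel_measurable_divide
        ip_measurable2) auto
qed

lemma gram_schmidt_measurable:
  assumes "\<And>i. i \<le> k \<Longrightarrow> (\<lambda>x. v x i) \<in> M \<rightarrow>\<^sub>M borel"
  shows "(\<lambda>x. gram_schmidt d (v x) k) \<in> M \<rightarrow>\<^sub>M borel"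
  using assms
proof (induction k rule: less_induct)
  case (less k)
  show ?case unfolding gram_schmidt_residual[of d _ k]
    using less by (intro residual_measurable) auto
qed

lemma perp_measurable:
  assumes "\<And>i. i < k \<Longrightarrow> (\<lambda>x. v x i) \<in> M \<rightarrow>\<^sub>M borel"
  shows "(\<lambda>x. perp d (v x) k j) \<in> M \<rightarrow>\<^sub>M borel"
  unfolding perp_def using assms by (intro residual_measurable gram_schmidt_measurable) auto

lemma edges_measurable:
  assumes "(\<lambda>x. x 1) \<in> M \<rightarrow>\<^sub>M borel" "(\<lambda>x. x (i + 2)) \<in> M \<rightarrow>\<^sub>M borel"
  shows "(\<lambda>x. edges x i) \<in> M \<rightarrow>\<^sub>M borel"
proof (rule measurable_coordinatewise_then_product)
  fix l
  show "(\<lambda>x. edges x i l) \<in> borel_measurable M"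
    using measurable_compose[OF assms(1) coord_borel] measurable_compose[OF assms(2) coord_borel]
    unfolding edges_def by (intro borel_measurable_diff) auto
qed

lemma Sph_component: "i \<in> I \<Longrightarrow> (\<lambda>x. x i) \<in> Sph d I \<rightarrow>\<^sub>M borel"
  using measurable_component_singleton[of i I "\<lambda>_. uniform_sphere d"]
      by (simp cong: measurable_cong_sets)

lemma edges_measurable_Sph: "k < d - 1 \<Longrightarrow> (\<lambda>x. edges x k) \<in> Sph d {1..d} \<rightarrow>\<^sub>M borel"
  by (intro edges_measurable Sph_component) auto

lemma pred_neq_0:
  fixes f :: "'a \<Rightarrow> real"
  assumes [measurable]: "f \<in> borel_measurable M"
  shows "Measurable.pred M (\<lambda>x. f x \<noteq> 0)"
  by measurable

lemma generic_measurable [measurable]: "Measurable.pred (Sph d {1..d}) (generic d)"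
proof -
  have "Measurable.pred (Sph d {1..d}) (\<lambda>x. \<forall>k\<in>{..<d - 1}. ip d (gram_schmidt d (edges x) k)
      (gram_schmidt d (edges x) k) \<noteq> 0)"
    by (intro pred_intros_finite pred_neq_0 ip_measurable2 gram_schmidt_measurable edges_measurable_Sph)
        auto
  also have "(\<lambda>x. \<forall>k\<in>{..<d - 1}. ip d (gram_schmidt d (edges x) k) (gram_schmidt d (edges x) k) \<noteq> 0) =
      generic d"
    by (simp only: generic_def[abs_def] Ball_def lessThan_iff)
  finally show ?thesis .
qed

lemma measurable_first_nonzero:
  fixes n q :: "nat \<Rightarrow> 'a \<Rightarrow> real"
  assumes [measurable]: "\<And>j. n j \<in> borel_measurable M" "\<And>j. q j \<in> borel_measurable M"
  shows "(\<lambda>x. \<Sum>j<d. if n j x \<noteq> 0 \<and> (\<forall>i<j. n i x = 0) then q j x else 0) \<in> borel_measurable M"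
  by measurable

lemma hnormal_measurable [measurable]: "hnormal d \<in> Sph d {1..d} \<rightarrow>\<^sub>M borel"
proof (rule measurable_coordinatewise_then_product)
  fix l
  have p: "(\<lambda>x. perp d (edges x) (d - 1) j) \<in> Sph d {1..d} \<rightarrow>\<^sub>M borel" for j
    by (intro perp_measurable edges_measurable_Sph)
  have n: "(\<lambda>x. nrm d (perp d (edges x) (d - 1) j)) \<in> borel_measurable (Sph d {1..d})" for j
    by (intro nrm_measurable2 p)
  have q: "(\<lambda>x. radial_proj d (perp d (edges x) (d - 1) j) l) \<in> borel_measurable (Sph d {1..d})" for j
    unfolding radial_proj_def
    by (cases "l < d") (simp_all only: if_True if_False borel_measurable_const,
        rule borel_measurable_divide[OF measurable_compose[OF p coord_borel] n])
  show "(\<lambda>x. hnormal d x l) \<in> borel_measurable (Sph d {1..d})"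
    unfolding hnormal_def by (rule measurable_first_nonzero[OF n q])
qed

lemma height_measurable [measurable]: "height d \<in> borel_measurable (Sph d {1..d})"
proof (cases "d = 0")
  case False
  then have "(\<lambda>x. x 1) \<in> Sph d {1..d} \<rightarrow>\<^sub>M borel" by (intro Sph_component) auto
  then show ?thesis unfolding height_def[abs_def] by (intro ip_measurable2 hnormal_measurable)
qed (simp add: height_def[abs_def] ip_def)

text \<open>Fubini with the inner integral over the point \<open>k + 2\<close> alone. The edges
  before the \<open>k\<close>-th do not involve it, so a unit vector \<open>u\<close> orthogonal to
  them is fixed. The \<open>k\<close>-th Gram-Schmidt vector can vanish only if the point lies on
  the hyperplane through \<open>x 1\<close> with normal \<open>u\<close>, which is a null
  event.\<close>

lemma AE_generic:
  assumes d: "4 \<le> d"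
  shows "AE x in Sph d {1..d}. generic d x"
proof -
  interpret product_prob_space "\<lambda>_::nat. uniform_sphere d" by (rule product_prob_space_Sph)
  have "AE x in Sph d {1..d}. \<forall>k\<in>{..<d - 1}. ip d (gram_schmidt d (edges x) k) (gram_schmidt d (edges x)
      k) \<noteq> 0"
  proof (intro AE_finite_allI)
    fix k assume k: "k \<in> {..<d - 1}"
    let ?Q = "\<lambda>x. ip d (gram_schmidt d (edges x) k) (gram_schmidt d (edges x) k) = 0"
    define J where "J = {1..d} - {k + 2}"
    have ins: "{1..d} = insert (k + 2) J" "k + 2 \<notin> J" "finite J" using k by (auto simp: J_def)
    have [measurable]: "(\<lambda>x. ip d (gram_schmidt d (edges x) k) (gram_schmidt d (edges x) k)) \<in>
        borel_measurable (Sph d {1..d})"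
      using k by (intro ip_measurable2 gram_schmidt_measurable edges_measurable_Sph) auto
    have m: "(\<lambda>x. indicator {x. ?Q x} x :: ennreal) \<in> borel_measurable (Sph d {1..d})"
      by measurable
    have "(\<integral>\<^sup>+x. indicator {x. ?Q x} x \<partial>Sph d {1..d}) =
        (\<integral>\<^sup>+x. (\<integral>\<^sup>+y. indicator {x. ?Q x} (x(k + 2 := y)) \<partial>uniform_sphere d) \<partial>Sph d J)"
      using ins m unfolding ins(1) by (intro product_nn_integral_insert) auto
    also have "\<dots> = (\<integral>\<^sup>+x. 0 \<partial>Sph d J)"
    proof (rule nn_integral_cong)
      fix x :: "nat \<Rightarrow> nat \<Rightarrow> real"
      obtain u where u: "u \<in> unit_sphere d" "\<forall>i<k. ip d (gram_schmidt d (edges x) i) u = 0"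
        using exists_unit_orthogonal[of k d "edges x"] less_le_trans[of k "d - 1" d] k
        by (auto simp del: One_nat_def)
      have nQ: "\<not> ?Q (x(k + 2 := y))" if y: "ip d y u \<noteq> ip d (x 1) u" for y
      proof
        let ?x = "x(k + 2 := y)"
        assume Q: "?Q ?x"
        have "gram_schmidt d (edges ?x) i = gram_schmidt d (edges x) i" if "i < k" for i
          using that by (intro gram_schmidt_cong) (auto simp: edges_def)
        then have "ip d (gram_schmidt d (edges ?x) k) u = ip d (edges ?x k) u"
          using u(2) by (subst ip_gram_schmidt) simp
        moreover have "ip d (gram_schmidt d (edges ?x) k) u = 0"
          using ip_eq_0_if_null[OF Q, of u] by (simp add: ip_commute)
        ultimately show False using y by (simp add: edges_def ip_diff_left)
      qed
      have "AE y in uniform_sphere d. indicator {x. ?Q x} (x(k + 2 := y)) = (0::ennreal)"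
        using AE_not_on_hyperplane[OF d u(1), of "ip d (x 1) u"]
      proof eventually_elim
        case (elim y)
        show ?case using nQ[OF elim] by (simp only: indicator_def mem_Collect_eq of_bool_eq)
      qed
      then have "(\<integral>\<^sup>+y. indicator {x. ?Q x} (x(k + 2 := y)) \<partial>uniform_sphere d) =
          (\<integral>\<^sup>+y. 0 \<partial>uniform_sphere d)"
        by (rule nn_integral_cong_AE)
      then show "(\<integral>\<^sup>+y. indicator {x. ?Q x} (x(k + 2 := y)) \<partial>uniform_sphere d) = 0" by simp
    qed
    finally have "(\<integral>\<^sup>+x. indicator {x. ?Q x} x \<partial>Sph d {1..d}) = 0" by simp
    then have "AE x in Sph d {1..d}. (indicator {x. ?Q x} x :: ennreal) = 0"
      by (rule iffD1[OF nn_integral_0_iff_AE[OF m]])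
    then show "AE x in Sph d {1..d}. \<not> ?Q x"
    proof eventually_elim
      case (elim x)
      show ?case
      proof
        assume "?Q x"
        then have "(indicator {x. ?Q x} x :: ennreal) = 1" by (intro indicator_simps(1) CollectI)
        then show False using elim by simp
      qed
    qed
  qed simp
  then show ?thesis
  proof eventually_elim
    case (elim x)
    then show ?case unfolding generic_def by blast
  qed
qed

section \<open>Generic points are affinely independent\<close>

lemma sum_fun_apply: "(\<Sum>i\<in>A. f i) l = (\<Sum>i\<in>A. f i l :: real)"
  by (induction A rule: infinite_finite_induct) auto

text \<open>An affine relation between the points is a linear relation between the edges. Pairing it
  with the Gram-Schmidt vector of the largest index that carries a nonzero coefficient kills all
  other terms and leaves the coefficient times a nonzero norm.\<close>

lemma generic_independent:
  assumes g: "generic d x" and d: "2 \<le> d"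
    and c: "(\<Sum>i=1..d. c i) = 0" "\<And>l. (\<Sum>i=1..d. c i * x i l) = 0" and i: "i \<in> {1..d}"
  shows "c i = 0"
proof -
  have split: "(\<Sum>i=1..d. f i) = f 1 + (\<Sum>k<d - 1. f (k + 2))" for f :: "nat \<Rightarrow> real"
  proof -
    have "{1..d} = insert 1 {2..d}" using d by auto
    then have "(\<Sum>i=1..d. f i) = f 1 + (\<Sum>i=2..d. f i)" by simp
    also have "(\<Sum>i=2..d. f i) = (\<Sum>k<d - 1. f (k + 2))"
    proof (rule sum.reindex_bij_witness[of _ "\<lambda>k. k + 2" "\<lambda>i. i - 2"])
      fix i assume "i \<in> {2..d}"
      then show "i - 2 + 2 = i" "f (i - 2 + 2) = f i" "i - 2 \<in> {..<d - 1}"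
          by (simp_all only: le_add_diff_inverse2 atLeastAtMost_iff) auto
    qed auto
    finally show ?thesis .
  qed
  have e: "(\<Sum>k<d - 1. c (k + 2) * edges x k l) = 0" for l
  proof -
    have "(\<Sum>k<d - 1. c (k + 2) * edges x k l) = (\<Sum>i=1..d. c i * x i l) - (\<Sum>i=1..d. c i) * x 1 l"
      unfolding split edges_def by (simp add: algebra_simps sum_subtractf sum_distrib_left
          sum_distrib_right)
    then show ?thesis using c by simp
  qed
  define A where "A = {k. k < d - 1 \<and> c (k + 2) \<noteq> 0}"
  have "A = {}"
  proof (rule ccontr)
    assume "A \<noteq> {}"
    moreover have "finite A" by (simp add: A_def)
    ultimately have M: "Max A \<in> A" "\<forall>k\<in>A. k \<le> Max A" by auto
    define m where "m = Max A"
    let ?r = "gram_schmidt d (edges x) m"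
    have orth: "ip d (edges x k) ?r = 0" if "k < m" for k
      using gram_schmidt_orthogonal_iff[of m d "edges x" ?r] that
      by (auto simp: gram_schmidt_orthogonal')
    have "0 = ip d (\<lambda>l. \<Sum>k<d - 1. c (k + 2) * edges x k l) ?r" by (simp only: e) (simp add: ip_def)
    also have "\<dots> = (\<Sum>k<d - 1. c (k + 2) * ip d (edges x k) ?r)" by (rule ip_sum_left)
    also have "\<dots> = (\<Sum>k<d - 1. if k = m then c (m + 2) * ip d (edges x m) ?r else 0)"
    proof (rule sum.cong)
      fix k assume k: "k \<in> {..<d - 1}"
      show "c (k + 2) * ip d (edges x k) ?r = (if k = m then c (m + 2) * ip d (edges x m) ?r else 0)"
      proof (cases k m rule: linorder_cases)
        case greater
        then have "k \<notin> A" using M(2) by (auto simp: m_def)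
        then show ?thesis using k greater by (auto simp: A_def)
      qed (use orth in auto)
    qed simp
    also have "\<dots> = c (m + 2) * ip d ?r ?r"
      using M(1) unfolding m_def[symmetric] ip_gram_schmidt_self by (auto simp: A_def)
    finally have "c (m + 2) * ip d ?r ?r = 0" by simp
    then show False using M(1) g unfolding m_def[symmetric] by (auto simp: A_def generic_def)
  qed
  then have c2: "c (k + 2) = 0" if "k < d - 1" for k using that by (auto simp: A_def)
  then have "c 1 = 0" using c(1) unfolding split by simp
  moreover have "c i = 0" if "i \<noteq> 1"
  proof -
    have "i = (i - 2) + 2" "i - 2 < d - 1" using i that by auto
    then show ?thesis using c2 by metis
  qed
  ultimately show ?thesis by auto
qed

lemma generic_affine_independent:
  assumes g: "generic d x" and d: "2 \<le> d"
  shows "inj_on x {1..d}" "\<not> affine_dependent (x ` {1..d})"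
proof -
  show inj: "inj_on x {1..d}"
  proof (rule inj_onI, rule ccontr)
    fix i j assume ij: "i \<in> {1..d}" "j \<in> {1..d}" "x i = x j" "i \<noteq> j"
    define c where "c k = (if k = i then 1 else 0) - (if k = j then 1 else (0::real))" for k
    have "c i = 0"
    proof (rule generic_independent[OF g d])
      show "(\<Sum>k=1..d. c k) = 0" unfolding c_def sum_subtractf using ij by simp
      show "(\<Sum>k=1..d. c k * x k l) = 0" for l
        unfolding c_def left_diff_distrib sum_subtractf if_distrib[of "\<lambda>a. a * _"] using ij
        by (simp cong: if_cong)
    qed (use ij in simp)
    then show False using ij by (simp add: c_def)
  qed
  show "\<not> affine_dependent (x ` {1..d})"
  proof
    assume "affine_dependent (x ` {1..d})"
    then obtain U where U: "sum U (x ` {1..d}) = 0" "\<exists>v\<in>x ` {1..d}. U v \<noteq> 0"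
        "(\<Sum>v\<in>x ` {1..d}. U v *\<^sub>R v) = 0"
      by (subst (asm) affine_dependent_explicit_finite) auto
    have "(\<Sum>i=1..d. U (x i)) = 0"
      by (rule trans[OF _ U(1)]) (simp only: sum.reindex[OF inj] comp_def)
    moreover have "(\<Sum>i=1..d. U (x i) * x i l) = 0" for l
    proof -
      have "(\<Sum>i=1..d. U (x i) *\<^sub>R x i) = 0"
        by (rule trans[OF _ U(3)]) (simp only: sum.reindex[OF inj] comp_def)
      from fun_cong[OF this, of l] show ?thesis
        unfolding sum_fun_apply scaleR_fun_def by (simp only: real_scaleR_def zero_fun_apply)
    qed
    ultimately have "U (x i) = 0" if "i \<in> {1..d}" for i
      by (rule generic_independent[OF g d _ _ that])
    then show False using U(2) by blast
  qed
qed

section \<open>Stein's identity for the height of the spanned hyperplane\<close>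

text \<open>The action of the boost on hyperplanes is the action of the Lorentz group on the pairs
  \<open>(u, h)\<close>, up to the normalisation of \<open>u\<close>.\<close>

definition hscale :: "real \<Rightarrow> real \<Rightarrow> real \<Rightarrow> real" where
  "hscale h v t = sqrt ((h * cosh t + v * sinh t)\<^sup>2 + 1 - h\<^sup>2)"

definition hboost :: "nat \<Rightarrow> real \<Rightarrow> real \<Rightarrow> (nat \<Rightarrow> real) \<Rightarrow> nat \<Rightarrow> real" where
  "hboost j t h u = (\<lambda>l. (if l = j then u j * cosh t + h * sinh t else u l) / hscale h (u j) t)"

definition hheight :: "real \<Rightarrow> real \<Rightarrow> real \<Rightarrow> real" where
  "hheight h v t = (h * cosh t + v * sinh t) / hscale h v t"

lemma hscale_pos:
  assumes "\<bar>h\<bar> \<le> 1" "\<bar>v\<bar> \<le> 1"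
  shows "0 < hscale h v t"
proof (cases "\<bar>h\<bar> < 1")
  case True
  then show ?thesis using one_minus_square_pos[OF True]
      by (simp add: hscale_def add_nonneg_pos add_diff_eq[symmetric])
next
  case False
  then have h: "h = 1 \<or> h = -1" using assms by auto
  have "0 < cosh t + v * sinh t" "0 < cosh t + (- v) * sinh t"
    using assms by (intro cosh_sinh_bounds; simp)+
  then have "h * cosh t + v * sinh t \<noteq> 0" using h by auto
  then show ?thesis using h by (auto simp: hscale_def)
qed

lemma ip_fun_upd_divide:
  assumes "j < d"
  shows "ip d y (\<lambda>l. (if l = j then q else u l) / r) = (ip d y u + y j * (q - u j)) / r"
proof -
  have "ip d y (\<lambda>l. (if l = j then q else u l) / r) =
      (\<Sum>l<d. (y l * u l + (if l = j then y j * (q - u j) else 0)) / r)"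
    unfolding ip_def by (intro sum.cong) (auto simp: algebra_simps diff_divide_distrib
        add_divide_distrib)
  also have "\<dots> = (ip d y u + y j * (q - u j)) / r"
    unfolding sum_divide_distrib[symmetric] sum.distrib using assms by (simp add: ip_def)
  finally show ?thesis .
qed

lemma cosh_sq: "(cosh t)\<^sup>2 = (sinh t)\<^sup>2 + (1::real)"
  using cosh_square_eq[of t] by simp

text \<open>Boosts preserve the Lorentz form |u|^2 - h^2, which equals 1 - h^2 at the start. The
  boosted normal, before normalisation, thus has squared length
  \<open>(h * cosh t + u j * sinh t)^2 + 1 - h^2\<close>, the square of
  \<open>hscale\<close>.\<close>

lemma hboost_unit_sphere:
  assumes j: "j < d" and u: "u \<in> unit_sphere d" and h: "\<bar>h\<bar> \<le> 1"
  shows "hboost j t h u \<in> unit_sphere d"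
proof -
  let ?q = "u j * cosh t + h * sinh t" and ?\<nu> = "hscale h (u j) t"
  have \<nu>: "0 < ?\<nu>" by (rule hscale_pos[OF h unit_sphere_component[OF u]])
  have "0 \<le> (h * cosh t + u j * sinh t)\<^sup>2 + 1 - h\<^sup>2" using \<nu> unfolding hscale_def real_sqrt_gt_0_iff
      by simp
  then have \<nu>2: "?\<nu> * ?\<nu> = (h * cosh t + u j * sinh t)\<^sup>2 + 1 - h\<^sup>2" by (simp add: hscale_def)
  have gen: "(A / p + B / p * C) / p = (A + B * C) / (p * p)" if "p \<noteq> 0" for A B C p :: real
    using that by (simp add: field_simps)
  have "ip d (hboost j t h u) (hboost j t h u) = (ip d u (hboost j t h u) + hboost j t h u j * (?q -
      u j)) / ?\<nu>"
    by (subst (2) hboost_def) (subst ip_fun_upd_divide[OF j], subst ip_commute, rule refl)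
  also have "\<dots> = ((1 + u j * (?q - u j)) / ?\<nu> + ?q / ?\<nu> * (?q - u j)) / ?\<nu>"
    unfolding hboost_def by (subst ip_fun_upd_divide[OF j]) (simp add: unit_sphere_ip[OF u])
  also have "\<dots> = (1 + u j * (?q - u j) + ?q * (?q - u j)) / (?\<nu> * ?\<nu>)"
    by (rule gen) (use \<nu> in simp)
  also have "1 + u j * (?q - u j) + ?q * (?q - u j) = ?\<nu> * ?\<nu>"
    unfolding \<nu>2 using cosh_sq[of t] by algebra
  finally have "ip d (hboost j t h u) (hboost j t h u) = 1" using \<nu> by simp
  moreover have "hboost j t h u \<in> Rd d" using u j by (auto simp: Rd_def hboost_def unit_sphere_def)
  ultimately show ?thesis by (simp add: unit_sphere_def nrm_def)
qed

text \<open>A point \<open>y\<close> and a hyperplane are incident if (y, 1) and (u, h) are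
  orthogonal for the Lorentz form, and a boost applied to both preserves this.\<close>

lemma ip_boost_hboost:
  assumes j: "j < d" and y: "y \<in> unit_sphere d" and h: "ip d y u = h"
  shows "ip d (boost j t y) (hboost j t h u) = hheight h (u j) t"
proof -
  let ?q = "u j * cosh t + h * sinh t" and ?\<nu> = "hscale h (u j) t" and ?p = "cosh t + y j * sinh t"
  have p: "0 < ?p" by (rule cosh_sinh_bounds[OF unit_sphere_component[OF y]])
  have gen: "(A / n + B / n * C) / D = ((A + B * C) / D) / n" for A B C D n :: real
    by (cases "n = 0"; cases "D = 0") (simp_all add: field_simps)
  have "ip d (boost j t y) (hboost j t h u) =
      ((h + y j * (?q - u j)) / ?\<nu> + ?q / ?\<nu> * (y j * (cosh t - 1) + sinh t)) / ?p"
    by (subst ip_boost[OF j], unfold hboost_def, subst ip_fun_upd_divide[OF j]) (simp add: h)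
  also have "\<dots> = ((h + y j * (?q - u j) + ?q * (y j * (cosh t - 1) + sinh t)) / ?p) / ?\<nu>"
    by (rule gen)
  also have "h + y j * (?q - u j) + ?q * (y j * (cosh t - 1) + sinh t) = (h * cosh t + u j * sinh t) *
      ?p"
    using cosh_sq[of t] by algebra
  finally show ?thesis using p by (simp add: hheight_def)
qed

lemma spanning_height_le:
  assumes "spanning d x u h" "1 \<le> d" "x 1 \<in> unit_sphere d"
  shows "\<bar>h\<bar> \<le> 1"
  using assms unit_sphere_ip_le[of "x 1" d u] by (auto simp: spanning_def)

lemma spanning_boosts:
  assumes j: "j < d" and x: "\<forall>i\<in>{1..d}. x i \<in> unit_sphere d" and s: "spanning d x u h"
  shows "spanning d (boosts {1..d} j t x) (hboost j t h u) (hheight h (u j) t)"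
proof -
  have u: "u \<in> unit_sphere d" using s by (simp add: spanning_def)
  have h: "\<bar>h\<bar> \<le> 1" using j x by (intro spanning_height_le[OF s]) auto
  show ?thesis unfolding spanning_def
  proof (intro conjI ballI)
    show "hboost j t h u \<in> unit_sphere d" by (rule hboost_unit_sphere[OF j u h])
    fix i assume i: "i \<in> {1..d}"
    then have "ip d (x i) u = h" using s by (simp add: spanning_def)
    then show "ip d (boosts {1..d} j t x i) (hboost j t h u) = hheight h (u j) t"
      using i x ip_boost_hboost[OF j] by (simp add: boosts_def)
  qed
qed

lemma boost_inverse:
  assumes "x \<in> unit_sphere d"
  shows "boost j (- t) (boost j t x) = x"
proof
  fix i
  let ?p = "cosh t + x j * sinh t"
  have p: "0 < ?p" by (rule cosh_sinh_bounds[OF unit_sphere_component[OF assms]])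
  have "cosh t * ?p - (x j * cosh t + sinh t) * sinh t = 1"
    using cosh_sq[of t] by algebra
  then have D: "cosh t - (x j * cosh t + sinh t) / ?p * sinh t = 1 / ?p"
    using p by (simp add: field_simps)
  have "(x j * cosh t + sinh t) * cosh t - sinh t * ?p = x j"
    using cosh_sq[of t] by algebra
  then have Nm: "(x j * cosh t + sinh t) / ?p * cosh t - sinh t = x j / ?p"
    using p by (simp add: field_simps)
  show "boost j (- t) (boost j t x) i = x i"
    unfolding boost_def using D Nm p by (auto simp: cosh_minus sinh_minus)
qed

lemma boosts_inverse:
  assumes "\<forall>i\<in>I. x i \<in> unit_sphere d" "x \<in> space (Sph d I)"
  shows "boosts I j (- t) (boosts I j t x) = x"
  using assms boost_inverse
  by (auto simp: boosts_def space_PiM PiE_iff extensional_def fun_eq_iff)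

text \<open>Up to normalisation the action is an invertible linear map, so proportional images come
  from proportional pairs. The two unit normals force the factor to be 1 or -1.\<close>

lemma hboost_injective:
  assumes j: "j < d" and u: "u \<in> unit_sphere d" "u' \<in> unit_sphere d" and h: "\<bar>h\<bar> \<le> 1" "\<bar>h'\<bar> \<le> 1"
    and c: "\<bar>c\<bar> = 1"
    and eq: "hboost j t h u = (\<lambda>l. c * hboost j t h' u' l)" "hheight h (u j) t =
        c * hheight h' (u' j) t"
  obtains c' where "\<bar>c'\<bar> = 1" "u = (\<lambda>l. c' * u' l)" "h = c' * h'"
proof -
  define n where "n = hscale h (u j) t"
  define n' where "n' = hscale h' (u' j) t"
  have n: "0 < n" "0 < n'"
    unfolding n_def n'_def by (intro hscale_pos h unit_sphere_component[OF u(1)]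
        unit_sphere_component[OF u(2)])+
  define k where "k = c * n / n'"
  have ul: "u l = k * u' l" if "l \<noteq> j" for l
    using fun_cong[OF eq(1), of l] n that
        by (simp add: hboost_def n_def[symmetric] n'_def[symmetric] k_def field_simps)
  have e1: "u j * cosh t + h * sinh t = k * (u' j * cosh t + h' * sinh t)"
    using fun_cong[OF eq(1), of j] n
        by (simp add: hboost_def n_def[symmetric] n'_def[symmetric] k_def field_simps)
  have e2: "h * cosh t + u j * sinh t = k * (h' * cosh t + u' j * sinh t)"
    using eq(2) n by (simp add: hheight_def n_def[symmetric] n'_def[symmetric] k_def field_simps)
  have uj: "u j = k * u' j" using e1 e2 cosh_sq[of t] by algebra
  have hk: "h = k * h'" using e1 e2 cosh_sq[of t] by algebra
  have "u l = k * u' l" for l using ul uj by (cases "l = j") auto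
  then have uk: "u = (\<lambda>l. k * u' l)" by (rule ext)
  have "ip d u u = k\<^sup>2 * ip d u' u'"
    unfolding uk ip_def by (simp add: sum_distrib_left power2_eq_square ac_simps)
  then have "k\<^sup>2 = 1" using unit_sphere_ip[OF u(1)] unit_sphere_ip[OF u(2)] by simp
  then have "\<bar>k\<bar> = 1" by (auto simp: power2_eq_1_iff)
  then show ?thesis using that uk hk by blast
qed

text \<open>The sign \<open>c\<close> may depend on \<open>t\<close>, since \<open>hnormal\<close>
  selects one of two normals by a rule that need not be continuous. Uniqueness is available at
  \<open>x\<close>, where genericity is assumed, but not directly at the boosted points; so the
  comparison is made after boosting back.\<close>

lemma height_boosts:
  assumes d: "2 \<le> d" and j: "j < d" and g: "generic d x" and x: "\<forall>i\<in>{1..d}. x i \<in> unit_sphere d" "x \<in>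
      space (Sph d {1..d})"
  obtains c where "\<bar>c\<bar> = 1" "hnormal d (boosts {1..d} j t x) =
      (\<lambda>l. c * hboost j t (height d x) (hnormal d x) l)"
    "height d (boosts {1..d} j t x) = c * hheight (height d x) (hnormal d x j) t"
proof -
  let ?x = "boosts {1..d} j t x" and ?u = "hnormal d x" and ?h = "height d x"
  let ?v = "hnormal d ?x" and ?k = "height d ?x"
  let ?U = "hboost j t ?h ?u" and ?H = "hheight ?h (?u j) t"
  have s: "spanning d x ?u ?h" by (rule spanning_hnormal[OF d])
  have x': "\<forall>i\<in>{1..d}. ?x i \<in> unit_sphere d"
    using x j by (auto simp: boosts_def intro: boost_unit_sphere)
  have s1: "spanning d ?x ?v ?k" by (rule spanning_hnormal[OF d])
  have s2: "spanning d ?x ?U ?H" by (rule spanning_boosts[OF j x(1) s])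
  \<comment> \<open>Every hyperplane through the boosted points returns to one through
    \<open>x\<close>. Applied to the selected normal and to the boosted normal, this gives two
    hyperplanes through \<open>x\<close> that must agree up to sign; \<open>hboost_injective\<close>
    then transfers the agreement to the boosted points.\<close>
  have inv: "spanning d x (hboost j (- t) k v) (hheight k (v j) (- t))" if "spanning d ?x v k" for v k
    using spanning_boosts[OF j x' that, of "- t"] unfolding boosts_inverse[OF x] .
  have x1: "?x 1 \<in> unit_sphere d" using x' d by auto
  have "(hboost j (- t) ?k ?v = hboost j (- t) ?H ?U \<and> hheight ?k (?v j) (- t) = hheight ?H (?U j) (-
      t)) \<or>
      (hboost j (- t) ?k ?v = (\<lambda>l. - hboost j (- t) ?H ?U l) \<and> hheight ?k (?v j) (- t) = -
          hheight ?H (?U j) (- t))"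
    by (rule generic_unique[OF d g inv[OF s2] inv[OF s1]])
  then obtain c where c: "\<bar>c\<bar> = 1" "hboost j (- t) ?k ?v = (\<lambda>l. c * hboost j (- t) ?H ?U l)"
      "hheight ?k (?v j) (- t) = c * hheight ?H (?U j) (- t)"
    by (elim disjE) (auto intro: that[of 1] that[of "-1"])
  have v: "?v \<in> unit_sphere d" "?U \<in> unit_sphere d" using s1 s2 by (auto simp: spanning_def)
  have k: "\<bar>?k\<bar> \<le> 1" "\<bar>?H\<bar> \<le> 1" using d
      by (intro spanning_height_le[OF s1 _ x1] spanning_height_le[OF s2 _ x1]; simp)+
  show ?thesis using hboost_injective[OF j v k c] that by metis
qed

lemma hscale_sq:
  assumes "\<bar>h\<bar> < 1"
  shows "(hscale h v t)\<^sup>2 = (h * cosh t + v * sinh t)\<^sup>2 + 1 - h\<^sup>2"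
  using one_minus_square_pos[OF assms] by (simp add: hscale_def add_diff_eq[symmetric])

text \<open>\<open>V\<close> is the \<open>j\<close>-th coordinate of the boosted normal. Together
  with the height it satisfies an autonomous system, so the derivative is available and bounded
  along the whole orbit.\<close>

lemma hboost_derivatives:
  assumes h: "\<bar>h\<bar> < 1" and v: "\<bar>v\<bar> \<le> 1"
  defines "H \<equiv> hheight h v" and "V \<equiv> \<lambda>t. (v * cosh t + h * sinh t) / hscale h v t"
  shows "(H has_real_derivative V t * (1 - (H t)\<^sup>2)) (at t)"
    and "(V has_real_derivative H t * (1 - (V t)\<^sup>2)) (at t)"
    and "\<bar>H t\<bar> < 1" "\<bar>V t\<bar> \<le> 1"
proof -
  define a where "a t = h * cosh t + v * sinh t" for t
  define q where "q t = v * cosh t + h * sinh t" for t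
  define n where "n = hscale h v"
  have n: "0 < n t" for t unfolding n_def using h v by (intro hscale_pos) auto
  have n2: "(n t)\<^sup>2 = (a t)\<^sup>2 + 1 - h\<^sup>2" for t unfolding n_def a_def by (rule hscale_sq[OF h])
  have q2: "(q t)\<^sup>2 = (a t)\<^sup>2 + v\<^sup>2 - h\<^sup>2" for t
    unfolding q_def a_def using cosh_sq[of t] by algebra
  have da: "(a has_real_derivative q t) (at t)" "(q has_real_derivative a t) (at t)" for t
    unfolding a_def q_def by (auto intro!: derivative_eq_intros)
  have dn: "(n has_real_derivative a t * q t / n t) (at t)" for t
  proof -
    have n': "n = (\<lambda>t. sqrt ((a t)\<^sup>2 + 1 - h\<^sup>2))" by (simp add: n_def hscale_def a_def fun_eq_iff)
    have "0 < (a t)\<^sup>2 + 1 - h\<^sup>2" using n2[of t] n[of t] by (metis zero_less_power)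
    then show ?thesis unfolding n'
      by (auto intro!: derivative_eq_intros da simp: field_simps)
  qed
  have gen: "(y * m - w * (a t * q t / m)) / (m * m) = y / m - w / m * (a t / m) * (q t / m)" if "m \<noteq> 0"
      for y w m :: real
    using that by (simp add: field_simps)
  have HV: "H = (\<lambda>t. a t / n t)" "V = (\<lambda>t. q t / n t)"
    by (auto simp: H_def V_def hheight_def a_def q_def n_def)
  have "(H has_real_derivative (q t * n t - a t * (a t * q t / n t)) / (n t * n t)) (at t)"
    unfolding HV using n[of t] by (intro DERIV_divide da dn) simp
  also have "(q t * n t - a t * (a t * q t / n t)) / (n t * n t) = q t / n t - a t / n t * (a t / n t) *
      (q t / n t)"
    using n[of t] by (intro gen) simp
  also have "\<dots> = V t * (1 - (H t)\<^sup>2)"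
    unfolding HV by (simp add: algebra_simps power2_eq_square)
  finally show "(H has_real_derivative V t * (1 - (H t)\<^sup>2)) (at t)" .
  have "(V has_real_derivative (a t * n t - q t * (a t * q t / n t)) / (n t * n t)) (at t)"
    unfolding HV using n[of t] by (intro DERIV_divide da dn) simp
  also have "(a t * n t - q t * (a t * q t / n t)) / (n t * n t) = a t / n t - q t / n t * (a t / n t) *
      (q t / n t)"
    using n[of t] by (intro gen) simp
  also have "\<dots> = H t * (1 - (V t)\<^sup>2)"
    unfolding HV by (simp add: algebra_simps power2_eq_square)
  finally show "(V has_real_derivative H t * (1 - (V t)\<^sup>2)) (at t)" .
  have "(a t)\<^sup>2 < (n t)\<^sup>2" using n2[of t] one_minus_square_pos[OF h] by simp
  then have "\<bar>a t\<bar> < n t" using n[of t] abs_le_square_iff[of "n t" "a t"] by simp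
  then show "\<bar>H t\<bar> < 1" using n[of t] by (simp add: HV)
  have "v\<^sup>2 \<le> 1" using v by (simp add: abs_square_le_1)
  then have "(q t)\<^sup>2 \<le> (n t)\<^sup>2" using n2[of t] q2[of t] by simp
  then have "\<bar>q t\<bar> \<le> n t" using n[of t] by (simp add: abs_le_square_iff[symmetric])
  then show "\<bar>V t\<bar> \<le> 1" using n[of t] by (simp add: HV)
qed


text \<open>For odd \<open>\<phi>\<close> the function \<open>\<phi>(h) u\<^sub>j\<close> does not depend on the choice of the sign of \<open>(u, h)\<close>.
  Summing Stein's identity for it over \<open>j\<close> eliminates \<open>u\<close>.\<close>

lemma height_stein:
  fixes \<phi> \<phi>' :: "real \<Rightarrow> real"
  assumes d: "4 \<le> d" and [measurable]: "\<phi> \<in> borel_measurable borel" "\<phi>' \<in> borel_measurable borel"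
    and odd: "\<And>h. \<phi> (- h) = - \<phi> h"
    and der: "\<And>h. \<bar>h\<bar> < 1 \<Longrightarrow> (\<phi> has_real_derivative \<phi>' h) (at h)"
    and bnd: "\<And>h. \<bar>h\<bar> \<le> 1 \<Longrightarrow> \<bar>\<phi> h\<bar> \<le> B" "\<And>h. \<bar>h\<bar> < 1 \<Longrightarrow> \<bar>\<phi>' h\<bar> \<le> B"
  shows "(\<integral>x. (1 - (height d x)\<^sup>2) * \<phi>' (height d x) \<partial>Sph d {1..d}) =
    (real d - 1)\<^sup>2 * (\<integral>x. height d x * \<phi> (height d x) \<partial>Sph d {1..d})"
proof -
  let ?S = "Sph d {1..d}" and ?h = "height d" and ?u = "hnormal d"
  interpret S: prob_space ?S by (rule prob_space_Sph)
  have d2: "2 \<le> d" using d by simp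
  have sph: "AE x in ?S. \<forall>i\<in>{1..d}. x i \<in> unit_sphere d" using d by (intro AE_Sph) auto
  have span: "spanning d x (?u x) (?h x)" for x by (rule spanning_hnormal[OF d2])
  have us: "?u x \<in> unit_sphere d" for x using span[of x] by (simp add: spanning_def)
  have uj: "\<bar>?u x j\<bar> \<le> 1" for x j by (rule unit_sphere_component[OF us])
  have h1: "\<bar>?h x\<bar> \<le> 1" if "\<forall>i\<in>{1..d}. x i \<in> unit_sphere d" for x
    using that d by (intro spanning_height_le[OF span]) auto
  have hlt: "AE x in ?S. \<bar>?h x\<bar> < 1"
    using AE_generic[OF d] sph
  proof eventually_elim
    case (elim x)
    then show ?case using d by (intro generic_height[OF d2 elim(1) span]) auto
  qed
  have B: "0 \<le> B" using bnd(1)[of 0] by simp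
  \<comment> \<open>This absorbs the unknown sign of \<open>height_boosts\<close>: it multiplies
    both the height and the normal, and cancels for odd \<open>\<phi>\<close>.\<close>
  have odd1: "\<phi> (c * h) * (c * v) = \<phi> h * v" if "\<bar>c\<bar> = 1" for c h v
    using that odd[of h] by (auto simp: abs_if split: if_splits)
  have [measurable]: "(\<lambda>x. ?u x j) \<in> borel_measurable ?S" for j
    by (rule measurable_compose[OF hnormal_measurable coord_borel])
  have [measurable]: "(\<lambda>x. x i j) \<in> borel_measurable ?S" if "i \<in> {1..d}" for i j
    by (rule measurable_compose[OF Sph_component[OF that] coord_borel])
  have sq: "\<bar>1 - y\<^sup>2\<bar> \<le> 1" if "\<bar>y\<bar> \<le> 1" for y :: real
  proof -
    have "y\<^sup>2 \<le> 1" using that by (simp add: abs_square_le_1)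
    then show ?thesis using zero_le_power2[of y] by linarith
  qed
  have coord: "(\<integral>x. (\<phi>' (?h x) * (1 - (?h x)\<^sup>2) * (?u x j * ?u x j) + \<phi> (?h x) *
      (?h x * (1 - (?u x j)\<^sup>2))) -
      real (d - 1) * (\<phi> (?h x) * ?u x j) * (\<Sum>i\<in>{1..d}. x i j) \<partial>?S) = 0"
    if j: "j < d" for j
  proof -
    let ?\<Phi> = "\<lambda>x. \<phi> (?h x) * ?u x j"
    let ?H = "\<lambda>x. hheight (?h x) (?u x j)"
    let ?V = "\<lambda>x t. (?u x j * cosh t + ?h x * sinh t) / hscale (?h x) (?u x j) t"
    let ?F' = "\<lambda>x t. \<phi>' (?H x t) * (?V x t * (1 - (?H x t)\<^sup>2)) * ?V x t + \<phi> (?H x t) *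
        (?H x t * (1 - (?V x t)\<^sup>2))"
    have flow: "?\<Phi> (boosts {1..d} j t x) = \<phi> (?H x t) * ?V x t"
      if x: "generic d x" "\<forall>i\<in>{1..d}. x i \<in> unit_sphere d" "x \<in> space ?S" for x t
    proof -
      obtain c where c: "\<bar>c\<bar> = 1" "?u (boosts {1..d} j t x) = (\<lambda>l. c * hboost j t (?h x) (?u x) l)"
          "?h (boosts {1..d} j t x) = c * ?H x t"
        by (rule height_boosts[OF d2 j x])
      show ?thesis unfolding c(2,3) odd1[OF c(1)] by (simp add: hboost_def)
    qed
    have derF: "((\<lambda>t. \<phi> (?H x t) * ?V x t) has_real_derivative ?F' x t) (at t)" if "\<bar>?h x\<bar> < 1" for x t
    proof -
      note D = hboost_derivatives[OF that uj, of x j t]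
      have "((\<lambda>t. \<phi> (?H x t)) has_real_derivative \<phi>' (?H x t) * (?V x t * (1 - (?H x t)\<^sup>2))) (at t)"
        by (rule DERIV_chain2[OF der[OF D(3)] D(1)])
      from DERIV_mult[OF this D(2)] show ?thesis by (simp add: mult.commute add.commute)
    qed
    have bndF: "\<bar>?F' x t\<bar> \<le> 2 * B" if "\<bar>?h x\<bar> < 1" for x t
    proof -
      note D = hboost_derivatives[OF that uj, of x j t]
      have "\<bar>\<phi>' (?H x t)\<bar> * (\<bar>?V x t\<bar> * \<bar>1 - (?H x t)\<^sup>2\<bar>) * \<bar>?V x t\<bar> \<le> B * (1 * 1) * 1"
        using D bnd B sq by (intro mult_mono) auto
      moreover have "\<bar>\<phi> (?H x t)\<bar> * (\<bar>?H x t\<bar> * \<bar>1 - (?V x t)\<^sup>2\<bar>) \<le> B * (1 * 1)"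
        using D bnd B sq by (intro mult_mono) auto
      ultimately have "\<bar>\<phi>' (?H x t) * (?V x t * (1 - (?H x t)\<^sup>2)) * ?V x t\<bar> \<le> B"
          "\<bar>\<phi> (?H x t) * (?H x t * (1 - (?V x t)\<^sup>2))\<bar> \<le> B"
        by (simp_all only: abs_mult mult_1_right)
      then show ?thesis by (rule order_trans[OF abs_triangle_ineq order_trans[OF add_mono]]) simp
    qed
    have F0: "?F' x 0 = \<phi>' (?h x) * (1 - (?h x)\<^sup>2) * (?u x j * ?u x j) + \<phi> (?h x) *
        (?h x * (1 - (?u x j)\<^sup>2))" for x
      by (simp add: hheight_def hscale_def mult_ac)
    show ?thesis
    proof (rule Sph_stein[OF d2 j, where B = B and C = "2 * B"])
      show "\<bar>?\<Phi> x\<bar> \<le> B" if "\<forall>i\<in>{1..d}. x i \<in> unit_sphere d" for x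
      proof -
        have "\<bar>\<phi> (?h x)\<bar> * \<bar>?u x j\<bar> \<le> B * 1" using bnd(1)[OF h1[OF that]] uj B by (intro mult_mono) auto
        then show ?thesis by (simp add: abs_mult)
      qed
      show "AE x in ?S. \<forall>t\<in>{- 1..1}. \<bar>?\<Phi> (boosts {1..d} j t x) - ?\<Phi> x\<bar> \<le> 2 * B * \<bar>t\<bar>"
        using AE_generic[OF d] sph hlt AE_space
      proof eventually_elim
        case (elim x)
        show ?case
        proof
          fix t :: real assume "t \<in> {-1..1}"
          then have t: "\<bar>t\<bar> \<le> 1" by auto
          have "\<bar>\<phi> (?H x t) * ?V x t - \<phi> (?H x 0) * ?V x 0\<bar> \<le> 2 * B * \<bar>t\<bar>"
            by (rule lipschitz_from_derivative[where f = "\<lambda>t. \<phi> (?H x t) * ?V x t" and f' = "?F' x"])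
               (rule derF[OF elim(3)] bndF[OF elim(3)] t)+
          then show "\<bar>?\<Phi> (boosts {1..d} j t x) - ?\<Phi> x\<bar> \<le> 2 * B * \<bar>t\<bar>"
            unfolding flow[OF elim(1,2,4), symmetric] boosts_0[OF elim(4)] .
        qed
      qed
      show "AE x in ?S. ((\<lambda>t. ?\<Phi> (boosts {1..d} j t x)) has_real_derivative
        (\<phi>' (?h x) * (1 - (?h x)\<^sup>2) * (?u x j * ?u x j) + \<phi> (?h x) * (?h x * (1 - (?u x j)\<^sup>2)))) (at 0)"
        using AE_generic[OF d] sph hlt AE_space
      proof eventually_elim
        case (elim x)
        show ?case unfolding flow[OF elim(1,2,4)] F0[symmetric] by (rule derF[OF elim(3)])
      qed
    qed measurable
  qed
  let ?G = "\<lambda>j x. (\<phi>' (?h x) * (1 - (?h x)\<^sup>2) * (?u x j * ?u x j) + \<phi> (?h x) *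
      (?h x * (1 - (?u x j)\<^sup>2))) -
      real (d - 1) * (\<phi> (?h x) * ?u x j) * (\<Sum>i\<in>{1..d}. x i j)"
  have b1: "\<bar>(1 - (?h x)\<^sup>2) * \<phi>' (?h x)\<bar> \<le> B" "\<bar>?h x * \<phi> (?h x)\<bar> \<le> B" if "\<bar>?h x\<bar> < 1" for x
  proof -
    have "\<bar>1 - (?h x)\<^sup>2\<bar> \<le> 1" using that by (intro sq) simp
    then have "\<bar>1 - (?h x)\<^sup>2\<bar> * \<bar>\<phi>' (?h x)\<bar> \<le> 1 * B" using bnd(2)[OF that] by (intro mult_mono) auto
    then show "\<bar>(1 - (?h x)\<^sup>2) * \<phi>' (?h x)\<bar> \<le> B" by (simp add: abs_mult)
    have "\<bar>?h x\<bar> * \<bar>\<phi> (?h x)\<bar> \<le> 1 * B" using that bnd(1)[of "?h x"] by (intro mult_mono) auto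
    then show "\<bar>?h x * \<phi> (?h x)\<bar> \<le> B" by (simp add: abs_mult)
  qed
  have i1: "integrable ?S (\<lambda>x. (1 - (?h x)\<^sup>2) * \<phi>' (?h x))"
  proof (rule S.integrable_const_bound[of _ B])
    show "AE x in ?S. norm ((1 - (?h x)\<^sup>2) * \<phi>' (?h x)) \<le> B"
      using hlt by eventually_elim (unfold real_norm_def, rule b1)
  qed measurable
  have i2: "integrable ?S (\<lambda>x. ?h x * \<phi> (?h x))"
  proof (rule S.integrable_const_bound[of _ B])
    show "AE x in ?S. norm (?h x * \<phi> (?h x)) \<le> B"
      using hlt by eventually_elim (unfold real_norm_def, rule b1)
  qed measurable
  have intG: "integrable ?S (?G j)" for j
  proof (rule S.integrable_const_bound[of _ "2 * B + real (d - 1) * B * real d"])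
    show "AE x in ?S. norm (?G j x) \<le> 2 * B + real (d - 1) * B * real d"
      using sph hlt
    proof eventually_elim
      case (elim x)
      have u2: "(?u x j)\<^sup>2 \<le> 1" using uj by (simp add: abs_square_le_1)
      have "\<bar>\<phi>' (?h x) * (1 - (?h x)\<^sup>2)\<bar> * \<bar>?u x j * ?u x j\<bar> \<le> B * 1"
        using b1(1)[OF elim(2)] u2 B by (intro mult_mono) (auto simp: mult.commute power2_eq_square)
      moreover have "\<bar>\<phi> (?h x) * ?h x\<bar> * \<bar>1 - (?u x j)\<^sup>2\<bar> \<le> B * 1"
        using b1(2)[OF elim(2)] u2 B by (intro mult_mono) (auto simp: mult.commute)
      moreover have "real (d - 1) * (\<bar>\<phi> (?h x)\<bar> * \<bar>?u x j\<bar>) * \<bar>\<Sum>i\<in>{1..d}. x i j\<bar> \<le> real (d - 1) *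
          (B * 1) * real d"
      proof -
        have "\<bar>\<Sum>i\<in>{1..d}. x i j\<bar> \<le> (\<Sum>i\<in>{1..d}. 1)"
          by (rule order_trans[OF sum_abs sum_mono]) (use elim(1) unit_sphere_component in blast)
        then show ?thesis using bnd(1)[of "?h x"] elim(2) uj B by (intro mult_mono mult_left_mono) auto
      qed
      ultimately have "\<bar>\<phi>' (?h x) * (1 - (?h x)\<^sup>2) * (?u x j * ?u x j)\<bar> \<le> B"
        "\<bar>\<phi> (?h x) * (?h x * (1 - (?u x j)\<^sup>2))\<bar> \<le> B"
        "\<bar>real (d - 1) * (\<phi> (?h x) * ?u x j) * (\<Sum>i\<in>{1..d}. x i j)\<bar> \<le> real (d - 1) * B * real d"
        by (simp_all only: abs_mult abs_of_nat mult.assoc mult_1_right)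
      then show ?case unfolding real_norm_def by linarith
    qed
  qed measurable
  have "0 = (\<Sum>j<d. \<integral>x. ?G j x \<partial>?S)" using coord by simp
  also have "\<dots> = (\<integral>x. (\<Sum>j<d. ?G j x) \<partial>?S)"
    by (rule Bochner_Integration.integral_sum[symmetric]) (rule intG)
  also have "\<dots> = (\<integral>x. (1 - (?h x)\<^sup>2) * \<phi>' (?h x) - (real d - 1)\<^sup>2 * (?h x * \<phi> (?h x)) \<partial>?S)"
  proof (rule Bochner_Integration.integral_cong[OF refl])
    fix x
    \<comment> \<open>The origin of the factor \<open>(real d - 1)^2\<close>: the normal has length
      1, and every one of the \<open>d\<close> points satisfies
      \<open>ip d (x i) (?u x) = ?h x\<close>. The coefficient of \<open>h * \<phi> h\<close>
      becomes \<open>(d - 1) - (d - 1) * d\<close>.\<close>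
    have s1: "(\<Sum>j<d. ?u x j * ?u x j) = 1" using unit_sphere_ip[OF us[of x]] by (simp add: ip_def)
    have "(\<Sum>j<d. ?u x j * (\<Sum>i\<in>{1..d}. x i j)) = (\<Sum>i\<in>{1..d}. ip d (x i) (?u x))"
      unfolding sum_distrib_left ip_def by (subst sum.swap) (simp add: mult.commute)
    also have "\<dots> = real d * ?h x" using span[of x] by (simp add: spanning_def)
    finally have s2: "(\<Sum>j<d. ?u x j * (\<Sum>i\<in>{1..d}. x i j)) = real d * ?h x" .
    have "(\<Sum>j<d. ?G j x) = \<phi>' (?h x) * (1 - (?h x)\<^sup>2) * (\<Sum>j<d. ?u x j * ?u x j) +
        \<phi> (?h x) * (?h x * (real d - (\<Sum>j<d. ?u x j * ?u x j))) -
        real (d - 1) * \<phi> (?h x) * (\<Sum>j<d. ?u x j * (\<Sum>i\<in>{1..d}. x i j))"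
      using d by (simp add: sum_subtractf sum.distrib sum_distrib_left[symmetric] power2_eq_square
          mult.assoc of_nat_diff)
    also have "\<dots> = (1 - (?h x)\<^sup>2) * \<phi>' (?h x) - (real d - 1)\<^sup>2 * (?h x * \<phi> (?h x))"
      unfolding s1 s2 using d by (simp add: of_nat_diff power2_eq_square algebra_simps)
    finally show "(\<Sum>j<d. ?G j x) = (1 - (?h x)\<^sup>2) * \<phi>' (?h x) - (real d - 1)\<^sup>2 * (?h x * \<phi> (?h x))" .
  qed
  also have "\<dots> = (\<integral>x. (1 - (?h x)\<^sup>2) * \<phi>' (?h x) \<partial>?S) - (real d - 1)\<^sup>2 * (\<integral>x. ?h x * \<phi> (?h x) \<partial>?S)"
    by (simp only: Bochner_Integration.integral_diff[OF i1 integrable_mult_right[OF i2]]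
        integral_mult_right_zero)
  finally show ?thesis by simp
qed

section \<open>Facets and the law of the typical height\<close>

lemma ip_add_left: "ip d (x + y) u = ip d x u + ip d y u"
  by (simp add: ip_def distrib_right sum.distrib)

lemma ip_scaleR_left: "ip d (a *\<^sub>R x) u = a * ip d x u"
  by (simp add: ip_def scaleR_fun_def sum_distrib_left mult.assoc)

lemma ip_sum_scaleR_left: "ip d (\<Sum>v\<in>S. w v *\<^sub>R v) u = (\<Sum>v\<in>S. w v * ip d v u)"
proof -
  have "ip d (\<Sum>v\<in>S. w v *\<^sub>R v) u = (\<Sum>v\<in>S. ip d (w v *\<^sub>R v) u)"
    unfolding ip_def sum_fun_apply sum_distrib_right by (rule sum.swap)
  then show ?thesis by (simp only: ip_scaleR_left)
qed

lemma Rd_combination: "x \<in> Rd d \<Longrightarrow> y \<in> Rd d \<Longrightarrow> a *\<^sub>R x + b *\<^sub>R y \<in> Rd d"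
  by (simp add: Rd_def scaleR_fun_def)

lemma convex_halfspace: "convex {x \<in> Rd d. ip d x u \<le> h}"
proof (rule convexI)
  fix x y :: "nat \<Rightarrow> real" and a b :: real
  assume xy: "x \<in> {x \<in> Rd d. ip d x u \<le> h}" "y \<in> {x \<in> Rd d. ip d x u \<le> h}"
      and ab: "0 \<le> a" "0 \<le> b" "a + b = 1"
  have "a * ip d x u + b * ip d y u \<le> a * h + b * h"
    using xy ab by (intro add_mono mult_left_mono) auto
  also have "\<dots> = h" using ab by (simp add: distrib_right[symmetric])
  finally show "a *\<^sub>R x + b *\<^sub>R y \<in> {x \<in> Rd d. ip d x u \<le> h}"
    using xy by (simp only: mem_Collect_eq ip_add_left ip_scaleR_left) (auto intro: Rd_combination)
qed

lemma convex_hyperplane: "convex (hyperplane d u h)"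
proof (rule convexI)
  fix x y :: "nat \<Rightarrow> real" and a b :: real
  assume xy: "x \<in> hyperplane d u h" "y \<in> hyperplane d u h" and ab: "0 \<le> a" "0 \<le> b" "a + b = 1"
  then have "a * ip d x u + b * ip d y u = h" by (simp add: hyperplane_def distrib_right[symmetric])
  then show "a *\<^sub>R x + b *\<^sub>R y \<in> hyperplane d u h"
    using xy unfolding hyperplane_def
    by (simp only: mem_Collect_eq ip_add_left ip_scaleR_left) (auto intro: Rd_combination)
qed

text \<open>For a convex combination on the hyperplane the weighted gaps
  \<open>w v * (h - ip d v u)\<close> are nonnegative with sum 0. Points of \<open>S - T\<close>
  have a positive gap, so they carry no weight.\<close>

lemma hull_inter_hyperplane:
  assumes fin: "finite S" and T: "T \<subseteq> S" and S: "S \<subseteq> Rd d"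
    and eq: "\<And>v. v \<in> T \<Longrightarrow> ip d v u = h" and lt: "\<And>v. v \<in> S - T \<Longrightarrow> ip d v u < h"
  shows "convex hull S \<subseteq> {x \<in> Rd d. ip d x u \<le> h}" and "convex hull S \<inter> hyperplane d u h =
      convex hull T"
proof -
  have le: "ip d v u \<le> h" if "v \<in> S" for v using eq[of v] lt[of v] that by (cases "v \<in> T") auto
  show "convex hull S \<subseteq> {x \<in> Rd d. ip d x u \<le> h}"
    using S le by (intro hull_minimal convex_halfspace) auto
  show "convex hull S \<inter> hyperplane d u h = convex hull T"
  proof (intro equalityI subsetI)
    fix x assume x: "x \<in> convex hull S \<inter> hyperplane d u h"
    then obtain w where w: "\<forall>v\<in>S. 0 \<le> w v" "sum w S = 1" "(\<Sum>v\<in>S. w v *\<^sub>R v) = x"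
      by (auto simp: convex_hull_finite[OF fin])
    have "ip d x u = h" using x by (simp add: hyperplane_def)
    then have "(\<Sum>v\<in>S. w v * ip d v u) = h" using w(3) ip_sum_scaleR_left[of d w S u] by metis
    then have "(\<Sum>v\<in>S. w v * (h - ip d v u)) = 0"
      using w(2) by (simp add: right_diff_distrib sum_subtractf sum_distrib_right[symmetric])
    moreover have "0 \<le> w v * (h - ip d v u)" if "v \<in> S" for v
      using w(1) le[OF that] that by simp
    ultimately have "\<forall>v\<in>S. w v * (h - ip d v u) = 0" using fin by (subst (asm) sum_nonneg_eq_0_iff) auto
    then have z: "w v = 0" if "v \<in> S - T" for v using lt[OF that] that by auto
    have "sum w T = 1" using w(2) sum.mono_neutral_right[OF fin T, of w] z by simp
    moreover have "(\<Sum>v\<in>S. w v *\<^sub>R v) = (\<Sum>v\<in>T. w v *\<^sub>R v)"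
      by (rule sum.mono_neutral_right[OF fin T]) (simp add: z)
    ultimately show "x \<in> convex hull T"
      using w T finite_subset[OF T fin] by (auto simp: convex_hull_finite intro!: exI[of _ w])
  next
    fix x assume x: "x \<in> convex hull T"
    have "convex hull T \<subseteq> hyperplane d u h"
      using T S eq by (intro hull_minimal convex_hyperplane) (auto simp: hyperplane_def)
    moreover have "convex hull T \<subseteq> convex hull S" by (rule hull_mono[OF T])
    ultimately show "x \<in> convex hull S \<inter> hyperplane d u h" using x by auto
  qed
qed

lemma face_of_inter_hyperplane:
  assumes P: "convex P" "P \<subseteq> {x \<in> Rd d. ip d x u \<le> h}" and F: "P \<inter> hyperplane d u h = F"
  shows "F face_of P"
  unfolding face_of_def
proof (intro conjI ballI impI)
  show "F \<subseteq> P" using F by auto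
  show "convex F" unfolding F[symmetric] by (intro convex_Int P convex_hyperplane)
  fix a b x assume ab: "a \<in> P" "b \<in> P" and x: "x \<in> F" "x \<in> open_segment a b"
  obtain t where t: "0 < t" "t < 1" "x = (1 - t) *\<^sub>R a + t *\<^sub>R b" using x(2) by (auto simp: in_segment)
  have le: "ip d a u \<le> h" "ip d b u \<le> h" using ab P by auto
  have "ip d x u = h" using x(1) F by (auto simp: hyperplane_def)
  then have e: "(1 - t) * ip d a u + t * ip d b u = h" unfolding t(3) ip_add_left ip_scaleR_left .
  have "(1 - t) * (h - ip d a u) + t * (h - ip d b u) = 0" using e by (simp add: algebra_simps)
  moreover have "0 \<le> (1 - t) * (h - ip d a u)" "0 \<le> t * (h - ip d b u)" using t le by auto
  ultimately have "(1 - t) * (h - ip d a u) = 0" "t * (h - ip d b u) = 0" by linarith+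
  then have "ip d a u = h" "ip d b u = h" using t by auto
  then show "a \<in> F" "b \<in> F" using ab P(2) unfolding F[symmetric] hyperplane_def by auto
qed

text \<open>Strictness in \<open>lt\<close> makes the face equal to the simplex; with further points
  on the hyperplane the intersection could be larger.\<close>

lemma spanning_facet:
  assumes d: "2 \<le> d" "d \<le> n" and y: "\<forall>i\<in>{1..n}. y i \<in> unit_sphere d" and g: "generic d y"
    and s: "spanning d y u h" and lt: "\<forall>i\<in>{d+1..n}. ip d (y i) u < h"
  shows "is_facet d (convex hull (y ` {1..n})) (convex hull (y ` {1..d}))"
    and "has_height d (convex hull (y ` {1..n})) (convex hull (y ` {1..d})) h"
proof -
  let ?P = "convex hull (y ` {1..n})" and ?F = "convex hull (y ` {1..d})"
  have u: "u \<in> unit_sphere d" and eq: "\<And>i. i \<in> {1..d} \<Longrightarrow> ip d (y i) u = h" using s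
      by (auto simp: spanning_def)
  have H: "?P \<subseteq> {x \<in> Rd d. ip d x u \<le> h}" "?P \<inter> hyperplane d u h = ?F"
  proof -
    have lt': "ip d v u < h" if "v \<in> y ` {1..n} - y ` {1..d}" for v
    proof -
      have "v \<in> y ` {1..n}" using that by (rule DiffD1)
      then obtain i where i: "v = y i" "i \<in> {1..n}" by (rule imageE)
      moreover from this have "i \<notin> {1..d}" using that by blast
      ultimately show ?thesis using lt by auto
    qed
    have S: "y ` {1..n} \<subseteq> Rd d" using y by (auto simp: unit_sphere_def)
    have T: "y ` {1..d} \<subseteq> y ` {1..n}" using d by auto
    have eq': "ip d v u = h" if "v \<in> y ` {1..d}" for v using that eq by auto
    show "?P \<subseteq> {x \<in> Rd d. ip d x u \<le> h}" "?P \<inter> hyperplane d u h = ?F"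
      by (rule hull_inter_hyperplane[OF _ T S eq' lt']; simp)+
  qed
  show "is_facet d ?P ?F" unfolding is_facet_def
  proof
    show "?F face_of ?P" by (rule face_of_inter_hyperplane[OF convex_convex_hull H])
    show "has_aff_dim ?F (d - 1)" unfolding has_aff_dim_def
      using generic_affine_independent[OF g d(1)] d
      by (intro exI[of _ "y ` {1..d}"]) (simp add: affine_hull_convex_hull card_image)
  qed
  have "\<bar>h\<bar> \<le> 1" using d y by (intro spanning_height_le[OF s]) auto
  then show "has_height d ?P ?F h" unfolding has_height_def using H u by (auto simp: abs_le_iff)
qed

text \<open>The converse of \<open>spanning_facet\<close>, with weak inequalities only. The gap
  between the two is closed in probability, since a cap and its interior have the same
  measure.\<close>

lemma height_spanning:
  assumes d: "d \<le> n" and h: "has_height d (convex hull (y ` {1..n})) (convex hull (y ` {1..d})) h"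
  obtains u where "spanning d y u h" "\<forall>i\<in>{1..n}. ip d (y i) u \<le> h"
proof -
  let ?P = "convex hull (y ` {1..n})" and ?F = "convex hull (y ` {1..d})"
  obtain u where u: "u \<in> unit_sphere d" "?P \<inter> hyperplane d u h = ?F" "?P \<subseteq> {x \<in> Rd d. ip d x u \<le> h}"
    using h by (auto simp: has_height_def)
  have "y i \<in> ?F" if "i \<in> {1..d}" for i using that by (intro hull_inc) auto
  then have "spanning d y u h" using u(1,2) by (auto simp: spanning_def hyperplane_def)
  moreover have "y i \<in> ?P" if "i \<in> {1..n}" for i using that by (intro hull_inc) auto
  then have "\<forall>i\<in>{1..n}. ip d (y i) u \<le> h" using u(3) by blast
  ultimately show ?thesis by (rule that)
qed

section \<open>Probability that the remaining points lie on one side\<close>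

lemma hyperplane_cong:
  assumes "2 \<le> d" "\<And>i. i \<in> {1..d} \<Longrightarrow> x i = y i"
  shows "generic d x = generic d y" "hnormal d x = hnormal d y" "height d x = height d y"
proof -
  have gs: "gram_schmidt d (edges x) k = gram_schmidt d (edges y) k" if "k < d - 1" for k
    using that assms by (intro gram_schmidt_cong) (simp add: edges_def)
  show "generic d x = generic d y" unfolding generic_def using gs by simp
  have "perp d (edges x) (d - 1) j = perp d (edges y) (d - 1) j" for j
    unfolding perp_def residual_def using gs by simp
  then show hn: "hnormal d x = hnormal d y" by (simp only: hnormal_def)
  show "height d x = height d y" unfolding height_def hn using assms by simp
qed

lemma emeasure_halfspace_lt:
  assumes d: "4 \<le> d" and u: "u \<in> unit_sphere d" and h: "\<bar>h\<bar> \<le> 1"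
  shows "emeasure (uniform_sphere d) {x. ip d x u < h} = ennreal (cap d h)"
proof -
  have "emeasure (uniform_sphere d) {x. ip d x u < h} = emeasure (uniform_sphere d) {x. ip d x u \<le> h}"
    using AE_not_on_hyperplane[OF d u, of h] by (intro emeasure_eq_AE) (auto elim!: eventually_mono)
  then show ?thesis by (simp add: emeasure_halfspace[OF assms])
qed

lemma emeasure_all_halfspace:
  fixes R :: "real \<Rightarrow> real \<Rightarrow> bool"
  assumes d: "4 \<le> d" and u: "u \<in> unit_sphere d" and h: "\<bar>h\<bar> \<le> 1" and J: "finite J"
      and R: "R = (\<le>) \<or> R = (<)"
  shows "emeasure (Sph d J) {y \<in> space (Sph d J). \<forall>i\<in>J. R (ip d (y i) u) h} =
      ennreal (cap d h ^ card J)"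
proof -
  interpret product_prob_space "\<lambda>_::nat. uniform_sphere d" by (rule product_prob_space_Sph)
  have "{y \<in> space (Sph d J). \<forall>i\<in>J. R (ip d (y i) u) h} = Pi\<^sub>E J (\<lambda>_. {x. R (ip d x u) h})"
    by (auto simp: space_PiM PiE_iff extensional_def)
  moreover have "{x. R (ip d x u) h} \<in> sets borel" using R by (elim disjE) simp_all
  ultimately have "emeasure (Sph d J) {y \<in> space (Sph d J). \<forall>i\<in>J. R (ip d (y i) u) h} =
      (\<Prod>i\<in>J. emeasure (uniform_sphere d) {x. R (ip d x u) h})"
    using J by (simp add: emeasure_PiM)
  also have "\<dots> = (\<Prod>i\<in>J. ennreal (cap d h))"
    using R emeasure_halfspace[OF d u h] emeasure_halfspace_lt[OF d u h] by auto
  finally show ?thesis using cap_nonneg[OF d, of h] by (simp add: ennreal_power)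
qed

lemma hyperplane_measurable:
  assumes "{1..d} \<subseteq> K" "2 \<le> d"
  shows "hnormal d \<in> Sph d K \<rightarrow>\<^sub>M borel" "height d \<in> Sph d K \<rightarrow>\<^sub>M borel"
      "Measurable.pred (Sph d K) (generic d)"
proof -
  have r: "(\<lambda>x. restrict x {1..d}) \<in> Sph d K \<rightarrow>\<^sub>M Sph d {1..d}"
    using assms(1) by (rule measurable_restrict_subset)
  have c: "generic d x = generic d (restrict x {1..d})" "hnormal d x = hnormal d (restrict x {1..d})"
    "height d x = height d (restrict x {1..d})" for x
    by (rule hyperplane_cong[OF assms(2)]; simp)+
  show "hnormal d \<in> Sph d K \<rightarrow>\<^sub>M borel"
    using measurable_compose[OF r hnormal_measurable] by (simp only: c(2)[symmetric])
  show "height d \<in> Sph d K \<rightarrow>\<^sub>M borel"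
    using measurable_compose[OF r height_measurable] by (simp only: c(3)[symmetric])
  show "Measurable.pred (Sph d K) (generic d)"
    using measurable_compose[OF r generic_measurable] by (simp only: c(1)[symmetric])
qed

text \<open>The factor \<open>c\<close>, always 1 or -1, selects one of the two orientations of the
  hyperplane. The relation \<open>R\<close> is \<open><\<close> when the facet event is bounded from
  below and \<open>\<le>\<close> when it is bounded from above.\<close>

definition one_sided :: "nat \<Rightarrow> nat \<Rightarrow> (real \<Rightarrow> real \<Rightarrow> bool) \<Rightarrow> real \<Rightarrow> real set \<Rightarrow> (nat \<Rightarrow> nat \<Rightarrow> real) \<Rightarrow> bool"
  where
  "one_sided n d R c B z \<longleftrightarrow> c * height d z \<in> B \<and> (\<forall>i\<in>{d+1..n}. R (c * ip d (z i) (hnormal d z)) (c *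
      height d z))"

lemma pred_order_relation:
  fixes f g :: "'a \<Rightarrow> real"
  assumes R: "R = (\<le>) \<or> R = (<)" and [measurable]: "f \<in> borel_measurable M" "g \<in> borel_measurable M"
  shows "Measurable.pred M (\<lambda>x. R (f x) (g x))"
proof -
  have "Measurable.pred M (\<lambda>x. f x \<le> g x)" "Measurable.pred M (\<lambda>x. f x < g x)" by measurable
  then show ?thesis using R by auto
qed

lemma one_sided_measurable:
  assumes d: "2 \<le> d" "d \<le> n" and R: "R = (\<le>) \<or> R = (<)" and [measurable]: "B \<in> sets borel"
  shows "Measurable.pred (Sph d {1..n}) (one_sided n d R c B)"
proof -
  have h [measurable]: "height d \<in> Sph d {1..n} \<rightarrow>\<^sub>M borel" and u: "hnormal d \<in> Sph d {1..n} \<rightarrow>\<^sub>M borel"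
    using d by (intro hyperplane_measurable; auto)+
  have i: "Measurable.pred (Sph d {1..n}) (\<lambda>z. R (c * ip d (z i) (hnormal d z)) (c * height d z))"
      if "i \<in> {d+1..n}" for i
    using that by (intro pred_order_relation[OF R] borel_measurable_times borel_measurable_const
        ip_measurable2 u h Sph_component) auto
  have "Measurable.pred (Sph d {1..n}) (\<lambda>z. c * height d z \<in> B)" by measurable
  then show ?thesis unfolding one_sided_def[abs_def]
    by (intro pred_intros_logic pred_intros_finite i) auto
qed

text \<open>Conditionally on the first \<open>d\<close> points the hyperplane is fixed. The other
  \<open>n - d\<close> points are independent of it, and each lies in the half-space with
  probability \<open>cap d (c * height d x)\<close>.\<close>

lemma emeasure_one_sided:
  assumes d: "4 \<le> d" "d \<le> n" and R: "R = (\<le>) \<or> R = (<)" and B [measurable]: "B \<in> sets borel"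
      and c: "\<bar>c\<bar> = 1"
  shows "emeasure (Sph d {1..n}) {z \<in> space (Sph d {1..n}). one_sided n d R c B z} =
    (\<integral>\<^sup>+x. ennreal (indicator B (c * height d x) * cap d (c * height d x) ^ (n - d)) \<partial>Sph d {1..d})"
proof -
  interpret product_prob_space "\<lambda>_::nat. uniform_sphere d" by (rule product_prob_space_Sph)
  let ?E = "{z \<in> space (Sph d {1..n}). one_sided n d R c B z}"
  have d2: "2 \<le> d" using d by simp
  define J where "J = {d+1..n}"
  have un: "{1..n} = {1..d} \<union> J" "{1..d} \<inter> J = {}" "finite J" "card J = n - d" using d
      by (auto simp: J_def)
  have E: "?E \<in> sets (Sph d {1..n})"
    using one_sided_measurable[OF d2 d(2) R B, of c] unfolding pred_def .
  have "emeasure (Sph d {1..n}) ?E = (\<integral>\<^sup>+z. indicator ?E z \<partial>Sph d {1..n})" using E by simp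
  also have "\<dots> = (\<integral>\<^sup>+x. (\<integral>\<^sup>+y. indicator ?E (merge {1..d} J (x, y)) \<partial>Sph d J) \<partial>Sph d {1..d})"
    using E un unfolding un(1) by (intro product_nn_integral_fold) auto
  also have "\<dots> = (\<integral>\<^sup>+x. ennreal (indicator B (c * height d x) * cap d (c * height d x) ^ (n -
      d)) \<partial>Sph d {1..d})"
  proof (rule nn_integral_cong_AE)
    have "AE x in Sph d {1..d}. \<forall>i\<in>{1..d}. x i \<in> unit_sphere d" using d by (intro AE_Sph) auto
    then show "AE x in Sph d {1..d}. (\<integral>\<^sup>+y. indicator ?E (merge {1..d} J (x, y)) \<partial>Sph d J) =
       ennreal (indicator B (c * height d x) * cap d (c * height d x) ^ (n - d))"
      using AE_space
    proof eventually_elim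
      case (elim x)
      let ?h = "height d x" and ?u = "hnormal d x"
      have s: "spanning d x ?u ?h" by (rule spanning_hnormal[OF d2])
      have h: "\<bar>c * ?h\<bar> \<le> 1" using spanning_height_le[OF s] elim d c by (simp add: abs_mult)
      have cu: "(\<lambda>l. c * ?u l) \<in> unit_sphere d"
      proof -
        have u: "?u \<in> unit_sphere d" using s by (simp add: spanning_def)
        have "ip d (\<lambda>l. c * ?u l) (\<lambda>l. c * ?u l) = (c * c) * ip d ?u ?u"
          unfolding ip_def sum_distrib_left by (intro sum.cong) auto
        also have "\<dots> = 1" using c unit_sphere_ip[OF u] by (metis abs_mult_self_eq mult_1)
        finally show ?thesis using u by (simp add: unit_sphere_def nrm_def Rd_def)
      qed
      have ci: "ip d v (\<lambda>l. c * ?u l) = c * ip d v ?u" for v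
        unfolding ip_def sum_distrib_left by (intro sum.cong) auto
      have os: "merge {1..d} J (x, y) \<in> ?E \<longleftrightarrow> c * ?h \<in> B \<and> (\<forall>i\<in>J. R (ip d (y i) (\<lambda>l. c * ?u l)) (c *
          ?h))"
        if y: "y \<in> space (Sph d J)" for y
      proof -
        let ?z = "merge {1..d} J (x, y)"
        have "?z \<in> space (Sph d {1..n})"
          using elim(2) y un(2) unfolding un(1)
              by (auto simp: space_PiM PiE_iff merge_def extensional_def)
        moreover have zc: "hnormal d ?z = ?u" "height d ?z = ?h"
          by (rule hyperplane_cong[OF d2]; simp add: merge_def)+
        moreover have "?z i = y i" if "i \<in> J" for i using that un(2) by (auto simp: merge_def)
        ultimately show ?thesis unfolding one_sided_def J_def[symmetric] mem_Collect_eq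
            by (simp add: ci)
      qed
      have ind: "indicator S p = (indicator B b * indicator T q :: ennreal)" if "p \<in> S \<longleftrightarrow> b \<in> B \<and> q \<in> T"
        for S T :: "(nat \<Rightarrow> nat \<Rightarrow> real) set" and p q b
        using that by (simp add: indicator_def)
      let ?A = "{y \<in> space (Sph d J). \<forall>i\<in>J. R (ip d (y i) (\<lambda>l. c * ?u l)) (c * ?h)}"
      have A: "?A \<in> sets (Sph d J)"
      proof -
        have "?A = Pi\<^sub>E J (\<lambda>_. {v. R (ip d v (\<lambda>l. c * ?u l)) (c * ?h)})"
          by (auto simp: space_PiM PiE_iff extensional_def)
        moreover have "{v. R (ip d v (\<lambda>l. c * ?u l)) (c * ?h)} \<in> sets borel" using R
            by (elim disjE) simp_all
        ultimately show ?thesis using un(3) by (simp add: sets_PiM_I_finite)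
      qed
      have "(\<integral>\<^sup>+y. indicator ?E (merge {1..d} J (x, y)) \<partial>Sph d J) =
          (\<integral>\<^sup>+y. indicator B (c * ?h) * indicator ?A y \<partial>Sph d J)"
      proof (rule nn_integral_cong)
        fix y assume y: "y \<in> space (Sph d J)"
        have "y \<in> ?A \<longleftrightarrow> (\<forall>i\<in>J. R (ip d (y i) (\<lambda>l. c * ?u l)) (c * ?h))"
          using y by (simp only: mem_Collect_eq simp_thms)
        then have "merge {1..d} J (x, y) \<in> ?E \<longleftrightarrow> c * ?h \<in> B \<and> y \<in> ?A"
          by (simp only: os[OF y])
        then show "indicator ?E (merge {1..d} J (x, y)) = (indicator B (c * ?h) *
            indicator ?A y :: ennreal)"
          by (rule ind)
      qed
      also have "\<dots> = indicator B (c * ?h) * emeasure (Sph d J) ?A"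
        using A by (simp add: nn_integral_cmult_indicator)
      also have "emeasure (Sph d J) ?A = ennreal (cap d (c * ?h) ^ card J)"
        by (rule emeasure_all_halfspace[OF d(1) cu h un(3) R])
      finally show ?case by (simp add: un(4) indicator_def)
    qed
  qed
  finally show ?thesis .
qed


lemma cap_measurable [measurable]:
  assumes "4 \<le> d" shows "cap d \<in> borel_measurable borel"
proof (rule borel_measurable_mono)
  show "mono (cap d)"
  proof (rule monoI)
    fix h k :: real assume "h \<le> k"
    then have "integral {-1..h} (sdens d) \<le> integral {-1..k} (sdens d)"
      by (intro integral_subset_le sdens_integrable assms) (auto simp: sdens_nonneg)
    then show "cap d h \<le> cap d k" using snorm_pos[OF assms] by (simp add: cap_def divide_right_mono)
  qed
qed

text \<open>The law of the typical height is \<open>f \<mapsto> hmean d (n - d) f / hmean d (n - d) 1\<close>.\<close>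

definition hmean :: "nat \<Rightarrow> nat \<Rightarrow> (real \<Rightarrow> real) \<Rightarrow> real" where
  "hmean d m f = (\<integral>x. f (height d x) * cap d (height d x) ^ m + f (- height d x) * cap d (-
      height d x) ^ m \<partial>Sph d {1..d})"

lemma AE_height:
  assumes d: "4 \<le> d" shows "AE x in Sph d {1..d}. \<bar>height d x\<bar> < 1"
proof -
  have "AE x in Sph d {1..d}. \<forall>i\<in>{1..d}. x i \<in> unit_sphere d" using d by (intro AE_Sph) auto
  then show ?thesis using AE_generic[OF d]
  proof eventually_elim
    case (elim x)
    have "2 \<le> d" using d by simp
    then show ?case using elim d by (intro generic_height[OF _ elim(2) spanning_hnormal]) auto
  qed
qed

lemma hmean_integrable:
  assumes d: "4 \<le> d" and [measurable]: "f \<in> borel_measurable borel"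
    and b: "\<And>t. \<bar>t\<bar> < 1 \<Longrightarrow> \<bar>f t\<bar> \<le> b" and c: "\<bar>c\<bar> = 1"
  shows "integrable (Sph d {1..d}) (\<lambda>x. f (c * height d x) * cap d (c * height d x) ^ m)"
proof -
  interpret S: prob_space "Sph d {1..d}" by (rule prob_space_Sph)
  note [measurable] = cap_measurable[OF d]
  show ?thesis
  proof (rule S.integrable_const_bound[of _ b])
    show "AE x in Sph d {1..d}. norm (f (c * height d x) * cap d (c * height d x) ^ m) \<le> b"
      using AE_height[OF d]
    proof eventually_elim
      case (elim x)
      then have h: "\<bar>c * height d x\<bar> < 1" using c by (simp add: abs_mult)
      have "\<bar>f (c * height d x)\<bar> * cap d (c * height d x) ^ m \<le> b * 1"
        using b[OF h] h cap_le_1[OF d, of "c * height d x"] cap_nonneg[OF d]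
        by (intro mult_mono power_le_one) auto
      then show ?case using cap_nonneg[OF d, of "c * height d x"] by (simp add: abs_mult)
    qed
  qed measurable
qed

lemma measure_one_sided:
  assumes d: "4 \<le> d" "d \<le> n" and R: "R = (\<le>) \<or> R = (<)" and B [measurable]: "B \<in> sets borel"
      and c: "\<bar>c\<bar> = 1"
  shows "measure (Sph d {1..n}) {z \<in> space (Sph d {1..n}). one_sided n d R c B z} =
    (\<integral>x. indicator B (c * height d x) * cap d (c * height d x) ^ (n - d) \<partial>Sph d {1..d})"
proof (rule measure_eq_emeasure_eq_ennreal)
  have nn: "0 \<le> indicator B (c * height d x) * cap d (c * height d x) ^ (n - d)" for x
    using cap_nonneg[OF d(1)] by simp
  then show "0 \<le> (\<integral>x. indicator B (c * height d x) * cap d (c * height d x) ^ (n - d) \<partial>Sph d {1..d})"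
    by (intro Bochner_Integration.integral_nonneg)
  show "emeasure (Sph d {1..n}) {z \<in> space (Sph d {1..n}). one_sided n d R c B z} =
    ennreal (\<integral>x. indicator B (c * height d x) * cap d (c * height d x) ^ (n - d) \<partial>Sph d {1..d})"
    unfolding emeasure_one_sided[OF assms]
    by (intro nn_integral_eq_integral hmean_integrable[where b = 1] d c AE_I2 nn)
        (auto simp: indicator_def)
qed

lemma hmean_eq:
  assumes d: "4 \<le> d" and [measurable]: "f \<in> borel_measurable borel" and b: "\<And>t. \<bar>t\<bar> < 1 \<Longrightarrow> \<bar>f t\<bar> \<le> b"
  shows "hmean d m f = (\<integral>x. f (1 * height d x) * cap d (1 * height d x) ^ m \<partial>Sph d {1..d}) +
    (\<integral>x. f (- 1 * height d x) * cap d (- 1 * height d x) ^ m \<partial>Sph d {1..d})"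
  using Bochner_Integration.integral_add[OF hmean_integrable[OF assms,
      of 1 m] hmean_integrable[OF assms, of "- 1" m]]
  by (simp add: hmean_def)

section \<open>Comparison of facet events with one-sided events\<close>

lemma AE_Sph_good:
  assumes d: "4 \<le> d" "d \<le> n"
  shows "AE z in Sph d {1..n}. (\<forall>i\<in>{1..n}. z i \<in> unit_sphere d) \<and> generic d z"
proof -
  interpret product_prob_space "\<lambda>_::nat. uniform_sphere d" by (rule product_prob_space_Sph)
  have sub: "{1..d} \<subseteq> {1..n}" using d by auto
  have r: "(\<lambda>x. restrict x {1..d}) \<in> Sph d {1..n} \<rightarrow>\<^sub>M Sph d {1..d}"
    using sub by (rule measurable_restrict_subset)
  have "AE x in distr (Sph d {1..n}) (Sph d {1..d}) (\<lambda>x. restrict x {1..d}). generic d x"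
    by (rule subst[OF distr_restrict[OF sub], of "\<lambda>M. AE x in M. generic d x"]) (simp,
        rule AE_generic[OF d(1)])
  then have "AE z in Sph d {1..n}. generic d (restrict z {1..d})"
    by (rule AE_distrD[OF r])
  moreover have "AE z in Sph d {1..n}. \<forall>i\<in>{1..n}. z i \<in> unit_sphere d" using d by (intro AE_Sph) auto
  ultimately show ?thesis
  proof eventually_elim
    case (elim z)
    moreover have "generic d z = generic d (restrict z {1..d})"
      using d by (intro hyperplane_cong) auto
    ultimately show ?case by simp
  qed
qed

lemma spanning_uminus: "spanning d x u h \<Longrightarrow> spanning d x (\<lambda>l. - u l) (- h)"
  by (auto simp: spanning_def unit_sphere_def Rd_def nrm_def ip_def sum_negf)

lemma ip_uminus_right: "ip d x (\<lambda>l. - u l) = - ip d x u"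
  by (simp add: ip_def sum_negf)

lemma one_sided_facet:
  assumes d: "2 \<le> d" "d \<le> n" and z: "\<forall>i\<in>{1..n}. z i \<in> unit_sphere d" "generic d z"
    and c: "\<bar>c\<bar> = 1" and os: "one_sided n d (<) c UNIV z"
  shows "is_facet d (convex hull (z ` {1..n})) (convex hull (z ` {1..d}))"
proof -
  have s: "spanning d z (hnormal d z) (height d z)" by (rule spanning_hnormal[OF d(1)])
  have "c = 1 \<or> c = -1" using c by auto
  then show ?thesis
  proof
    assume "c = 1"
    then show ?thesis using os by (intro spanning_facet(1)[OF d z s]) (simp add: one_sided_def)
  next
    assume "c = -1"
    then show ?thesis using os
      by (intro spanning_facet(1)[OF d z spanning_uminus[OF s]]) (simp add: one_sided_def
          ip_uminus_right)
  qed
qed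

lemma has_height_one_sided:
  assumes d: "2 \<le> d" "d \<le> n" and g: "generic d z" and h: "h \<in> B"
    and H: "has_height d (convex hull (z ` {1..n})) (convex hull (z ` {1..d})) h"
  shows "one_sided n d (\<le>) 1 B z \<or> one_sided n d (\<le>) (- 1) B z"
proof -
  obtain u where u: "spanning d z u h" "\<forall>i\<in>{1..n}. ip d (z i) u \<le> h"
    by (rule height_spanning[OF d(2) H])
  have s: "spanning d z (hnormal d z) (height d z)" by (rule spanning_hnormal[OF d(1)])
  from generic_unique[OF d(1) g s u(1)] show ?thesis
  proof
    assume "u = hnormal d z \<and> h = height d z"
    then have "one_sided n d (\<le>) 1 B z" using u(2) h by (auto simp: one_sided_def)
    then show ?thesis ..
  next
    assume "u = (\<lambda>l. - hnormal d z l) \<and> h = - height d z"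
    then have "one_sided n d (\<le>) (- 1) B z" using u(2) h by (auto simp: one_sided_def ip_uminus_right)
    then show ?thesis ..
  qed
qed

text \<open>Concentration needs only an upper bound on probabilities. In the conditional probability
  the numerator is bounded above by the events with weak inequalities and the denominator below by
  those with strict ones; both have the same measure, expressed by \<open>hmean\<close>.\<close>

lemma typical_height_bound:
  assumes d: "4 \<le> d" "d < n" and iid: "iid_uniform_sphere n d M X" and tH: "typical_height n d M X N H"
    and B [measurable]: "B \<in> sets borel"
  shows "measure N {\<omega> \<in> space N. H \<omega> \<in> B} * hmean d (n - d) (\<lambda>_. 1) \<le> hmean d (n - d) (indicator B)"
proof -
  interpret M: prob_space M using iid by (simp add: iid_uniform_sphere_def)
  interpret N: prob_space N using tH by (simp add: typical_height_def)
  have dn: "d \<le> n" "2 \<le> d" "{1..n} \<noteq> {}" using d by auto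
  have indep: "M.indep_vars (\<lambda>_. borel) X {1..n}" and law: "\<And>i. i \<in> {1..n} \<Longrightarrow> distr M borel (X i) =
      uniform_sphere d"
    using iid by (auto simp: iid_uniform_sphere_def)
  have X: "X i \<in> M \<rightarrow>\<^sub>M borel" if "i \<in> {1..n}" for i
    using indep that unfolding M.indep_vars_def by blast
  define Z where "Z \<omega> = (\<lambda>i\<in>{1..n}. X i \<omega>)" for \<omega>
  have Zm: "Z \<in> M \<rightarrow>\<^sub>M Sph d {1..n}"
    unfolding Z_def[abs_def] using X by (intro measurable_restrict) (simp cong: measurable_cong_sets)
  have "distr M (Sph d {1..n}) Z = distr M (\<Pi>\<^sub>M i\<in>{1..n}. borel) Z"
    by (intro distr_cong sets_PiM_cong) auto
  also have "\<dots> = (\<Pi>\<^sub>M i\<in>{1..n}. distr M borel (X i))"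
    using indep unfolding Z_def[abs_def] by (subst (asm) M.indep_vars_iff_distr_eq_PiM'[OF dn(3) X])
  also have "\<dots> = Sph d {1..n}" using law by (intro PiM_cong) auto
  finally have dZ: "distr M (Sph d {1..n}) Z = Sph d {1..n}" .
  have good: "AE \<omega> in M. (\<forall>i\<in>{1..n}. Z \<omega> i \<in> unit_sphere d) \<and> generic d (Z \<omega>)"
    using AE_Sph_good[OF d(1) dn(1)] by (intro AE_distrD[OF Zm]) (simp only: dZ)
  have mZ: "measure M {\<omega> \<in> space M. P (Z \<omega>)} = measure (Sph d {1..n}) {z \<in> space (Sph d {1..n}). P z}"
    and sZ: "{\<omega> \<in> space M. P (Z \<omega>)} \<in> sets M"
    if P: "Measurable.pred (Sph d {1..n}) P" for P
  proof -
    have S: "{z \<in> space (Sph d {1..n}). P z} \<in> sets (Sph d {1..n})" using P unfolding pred_def .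
    have eq: "Z -` {z \<in> space (Sph d {1..n}). P z} \<inter> space M = {\<omega> \<in> space M. P (Z \<omega>)}"
      using measurable_space[OF Zm] by auto
    show "measure M {\<omega> \<in> space M. P (Z \<omega>)} = measure (Sph d {1..n}) {z \<in> space (Sph d {1..n}). P z}"
      using measure_distr[OF Zm S] unfolding dZ eq by simp
    show "{\<omega> \<in> space M. P (Z \<omega>)} \<in> sets M"
      using measurable_sets[OF Zm S] unfolding eq .
  qed
  have poly: "rand_poly n X \<omega> = convex hull (Z \<omega> ` {1..n})" "rand_poly d X \<omega> =
      convex hull (Z \<omega> ` {1..d})" for \<omega>
    using dn by (auto simp: rand_poly_def Z_def intro!: arg_cong[where f =
        "\<lambda>S. convex hull S"] image_cong)
  define Fc where "Fc = {\<omega> \<in> space M. is_facet d (rand_poly n X \<omega>) (rand_poly d X \<omega>)}"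
  define Ev where "Ev B = {\<omega> \<in> space M. (\<exists>h\<in>B. has_height d (rand_poly n X \<omega>) (rand_poly d X \<omega>) h) \<and>
      is_facet d (rand_poly n X \<omega>) (rand_poly d X \<omega>)}" for B
  have tH': "measure N {\<omega> \<in> space N. H \<omega> \<in> B} = measure M (Ev B) / measure M Fc" if "B \<in> sets borel"
      for B
    using tH that by (simp add: typical_height_def cond_prob_def Ev_def Fc_def)
  \<comment> \<open>\<open>H\<close> has total mass 1, and a quotient with denominator 0 would be 0.
    Hence the facet event has nonzero measure, and it is measurable because \<open>measure\<close>
    is 0 on non-measurable sets.\<close>
  have "measure M (Ev UNIV) / measure M Fc = 1"
    using tH'[of UNIV] N.prob_space by simp
  then have pF: "measure M Fc \<noteq> 0" by auto
  then have sF: "Fc \<in> sets M" using measure_notin_sets by blast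
  define A where "A R c B = {\<omega> \<in> space M. one_sided n d R c B (Z \<omega>)}" for R c B
  have mA: "measure M (A R c B) = (\<integral>x. indicator B (c * height d x) * cap d (c * height d x) ^ (n -
      d) \<partial>Sph d {1..d})"
    and sA: "A R c B \<in> sets M"
    if R: "R = (\<le>) \<or> R = (<)" and B: "B \<in> sets borel" and c: "\<bar>c\<bar> = 1" for R c B
    using mZ[OF one_sided_measurable[OF dn(2,1) R B, of c]] measure_one_sided[OF d(1) dn(1) R B c]
      sZ[OF one_sided_measurable[OF dn(2,1) R B, of c]] unfolding A_def by simp_all
  have hm: "hmean d (n - d) (indicator B) = measure M (A R 1 B) + measure M (A R (- 1) B)"
    if R: "R = (\<le>) \<or> R = (<)" and B [measurable]: "B \<in> sets borel" for R B
    by (simp only: mA[OF R B, of 1] mA[OF R B, of "- 1"] abs_one abs_neg_one)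
       (rule hmean_eq[OF d(1), where b = 1], auto simp: indicator_def)
  have lower: "hmean d (n - d) (indicator UNIV) \<le> measure M Fc"
  proof -
    \<comment> \<open>As \<open>d < n\<close>, there is a further point, and it cannot lie strictly
      on both sides of the hyperplane.\<close>
    have disj: "A (<) 1 UNIV \<inter> A (<) (- 1) UNIV = {}"
      using d by (force simp: A_def one_sided_def)
    have "hmean d (n - d) (indicator UNIV) = measure M (A (<) 1 UNIV) + measure M (A (<) (- 1) UNIV)"
      by (rule hm) auto
    also have "\<dots> = measure M (A (<) 1 UNIV \<union> A (<) (- 1) UNIV)"
      by (rule M.finite_measure_Union[symmetric]) (auto intro!: sA disj)
    also have "\<dots> \<le> measure M Fc"
    proof (rule M.finite_measure_mono_AE[OF _ sF])
      show "AE \<omega> in M. \<omega> \<in> A (<) 1 UNIV \<union> A (<) (- 1) UNIV \<longrightarrow> \<omega> \<in> Fc"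
        using good
      proof eventually_elim
        case (elim \<omega>)
        show ?case
        proof
          assume "\<omega> \<in> A (<) 1 UNIV \<union> A (<) (- 1) UNIV"
          then have sp: "\<omega> \<in> space M" and "one_sided n d (<) 1 UNIV (Z \<omega>) \<or> one_sided n d (<) (-
              1) UNIV (Z \<omega>)"
            by (auto simp: A_def)
          then have "is_facet d (convex hull (Z \<omega> ` {1..n})) (convex hull (Z \<omega> ` {1..d}))"
            using one_sided_facet[OF dn(2,1) conjunct1[OF elim] conjunct2[OF elim], of 1]
              one_sided_facet[OF dn(2,1) conjunct1[OF elim] conjunct2[OF elim], of "- 1"] by auto
          with sp show "\<omega> \<in> Fc" by (simp add: Fc_def poly)
        qed
      qed
    qed
    finally show ?thesis .
  qed
  have upper: "measure M (Ev B) \<le> hmean d (n - d) (indicator B)"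
  proof (cases "Ev B \<in> sets M")
    case True
    have sU: "A (\<le>) 1 B \<union> A (\<le>) (- 1) B \<in> sets M" by (intro sets.Un sA B) auto
    have "measure M (Ev B) \<le> measure M (A (\<le>) 1 B \<union> A (\<le>) (- 1) B)"
    proof (rule M.finite_measure_mono_AE[OF _ sU])
      show "AE \<omega> in M. \<omega> \<in> Ev B \<longrightarrow> \<omega> \<in> A (\<le>) 1 B \<union> A (\<le>) (- 1) B"
        using good
      proof eventually_elim
        case (elim \<omega>)
        then show ?case
          using has_height_one_sided[OF dn(2,1), of "Z \<omega>" _ B] by (auto simp: Ev_def A_def poly)
      qed
    qed
    also have "\<dots> \<le> measure M (A (\<le>) 1 B) + measure M (A (\<le>) (- 1) B)"
      by (intro measure_Un_le sA B) auto
    also have "\<dots> = hmean d (n - d) (indicator B)" by (rule hm[symmetric]) (use B in auto)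
    finally show ?thesis .
  next
    \<comment> \<open>Measurability of \<open>Ev B\<close> has not been established; outside the
      sigma-algebra its \<open>measure\<close> is 0 and the bound is trivial.\<close>
    case False
    then have "measure M (Ev B) = 0" by (rule measure_notin_sets)
    also have "0 \<le> hmean d (n - d) (indicator B)"
      unfolding hmean_def using cap_nonneg[OF d(1)] by (intro Bochner_Integration.integral_nonneg) auto
    finally show ?thesis .
  qed
  have "measure N {\<omega> \<in> space N. H \<omega> \<in> B} * hmean d (n - d) (\<lambda>_. 1) \<le> measure N {\<omega> \<in> space N. H \<omega> \<in> B} *
      measure M Fc"
    using lower by (intro mult_left_mono) (simp_all add: indicator_def)
  also have "\<dots> = measure M (Ev B)" using tH'[OF B] pF by simp
  also note upper
  finally show ?thesis .
qed

section \<open>Concentration of the typical height\<close>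

lemma height_integrable:
  assumes d: "4 \<le> d" and [measurable]: "f \<in> borel_measurable borel"
    and b: "\<And>t. \<bar>t\<bar> < 1 \<Longrightarrow> \<bar>f t\<bar> \<le> b"
  shows "integrable (Sph d {1..d}) (\<lambda>x. f (height d x) :: real)"
proof -
  interpret S: prob_space "Sph d {1..d}" by (rule prob_space_Sph)
  show ?thesis
  proof (rule S.integrable_const_bound[of _ b])
    show "AE x in Sph d {1..d}. norm (f (height d x)) \<le> b"
      using AE_height[OF d] by eventually_elim (unfold real_norm_def, rule b)
  qed measurable
qed

lemma sdens_le_1: "4 \<le> d \<Longrightarrow> sdens d t \<le> 1"
  unfolding sdens_def by (intro powr_le1) auto

text \<open>One of the two caps cut off by the hyperplane has probability at least 1/2, so the
  integrand is at least \<open>(1 / 2) ^ m\<close>.\<close>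

lemma hmean_1_pos:
  assumes d: "4 \<le> d" shows "0 < hmean d m (\<lambda>_. 1)"
proof -
  interpret S: prob_space "Sph d {1..d}" by (rule prob_space_Sph)
  note [measurable] = cap_measurable[OF d]
  have "(\<integral>x. (1 / 2) ^ m \<partial>Sph d {1..d}) \<le> (\<integral>x. 1 * cap d (height d x) ^ m +
      1 * cap d (- height d x) ^ m \<partial>Sph d {1..d})"
  proof (rule integral_mono_AE)
    have "\<bar>1 * cap d t ^ m + 1 * cap d (- t) ^ m\<bar> \<le> 1 + 1" if "\<bar>t\<bar> < 1" for t
    proof -
      have "cap d t ^ m \<le> 1" "cap d (- t) ^ m \<le> 1"
        using that by (auto intro!: power_le_one cap_nonneg cap_le_1 d)
      then show ?thesis using cap_nonneg[OF d, of t] cap_nonneg[OF d, of "- t"] by simp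
    qed
    then show "integrable (Sph d {1..d}) (\<lambda>x. 1 * cap d (height d x) ^ m +
        1 * cap d (- height d x) ^ m)"
      by (intro height_integrable[OF d, where f = "\<lambda>t. 1 * cap d t ^ m + 1 * cap d (- t) ^ m"])
          (measurable, simp)
    show "AE x in Sph d {1..d}. (1 / 2) ^ m \<le> 1 * cap d (height d x) ^ m + 1 * cap d (- height d x) ^ m"
      using AE_height[OF d]
    proof eventually_elim
      case (elim x)
      let ?a = "cap d (height d x)" and ?b = "cap d (- height d x)"
      have "?b = 1 - ?a" using elim by (intro cap_reflect d) simp
      then have "1 / 2 \<le> ?a \<or> 1 / 2 \<le> ?b" by linarith
      then have "(1 / 2) ^ m \<le> ?a ^ m \<or> (1 / 2) ^ m \<le> ?b ^ m" by (auto intro: power_mono)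
      moreover have "0 \<le> ?a ^ m" "0 \<le> ?b ^ m" using cap_nonneg[OF d] by auto
      ultimately show ?case by auto
    qed
  qed (rule S.integrable_const)
  then have "(1 / 2) ^ m \<le> hmean d m (\<lambda>_. 1)" by (simp add: hmean_def S.prob_space[simplified])
  then show ?thesis by (meson less_le_trans zero_less_power half_gt_zero zero_less_one)
qed

text \<open>Since \<open>hazard\<close> decreases, both factors have the same sign unless
  \<open>t\<close> lies between 0 and \<open>h0\<close>. There the product is negative at worst by
  \<open>h0\<close> times the total variation of \<open>hazard\<close> on that interval.\<close>

lemma hazard_drift:
  assumes d: "4 \<le> d" and h0: "0 \<le> h0" "h0 < 1" and t: "\<bar>t\<bar> < 1"
  shows "- (h0 * (hazard d 0 - hazard d h0)) \<le> (t - h0) * (hazard d 0 - hazard d t)"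
proof -
  have nn: "0 \<le> h0 * (hazard d 0 - hazard d h0)"
    using hazard_antimono[OF d, of 0 h0] h0 by simp
  consider "t \<le> 0" | "h0 \<le> t" | "0 < t" "t < h0" by linarith
  then show ?thesis
  proof cases
    case 1
    then have "hazard d 0 \<le> hazard d t" using t by (intro hazard_antimono d) auto
    then have "0 \<le> (t - h0) * (hazard d 0 - hazard d t)" using 1 h0 by (intro mult_nonpos_nonpos) auto
    then show ?thesis using nn by linarith
  next
    case 2
    then have "hazard d t \<le> hazard d 0" using t h0 by (intro hazard_antimono d) auto
    then have "0 \<le> (t - h0) * (hazard d 0 - hazard d t)" using 2 by simp
    then show ?thesis using nn by linarith
  next
    case 3
    have "hazard d h0 \<le> hazard d t" "hazard d t \<le> hazard d 0"
      using 3 t h0 by (auto intro!: hazard_antimono d)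
    then have "(h0 - t) * (hazard d 0 - hazard d t) \<le> h0 * (hazard d 0 - hazard d h0)"
      using 3 by (intro mult_mono) auto
    then show ?thesis by (simp add: algebra_simps)
  qed
qed

text \<open>Stein's identity annihilates the mean of
  \<open>(d - 1)^2 * h * \<phi> h - (1 - h^2) * \<phi>' h\<close>. It therefore suffices to dominate
  the squared deviation pointwise by this expression plus a constant multiple of the weight.\<close>

lemma second_moment_bound:
  assumes d: "4 \<le> d" and m: "1 \<le> m" and h0: "0 \<le> h0" "h0 < 1"
    and eq: "(real d - 1)\<^sup>2 * h0 = real m * hazard d 0"
  shows "(real d - 1)\<^sup>2 * hmean d m (\<lambda>t. (t - h0)\<^sup>2) \<le>
    (1 + real m * (h0 * (hazard d 0 - hazard d h0))) * hmean d m (\<lambda>_. 1)"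
proof -
  let ?S = "Sph d {1..d}" and ?F = "cap d" and ?s = "\<lambda>t. sdens d t / snorm d"
  note [measurable] = cap_measurable[OF d]
  have Z: "0 < snorm d" by (rule snorm_pos[OF d])
  define C where "C = real m * (h0 * (hazard d 0 - hazard d h0))"
  define q where "q t = (t - h0) * ?F t ^ m" for t
  define q' where "q' t = ?F t ^ m + (t - h0) * (real m * ?F t ^ (m - 1) * ?s t)" for t
  have [measurable]: "q \<in> borel_measurable borel" "q' \<in> borel_measurable borel"
    unfolding q_def[abs_def] q'_def[abs_def] by measurable
  \<comment> \<open>The sum of a bound for \<open>q\<close>, namely 2, and a bound for
    \<open>q'\<close>, namely \<open>1 + 2 * m / snorm d\<close>.\<close>
  define b where "b = 1 + 2 * (real m * (1 / snorm d)) + 2"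
  have F1: "\<bar>?F t ^ k\<bar> \<le> 1" if "\<bar>t\<bar> \<le> 1" for t k
    using cap_nonneg[OF d, of t] cap_le_1[OF d that] by (simp add: power_abs power_le_one)
  have s1: "\<bar>?s t\<bar> \<le> 1 / snorm d" for t
    using sdens_nonneg[of d t] sdens_le_1[OF d, of t] Z by (simp add: divide_right_mono)
  have t2: "\<bar>t - h0\<bar> \<le> 2" if "\<bar>t\<bar> \<le> 1" for t using that h0 by auto
  have qb: "\<bar>q t\<bar> \<le> b" if "\<bar>t\<bar> \<le> 1" for t
  proof -
    have "\<bar>t - h0\<bar> * \<bar>?F t ^ m\<bar> \<le> 2 * 1" using t2[OF that] F1[OF that] by (intro mult_mono) auto
    moreover have "0 \<le> 2 * (real m * (1 / snorm d))" using Z by simp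
    ultimately show ?thesis unfolding q_def abs_mult b_def by linarith
  qed
  have q'b: "\<bar>q' t\<bar> \<le> b" if "\<bar>t\<bar> \<le> 1" for t
  proof -
    have "\<bar>t - h0\<bar> * ((real m * \<bar>?F t ^ (m - 1)\<bar>) * \<bar>?s t\<bar>) \<le> 2 * ((real m * 1) * (1 / snorm d))"
      using t2[OF that] F1[OF that] s1 Z by (intro mult_mono mult_left_mono) auto
    then have "\<bar>(t - h0) * (real m * ?F t ^ (m - 1) * ?s t)\<bar> \<le> 2 * (real m * (1 / snorm d))"
      by (simp only: abs_mult abs_of_nat mult_1_right)
    then show ?thesis using F1[OF that, of m] unfolding q'_def b_def by linarith
  qed
  \<comment> \<open>Antisymmetrising makes the test function odd, as \<open>height_stein\<close>
    requires. Since \<open>t\<close> is odd and \<open>1 - t^2\<close> is even, the two halves of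
    \<open>\<phi>\<close> reproduce the two orientations in \<open>hmean\<close>.\<close>
  define \<phi> where "\<phi> t = q t - q (- t)" for t
  define \<phi>' where "\<phi>' t = q' t + q' (- t)" for t
  have [measurable]: "\<phi> \<in> borel_measurable borel" "\<phi>' \<in> borel_measurable borel"
    unfolding \<phi>_def[abs_def] \<phi>'_def[abs_def] by measurable
  have dq: "(q has_real_derivative q' t) (at t)" if "\<bar>t\<bar> < 1" for t
  proof -
    have "((\<lambda>t. ?F t ^ m) has_real_derivative real m * ?F t ^ (m - 1) * ?s t) (at t)"
      using DERIV_power[OF cap_derivative[OF d that], of m] by (simp add: mult_ac)
    then have "((\<lambda>t. (t - h0) * ?F t ^ m) has_real_derivative 1 * ?F t ^ m + (real m * ?F t ^ (m - 1) *
        ?s t) * (t - h0)) (at t)"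
      by (intro DERIV_mult) (auto intro!: derivative_eq_intros)
    then show ?thesis unfolding q_def[abs_def] q'_def by (simp add: mult.commute)
  qed
  have stein: "(\<integral>x. (1 - (height d x)\<^sup>2) * \<phi>' (height d x) \<partial>?S) = (real d - 1)\<^sup>2 * (\<integral>x. height d x *
      \<phi> (height d x) \<partial>?S)"
  proof (rule height_stein[OF d, where B = "2 * b"])
    show "\<phi> (- h) = - \<phi> h" for h by (simp add: \<phi>_def)
    show "(\<phi> has_real_derivative \<phi>' h) (at h)" if h: "\<bar>h\<bar> < 1" for h
    proof -
      have "((\<lambda>t. q (- t)) has_real_derivative q' (- h) * - 1) (at h)"
        by (rule DERIV_chain2[OF dq]) (use h in \<open>auto intro!: derivative_eq_intros\<close>)
      from DERIV_diff[OF dq[OF h] this] show ?thesis by (simp add: \<phi>_def[abs_def] \<phi>'_def)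
    qed
    show "\<bar>\<phi> h\<bar> \<le> 2 * b" if "\<bar>h\<bar> \<le> 1" for h using qb[of h] qb[of "- h"] that unfolding \<phi>_def by simp
    show "\<bar>\<phi>' h\<bar> \<le> 2 * b" if "\<bar>h\<bar> < 1" for h using q'b[of h] q'b[of "- h"] that unfolding \<phi>'_def by simp
  qed measurable
  \<comment> \<open>After \<open>eq\<close> has replaced \<open>(d - 1)^2 * h0\<close>, the
    difference of the two sides is \<open>?F t ^ m\<close> times
    \<open>m * (t - h0) * (hazard d 0 - hazard d t) + C + t^2\<close>. The term \<open>t^2\<close>
    is left over from \<open>1 - (1 - t^2)\<close>, and \<open>C\<close> is the loss in
    \<open>hazard_drift\<close>.\<close>
  have point: "(real d - 1)\<^sup>2 * ((t - h0)\<^sup>2 * ?F t ^ m) \<le> (real d - 1)\<^sup>2 * (t * q t) - (1 - t\<^sup>2) *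
      q' t + (1 + C) * ?F t ^ m"
    if t: "\<bar>t\<bar> < 1" for t
  proof -
    have Fp: "0 < ?F t" by (rule cap_pos[OF d t])
    have "?F t ^ m = ?F t ^ (m - 1) * ?F t" using m by (simp add: power_eq_if)
    then have hz: "(1 - t\<^sup>2) * (real m * ?F t ^ (m - 1) * ?s t) = real m * hazard d t * ?F t ^ m"
      using Fp by (simp add: hazard_def)
    have e: "(real d - 1)\<^sup>2 * (t * q t) - (1 - t\<^sup>2) * q' t + (1 + C) * ?F t ^ m - (real d - 1)\<^sup>2 *
        ((t - h0)\<^sup>2 * ?F t ^ m) =
        ((real d - 1)\<^sup>2 * h0 * (t - h0) + t\<^sup>2 + C) * ?F t ^ m - (t - h0) *
            ((1 - t\<^sup>2) * (real m * ?F t ^ (m - 1) * ?s t))"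
      unfolding q_def q'_def by (simp add: algebra_simps power2_eq_square)
    also have "\<dots> = (real m * ((t - h0) * (hazard d 0 - hazard d t)) + C + t\<^sup>2) * ?F t ^ m"
      unfolding hz eq by (simp add: algebra_simps)
    also have "0 \<le> real m * ((t - h0) * (hazard d 0 - hazard d t)) + C + t\<^sup>2"
    proof -
      have "real m * (- (h0 * (hazard d 0 - hazard d h0))) \<le> real m * ((t - h0) * (hazard d 0 -
          hazard d t))"
        by (intro mult_left_mono hazard_drift d h0 t) simp
      then show ?thesis unfolding C_def using zero_le_power2[of t] by linarith
    qed
    then have "0 \<le> (real m * ((t - h0) * (hazard d 0 - hazard d t)) + C + t\<^sup>2) * ?F t ^ m"
      using Fp by (intro mult_nonneg_nonneg) auto
    finally show ?thesis by linarith
  qed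
  let ?h = "height d"
  let ?A = "\<lambda>t. (t - h0)\<^sup>2 * ?F t ^ m + (- t - h0)\<^sup>2 * ?F (- t) ^ m"
  let ?E = "\<lambda>t. 1 * ?F t ^ m + 1 * ?F (- t) ^ m"
  have iA: "integrable ?S (\<lambda>x. ?A (?h x))"
  proof (rule height_integrable[OF d, where b = 8])
    fix t :: real assume t: "\<bar>t\<bar> < 1"
    have "\<bar>(v - h0)\<^sup>2 * ?F v ^ m\<bar> \<le> 4" if "\<bar>v\<bar> \<le> 1" for v
    proof -
      have "\<bar>v - h0\<bar>\<^sup>2 \<le> 2\<^sup>2" using t2[OF that] by (intro power_mono) auto
      then have "\<bar>v - h0\<bar>\<^sup>2 * \<bar>?F v ^ m\<bar> \<le> 4 * 1" using F1[OF that] by (intro mult_mono) auto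
      then show ?thesis by (simp add: abs_mult)
    qed
    from this[of t] this[of "- t"] t show "\<bar>?A t\<bar> \<le> 8" by simp
  qed measurable
  have iE: "integrable ?S (\<lambda>x. ?E (?h x))"
  proof (rule height_integrable[OF d, where b = 2])
    show "\<bar>?E t\<bar> \<le> 2" if "\<bar>t\<bar> < 1" for t using F1[of t m] F1[of "- t" m] that by simp
  qed measurable
  have iP: "integrable ?S (\<lambda>x. ?h x * \<phi> (?h x))"
  proof (rule height_integrable[OF d, where b = "1 * (2 * b)" and f = "\<lambda>t. t * \<phi> t"])
    show "\<bar>t * \<phi> t\<bar> \<le> 1 * (2 * b)" if "\<bar>t\<bar> < 1" for t
      using qb[of t] qb[of "- t"] that unfolding abs_mult by (intro mult_mono) (auto simp: \<phi>_def)
  qed measurable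
  have iP': "integrable ?S (\<lambda>x. (1 - (?h x)\<^sup>2) * \<phi>' (?h x))"
  proof (rule height_integrable[OF d, where b = "1 * (2 * b)" and f = "\<lambda>t. (1 - t\<^sup>2) * \<phi>' t"])
    show "\<bar>(1 - t\<^sup>2) * \<phi>' t\<bar> \<le> 1 * (2 * b)" if t: "\<bar>t\<bar> < 1" for t
    proof -
      have "\<bar>1 - t\<^sup>2\<bar> \<le> 1" using one_minus_square_pos[OF t] zero_le_power2[of t] by linarith
      then show ?thesis using q'b[of t] q'b[of "- t"] t unfolding abs_mult
          by (intro mult_mono) (auto simp: \<phi>'_def)
    qed
  qed measurable
  have "(real d - 1)\<^sup>2 * hmean d m (\<lambda>t. (t - h0)\<^sup>2) = (\<integral>x. (real d - 1)\<^sup>2 * ?A (?h x) \<partial>?S)"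
    by (simp add: hmean_def)
  also have "\<dots> \<le> (\<integral>x. (real d - 1)\<^sup>2 * (?h x * \<phi> (?h x)) - (1 - (?h x)\<^sup>2) * \<phi>' (?h x) + (1 + C) *
      ?E (?h x) \<partial>?S)"
  proof (rule integral_mono_AE)
    show "integrable ?S (\<lambda>x. (real d - 1)\<^sup>2 * ?A (?h x))" by (intro integrable_mult_right iA)
    show "integrable ?S (\<lambda>x. (real d - 1)\<^sup>2 * (?h x * \<phi> (?h x)) - (1 - (?h x)\<^sup>2) * \<phi>' (?h x) + (1 + C) *
        ?E (?h x))"
      by (intro Bochner_Integration.integrable_add Bochner_Integration.integrable_diff
          integrable_mult_right iP iP' iE)
    show "AE x in ?S. (real d - 1)\<^sup>2 * ?A (?h x) \<le>
        (real d - 1)\<^sup>2 * (?h x * \<phi> (?h x)) - (1 - (?h x)\<^sup>2) * \<phi>' (?h x) + (1 + C) * ?E (?h x)"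
      using AE_height[OF d]
    proof eventually_elim
      case (elim x)
      then show ?case using point[of "?h x"] point[of "- ?h x"]
          by (simp add: \<phi>_def \<phi>'_def algebra_simps)
    qed
  qed
  also have "\<dots> = (real d - 1)\<^sup>2 * (\<integral>x. ?h x * \<phi> (?h x) \<partial>?S) - (\<integral>x. (1 - (?h x)\<^sup>2) * \<phi>' (?h x) \<partial>?S) +
      (1 + C) * (\<integral>x. ?E (?h x) \<partial>?S)"
    by (subst Bochner_Integration.integral_add,
        intro Bochner_Integration.integrable_diff integrable_mult_right iP iP',
        intro integrable_mult_right iE, subst Bochner_Integration.integral_diff,
            intro integrable_mult_right iP, rule iP')
       (simp only: integral_mult_right_zero)
  also have "\<dots> = (1 + C) * hmean d m (\<lambda>_. 1)" unfolding stein hmean_def by simp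
  finally show ?thesis unfolding C_def .
qed

text \<open>Chebyshev's inequality for the weighted mean \<open>hmean\<close>, transferred to
  \<open>H\<close> by \<open>typical_height_bound\<close>.\<close>

lemma typical_height_concentration:
  assumes d: "4 \<le> d" "d < n" and iid: "iid_uniform_sphere n d M X" and tH: "typical_height n d M X N H"
    and h0: "0 \<le> h0" "h0 < 1" "(real d - 1)\<^sup>2 * h0 = real (n - d) * hazard d 0" and \<delta>: "0 < \<delta>"
  shows "measure N {\<omega> \<in> space N. \<delta> \<le> \<bar>H \<omega> - h0\<bar>} \<le>
    (1 + real (n - d) * (h0 * (hazard d 0 - hazard d h0))) / ((real d - 1)\<^sup>2 * \<delta>\<^sup>2)"
proof -
  let ?S = "Sph d {1..d}" and ?F = "cap d" and ?m = "n - d" and ?h = "height d"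
  note [measurable] = cap_measurable[OF d(1)]
  let ?B = "{t. \<delta> \<le> \<bar>t - h0\<bar>}"
  define I where "I = hmean d ?m (\<lambda>_. 1)"
  define C where "C = 1 + real ?m * (h0 * (hazard d 0 - hazard d h0))"
  have I: "0 < I" unfolding I_def by (rule hmean_1_pos[OF d(1)])
  have B [measurable]: "?B \<in> sets borel" by measurable
  have F1: "\<bar>?F t ^ k\<bar> \<le> 1" if "\<bar>t\<bar> \<le> 1" for t k
    using cap_nonneg[OF d(1), of t] cap_le_1[OF d(1) that] by (simp add: power_abs power_le_one)
  have int: "integrable ?S (\<lambda>x. f (?h x) * ?F (?h x) ^ ?m + f (- ?h x) * ?F (- ?h x) ^ ?m)"
    if [measurable]: "f \<in> borel_measurable borel" and f: "\<And>t. \<bar>t\<bar> < 1 \<Longrightarrow> \<bar>f t\<bar> \<le> c" and c: "0 \<le> c"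
        for f :: "real \<Rightarrow> real" and c
  proof (rule height_integrable[OF d(1), where b = "c * 1 + c * 1" and f = "\<lambda>t. f t * ?F t ^ ?m +
      f (- t) * ?F (- t) ^ ?m"])
    fix t :: real assume t: "\<bar>t\<bar> < 1"
    have "\<bar>f v * ?F v ^ ?m\<bar> \<le> c * 1" if "\<bar>v\<bar> < 1" for v
      unfolding abs_mult by (rule mult_mono[OF f[OF that] F1]) (use that c in auto)
    from this[of t] this[of "- t"] t show "\<bar>f t * ?F t ^ ?m + f (- t) * ?F (- t) ^ ?m\<bar> \<le> c * 1 + c * 1"
        by (simp add: abs_le_iff)
  qed measurable
  have "\<delta>\<^sup>2 * hmean d ?m (indicator ?B) =
      (\<integral>x. \<delta>\<^sup>2 * (indicator ?B (?h x) * ?F (?h x) ^ ?m + indicator ?B (- ?h x) * ?F (- ?h x) ^ ?m) \<partial>?S)"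
    unfolding hmean_def by simp
  also have "\<dots> \<le> hmean d ?m (\<lambda>t. (t - h0)\<^sup>2)"
    unfolding hmean_def
  proof (rule integral_mono)
    show "integrable ?S (\<lambda>x. \<delta>\<^sup>2 * (indicator ?B (?h x) * ?F (?h x) ^ ?m + indicator ?B (- ?h x) * ?F (-
        ?h x) ^ ?m))"
      by (intro integrable_mult_right int[where c = 1]) (auto simp: indicator_def)
    show "integrable ?S (\<lambda>x. (?h x - h0)\<^sup>2 * ?F (?h x) ^ ?m + (- ?h x - h0)\<^sup>2 * ?F (- ?h x) ^ ?m)"
    proof (rule int[where c = 4])
      fix t :: real assume "\<bar>t\<bar> < 1"
      then have "\<bar>t - h0\<bar>\<^sup>2 \<le> 2\<^sup>2" using h0 by (intro power_mono) auto
      then show "\<bar>(t - h0)\<^sup>2\<bar> \<le> 4" by simp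
    qed auto
    fix x
    have ch: "\<delta>\<^sup>2 * (indicator ?B t * ?F t ^ ?m) \<le> (t - h0)\<^sup>2 * ?F t ^ ?m" for t
    proof -
      have "\<delta>\<^sup>2 * indicator ?B t \<le> (t - h0)\<^sup>2"
        using power_mono[of \<delta> "\<bar>t - h0\<bar>" 2] \<delta> by (auto simp: indicator_def)
      then have "(\<delta>\<^sup>2 * indicator ?B t) * ?F t ^ ?m \<le> (t - h0)\<^sup>2 * ?F t ^ ?m"
        using cap_nonneg[OF d(1), of t] by (intro mult_right_mono) auto
      then show ?thesis by (simp only: mult.assoc)
    qed
    show "\<delta>\<^sup>2 * (indicator ?B (?h x) * ?F (?h x) ^ ?m + indicator ?B (- ?h x) * ?F (- ?h x) ^ ?m) \<le>
        (?h x - h0)\<^sup>2 * ?F (?h x) ^ ?m + (- ?h x - h0)\<^sup>2 * ?F (- ?h x) ^ ?m"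
      using ch[of "?h x"] ch[of "- ?h x"] by (simp only: distrib_left)
  qed
  finally have cheb: "\<delta>\<^sup>2 * hmean d ?m (indicator ?B) \<le> hmean d ?m (\<lambda>t. (t - h0)\<^sup>2)" .
  have sm: "(real d - 1)\<^sup>2 * hmean d ?m (\<lambda>t. (t - h0)\<^sup>2) \<le> C * I"
    unfolding C_def I_def using d by (intro second_moment_bound h0) auto
  have "measure N {\<omega> \<in> space N. H \<omega> \<in> ?B} * I \<le> hmean d ?m (indicator ?B)"
    unfolding I_def by (rule typical_height_bound[OF d iid tH B])
  then have "((real d - 1)\<^sup>2 * \<delta>\<^sup>2) * (measure N {\<omega> \<in> space N. H \<omega> \<in> ?B} * I) \<le> ((real d - 1)\<^sup>2 * \<delta>\<^sup>2) *
      hmean d ?m (indicator ?B)"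
    by (intro mult_left_mono) auto
  also have "\<dots> \<le> (real d - 1)\<^sup>2 * hmean d ?m (\<lambda>t. (t - h0)\<^sup>2)"
    using cheb by (simp add: mult.assoc mult_left_mono)
  also note sm
  finally have "((real d - 1)\<^sup>2 * \<delta>\<^sup>2 * measure N {\<omega> \<in> space N. H \<omega> \<in> ?B}) * I \<le> C * I"
      by (simp only: mult.assoc)
  then have "(real d - 1)\<^sup>2 * \<delta>\<^sup>2 * measure N {\<omega> \<in> space N. H \<omega> \<in> ?B} \<le> C" using I by simp
  moreover have "0 < (real d - 1)\<^sup>2 * \<delta>\<^sup>2" using d \<delta> by simp
  ultimately have "measure N {\<omega> \<in> space N. H \<omega> \<in> ?B} \<le> C / ((real d - 1)\<^sup>2 * \<delta>\<^sup>2)"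
    by (simp add: pos_le_divide_eq mult.commute)
  then show ?thesis by (simp add: C_def)
qed

section \<open>Asymptotics\<close>

text \<open>Raising \<open>d\<close> by 2 multiplies the density by \<open>1 - t^2\<close>, and the
  moment recursion with \<open>k = 1\<close> gives the second moment as
  \<open>snorm d / d\<close>.\<close>

lemma snorm_step:
  assumes "4 \<le> d" shows "real d * snorm (d + 2) = (real d - 1) * snorm d"
proof -
  let ?m = "\<lambda>k::nat. integral {-1..1} (\<lambda>t. t ^ k * sdens d t)"
  have s: "sdens (d + 2) t = sdens d t - t ^ 2 * sdens d t" if "t \<in> {-1..1}" for t
  proof (cases "\<bar>t\<bar> < 1")
    case True
    then have p: "0 < 1 - t\<^sup>2" by (rule one_minus_square_pos)
    have "sdens (d + 2) t = (1 - t\<^sup>2) powr (1 + (real d - 3) / 2)"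
      using p by (simp add: sdens_def field_simps)
    also have "\<dots> = (1 - t\<^sup>2) * sdens d t" using p by (simp only: powr_add) (simp add: sdens_def)
    finally show ?thesis by (simp add: algebra_simps)
  next
    case False
    then have "t = 1 \<or> t = -1" using that by auto
    then show ?thesis by (auto simp: sdens_def)
  qed
  have "snorm (d + 2) = integral {-1..1} (\<lambda>t. sdens d t - t ^ 2 * sdens d t)"
    unfolding snorm_def by (rule integral_cong) (rule s)
  also have "\<dots> = snorm d - ?m 2"
    unfolding snorm_def
    by (intro Henstock_Kurzweil_Integration.integral_diff integrable_continuous_real continuous_intros
        sdens_continuous assms)
  finally have "snorm (d + 2) = snorm d - ?m 2" .
  moreover have "real d * ?m 2 = snorm d"
  proof -
    have "?m 0 - ?m 2 = (real d - 1) * ?m 2"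
      using sdens_moments[OF assms, of 1] assms by (simp add: of_nat_diff numeral_2_eq_2[symmetric])
    moreover have "?m 0 = snorm d" by (simp add: snorm_def)
    ultimately show ?thesis by (simp add: algebra_simps)
  qed
  ultimately show ?thesis by (simp only: right_diff_distrib left_diff_distrib mult_1)
qed

lemma snorm_decreasing:
  assumes "4 \<le> d" shows "snorm (d + 1) \<le> snorm d"
  unfolding snorm_def
proof (rule integral_le)
  fix t :: real assume "t \<in> {-1..1}"
  then have "t\<^sup>2 \<le> 1" by (simp add: abs_square_le_1 abs_le_iff)
  then show "sdens (d + 1) t \<le> sdens d t"
    unfolding sdens_def by (intro powr_mono') auto
qed (use assms in \<open>auto intro: sdens_integrable\<close>)

lemma snorm_4: "snorm 4 = pi / 2"
proof -
  let ?f = "\<lambda>t::real. (t * sqrt (1 - t\<^sup>2) + arcsin t) / 2"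
  have "(sdens 4 has_integral ?f 1 - ?f (- 1)) {-1..1}"
  proof (rule fundamental_theorem_of_calculus_interior)
    show "continuous_on {-1..1} ?f" by (intro continuous_intros) auto
    fix t :: real assume "t \<in> {-1<..<1}"
    then have t: "-1 < t" "t < 1" by auto
    then have p: "0 < 1 - t\<^sup>2" by (intro one_minus_square_pos) auto
    have "(?f has_real_derivative (1 * sqrt (1 - t\<^sup>2) + inverse (sqrt (1 - t\<^sup>2)) / 2 * (- (2 * t)) * t +
        inverse (sqrt (1 - t\<^sup>2))) / 2) (at t)"
      using p t by (auto intro!: derivative_eq_intros)
    also have "(1 * sqrt (1 - t\<^sup>2) + inverse (sqrt (1 - t\<^sup>2)) / 2 * (- (2 * t)) * t +
        inverse (sqrt (1 - t\<^sup>2))) / 2 = sdens 4 t"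
    proof -
      define r where "r = sqrt (1 - t\<^sup>2)"
      have r: "0 < r" "r * r = 1 - t * t" using p by (simp_all add: r_def power2_eq_square)
      have "sdens 4 t = r" using p by (simp add: sdens_def r_def powr_half_sqrt)
      moreover have "(1 * r + inverse r / 2 * (- (2 * t)) * t + inverse r) / 2 = r"
      proof -
        have "(1 * r + inverse r / 2 * (- (2 * t)) * t + inverse r) = r + inverse r * (1 - t * t)"
          by (simp add: algebra_simps)
        also have "\<dots> = r + r" unfolding r(2)[symmetric] using r(1) by simp
        finally show ?thesis by simp
      qed
      ultimately show ?thesis by (simp add: r_def)
    qed
    finally show "(?f has_vector_derivative sdens 4 t) (at t)"
      by (simp add: has_real_derivative_iff_has_vector_derivative)
  qed simp
  then show ?thesis unfolding snorm_def by (simp add: integral_unique arcsin_minus)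
qed

lemma snorm_5: "snorm 5 = 4 / 3"
proof -
  have "((\<lambda>t. 1 - t\<^sup>2) has_integral (1 - 1 ^ 3 / 3) - (- 1 - (- 1) ^ 3 / 3)) {-1..1::real}"
  proof (rule fundamental_theorem_of_calculus)
    fix t :: real
    have "((\<lambda>t. t - t ^ 3 / 3) has_real_derivative 1 - t\<^sup>2) (at t within {-1..1})"
      by (auto intro!: derivative_eq_intros)
    then show "((\<lambda>t. t - t ^ 3 / 3) has_vector_derivative 1 - t\<^sup>2) (at t within {-1..1})"
      by (simp add: has_real_derivative_iff_has_vector_derivative)
  qed simp
  then have "integral {-1..1} (\<lambda>t::real. 1 - t\<^sup>2) = 4 / 3" by (auto dest: integral_unique)
  moreover have "snorm 5 = integral {-1..1} (\<lambda>t::real. 1 - t\<^sup>2)"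
    unfolding snorm_def
  proof (rule integral_cong)
    fix t :: real assume "t \<in> {-1..1}"
    then have "t\<^sup>2 \<le> 1" by (simp add: abs_square_le_1 abs_le_iff)
    then show "sdens 5 t = 1 - t\<^sup>2" by (simp add: sdens_def)
  qed
  ultimately show ?thesis by simp
qed

text \<open>Wallis' product: the quantity below is invariant under \<open>d \<mapsto> d + 1\<close>.\<close>

lemma snorm_wallis: "4 \<le> d \<Longrightarrow> (real d - 1) * snorm d * snorm (d + 1) = 2 * pi"
proof (induction d rule: nat_induct_at_least)
  case base
  then show ?case by (simp add: snorm_4 snorm_5)
next
  case (Suc d)
  have "(real (Suc d) - 1) * snorm (Suc d) * snorm (Suc d + 1) = (real d * snorm (d + 2)) * snorm (d +
      1)"
    by simp
  also have "\<dots> = 2 * pi" unfolding snorm_step[OF Suc.hyps] using Suc.IH by (simp add: mult_ac)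
  finally show ?case .
qed

text \<open>\<open>snorm\<close> decreases, so its square lies between consecutive products, which
  Wallis' identity evaluates exactly: \<open>2 * pi / d\<close> from below and
  \<open>2 * pi / (d - 2)\<close> from above.\<close>

lemma snorm_asymp: "(\<lambda>d. snorm d * sqrt (real d)) \<longlonglongrightarrow> sqrt (2 * pi)"
proof -
  have lo: "2 * pi \<le> (snorm d)\<^sup>2 * real d" if d: "4 \<le> d" for d
  proof -
    have "2 * pi = (real d - 1) * snorm d * snorm (d + 1)" using snorm_wallis[OF d] by simp
    also have "\<dots> \<le> real d * snorm d * snorm d"
      using snorm_decreasing[OF d] snorm_pos[OF d] d snorm_pos[of "d + 1"] by (intro mult_mono) auto
    finally show ?thesis by (simp add: power2_eq_square mult_ac)
  qed
  have hi: "(snorm d)\<^sup>2 * real d \<le> 2 * pi * (real d / (real d - 2))" if d: "5 \<le> d" for d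
  proof -
    obtain e where e: "d = e + 1" "4 \<le> e" using d by (cases d) auto
    have "(real e - 1) * (snorm d)\<^sup>2 \<le> (real e - 1) * snorm e * snorm (e + 1)"
      using snorm_decreasing[OF e(2)] snorm_pos[of d] e d by (simp add: power2_eq_square mult.assoc)
    also have "\<dots> = 2 * pi" by (rule snorm_wallis[OF e(2)])
    finally have "(real d - 2) * (snorm d)\<^sup>2 \<le> 2 * pi" using e by simp
    then have "(snorm d)\<^sup>2 \<le> 2 * pi / (real d - 2)" using d by (simp add: pos_le_divide_eq mult.commute)
    then have "(snorm d)\<^sup>2 * real d \<le> 2 * pi / (real d - 2) * real d" by (intro mult_right_mono) auto
    then show ?thesis by simp
  qed
  have "(\<lambda>d. (snorm d)\<^sup>2 * real d) \<longlonglongrightarrow> 2 * pi"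
  proof (rule tendsto_sandwich)
    show "\<forall>\<^sub>F d in sequentially. 2 * pi \<le> (snorm d)\<^sup>2 * real d"
      using lo by (auto simp: eventually_sequentially)
    show "\<forall>\<^sub>F d in sequentially. (snorm d)\<^sup>2 * real d \<le> 2 * pi * (real d / (real d - 2))"
      using hi by (auto simp: eventually_sequentially)
    have "(\<lambda>d. 1 / (1 - 2 * (1 / real d))) \<longlonglongrightarrow> 1 / (1 - 2 * 0)"
      by (intro tendsto_intros lim_1_over_n) simp
    moreover have "\<forall>\<^sub>F d in sequentially. 1 / (1 - 2 * (1 / real d)) = real d / (real d - 2)"
      using eventually_gt_at_top[of 2] by eventually_elim (simp add: field_simps)
    ultimately have "(\<lambda>d. real d / (real d - 2)) \<longlonglongrightarrow> 1"
      by (simp add: Lim_transform_eventually)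
    then show "(\<lambda>d. 2 * pi * (real d / (real d - 2))) \<longlonglongrightarrow> 2 * pi"
      using tendsto_mult_left[of "\<lambda>d. real d / (real d - 2)" 1 sequentially "2 * pi"]
          by (simp only: mult_1_right)
  qed simp
  then have "(\<lambda>d. sqrt ((snorm d)\<^sup>2 * real d)) \<longlonglongrightarrow> sqrt (2 * pi)" by (rule tendsto_real_sqrt)
  moreover have "\<forall>\<^sub>F d in sequentially. sqrt ((snorm d)\<^sup>2 * real d) = snorm d * sqrt (real d)"
    using eventually_ge_at_top[of 4]
    by eventually_elim (use snorm_pos in \<open>auto simp: real_sqrt_mult less_imp_le\<close>)
  ultimately show ?thesis by (rule Lim_transform_eventually)
qed

section \<open>Behaviour of the hazard function near 0\<close>

lemma hazard_0: "4 \<le> d \<Longrightarrow> hazard d 0 = 2 / snorm d"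
  by (simp add: hazard_def cap_0 sdens_def)

text \<open>The numerator of \<open>hazard\<close> drops by at most a factor
  \<open>1 - d * h^2\<close>, and \<open>cap d h\<close> exceeds 1/2 by at most
  \<open>h / snorm d\<close> because the density is at most 1. As \<open>snorm d\<close> is of order
  d^(-1/2), the ratio tends to 1 when \<open>h * sqrt d\<close> tends to 0.\<close>

lemma hazard_ratio:
  assumes d: "4 \<le> d" and h: "0 \<le> h" "h < 1"
  shows "(1 - real d * h\<^sup>2) / (1 + 2 * h / snorm d) \<le> hazard d h / hazard d 0"
proof -
  have Z: "0 < snorm d" by (rule snorm_pos[OF d])
  have h1: "\<bar>h\<bar> < 1" using h by simp
  have p: "0 < 1 - h\<^sup>2" by (rule one_minus_square_pos[OF h1])
  have c: "0 < cap d h" by (rule cap_pos[OF d h1])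
  \<comment> \<open>The true exponent \<open>(d - 1) / 2\<close> is enlarged to the integer
    \<open>d\<close> so that Bernoulli's inequality applies; a constant factor in front of
    \<open>h^2\<close> is harmless.\<close>
  have "1 + real d * (- h\<^sup>2) \<le> (1 + (- h\<^sup>2)) ^ d" using p by (intro Bernoulli_inequality) simp
  also have "\<dots> = (1 - h\<^sup>2) * (1 - h\<^sup>2) powr (real (d - 1))" using p d
    by (cases d) (simp_all only: powr_realpow power_Suc diff_Suc_1, simp)
  also have "\<dots> \<le> (1 - h\<^sup>2) * sdens d h"
  proof (rule mult_left_mono)
    have "max 0 (1 - h\<^sup>2) = 1 - h\<^sup>2" using p by simp
    moreover have "(1 - h\<^sup>2) powr (real (d - 1)) \<le> (1 - h\<^sup>2) powr ((real d - 3) / 2)"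
      by (rule powr_mono') (use p d in \<open>auto simp: of_nat_diff\<close>)
    ultimately show "(1 - h\<^sup>2) powr (real (d - 1)) \<le> sdens d h" by (simp only: sdens_def)
  qed (use p in simp)
  finally have num: "1 - real d * h\<^sup>2 \<le> (1 - h\<^sup>2) * sdens d h" by simp
  have "integral {-1..h} (sdens d) = integral {-1..0} (sdens d) + integral {0..h} (sdens d)"
    using h by (intro Henstock_Kurzweil_Integration.integral_combine[symmetric] sdens_integrable d) auto
  also have "integral {0..h} (sdens d) \<le> integral {0..h} (\<lambda>_. 1)"
    by (intro integral_le sdens_integrable d sdens_le_1) auto
  finally have "integral {-1..h} (sdens d) \<le> integral {-1..0} (sdens d) + h" using h by simp
  then have "cap d h \<le> (integral {-1..0} (sdens d) + h) / snorm d"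
    unfolding cap_def using Z by (intro divide_right_mono) auto
  also have "\<dots> = 1 / 2 + h / snorm d" using cap_0[OF d] by (simp add: cap_def add_divide_distrib)
  finally have den: "2 * cap d h \<le> 1 + 2 * h / snorm d" by simp
  have e: "hazard d h / hazard d 0 = ((1 - h\<^sup>2) * sdens d h) / (2 * cap d h)"
    using Z unfolding hazard_0[OF d] unfolding hazard_def by simp
  have "(1 - real d * h\<^sup>2) / (1 + 2 * h / snorm d) \<le> ((1 - h\<^sup>2) * sdens d h) / (1 + 2 * h / snorm d)"
    using h Z by (intro divide_right_mono[OF num]) simp
  also have "\<dots> \<le> ((1 - h\<^sup>2) * sdens d h) / (2 * cap d h)"
  proof (rule divide_left_mono[OF den])
    have "0 < 1 + 2 * h / snorm d" using h Z by (simp add: add_pos_nonneg)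
    then show "0 < (1 + 2 * h / snorm d) * (2 * cap d h)" using c by simp
  qed (use p sdens_nonneg[of d h] in simp)
  finally show ?thesis unfolding e .
qed


text \<open>The first summand is the variance bound \<open>1 / (d - 1)^2\<close> in the scale
  \<open>z\<close>; it is small when \<open>sqrt d\<close> is small compared with \<open>m\<close>.
  The second is the cost of freezing \<open>hazard\<close> at 0, estimated by
  \<open>hazard_ratio\<close>; it is small when \<open>m\<close> is small compared with
  \<open>d\<close>.\<close>

lemma typical_height_deviation:
  fixes \<kappa> :: real
  assumes d: "4 \<le> d" "d < n" and iid: "iid_uniform_sphere n d M X" and tH: "typical_height n d M X N H"
    and \<epsilon>: "0 < \<epsilon>"
  defines "m \<equiv> real n - real d"
  defines "h0 \<equiv> m * hazard d 0 / (real d - 1)\<^sup>2" and "z \<equiv> real d powr (3 / 2) / m"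
  assumes h1: "h0 < 1" and y: "\<bar>z * h0 - \<kappa>\<bar> < \<epsilon> / 2"
  shows "measure N {\<omega> \<in> space N. \<bar>z * H \<omega> - \<kappa>\<bar> > \<epsilon>} \<le>
    4 / \<epsilon>\<^sup>2 * ((sqrt (real d) / m)\<^sup>2 * (real d / (real d - 1))\<^sup>2 +
      (z * h0)\<^sup>2 * (1 - (1 - real d * h0\<^sup>2) / (1 + 2 * h0 / snorm d)))"
proof -
  interpret N: prob_space N using tH by (simp add: typical_height_def)
  have [measurable]: "H \<in> borel_measurable N" using tH by (simp add: typical_height_def)
  have m: "0 < m" "real (n - d) = m" using d by (auto simp: m_def)
  have z: "0 < z" using m d by (simp add: z_def)
  have hz: "0 < hazard d 0" using hazard_0[OF d(1)] snorm_pos[OF d(1)] by simp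
  have h0: "0 \<le> h0" using m hz by (simp add: h0_def)
  have d1: "0 < (real d - 1)\<^sup>2" using d by simp
  have eq: "(real d - 1)\<^sup>2 * h0 = m * hazard d 0" using d1 unfolding h0_def by simp
  \<comment> \<open>Half of the tolerance is spent on \<open>z * h0\<close> against
    \<open>\<kappa>\<close>, the other half on \<open>H\<close> against \<open>h0\<close>.\<close>
  define \<delta> where "\<delta> = \<epsilon> / (2 * z)"
  have \<delta>: "0 < \<delta>" using \<epsilon> z by (simp add: \<delta>_def)
  define L where "L = (1 - real d * h0\<^sup>2) / (1 + 2 * h0 / snorm d)"
  have L: "L * hazard d 0 \<le> hazard d h0"
    using hazard_ratio[OF d(1) h0 h1] hz unfolding L_def[symmetric] by (simp add: pos_le_divide_eq)
  have "measure N {\<omega> \<in> space N. \<bar>z * H \<omega> - \<kappa>\<bar> > \<epsilon>} \<le> measure N {\<omega> \<in> space N. \<delta> \<le> \<bar>H \<omega> - h0\<bar>}"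
  proof (rule N.finite_measure_mono)
    show "{\<omega> \<in> space N. \<bar>z * H \<omega> - \<kappa>\<bar> > \<epsilon>} \<subseteq> {\<omega> \<in> space N. \<delta> \<le> \<bar>H \<omega> - h0\<bar>}"
    proof
      fix \<omega> assume \<omega>: "\<omega> \<in> {\<omega> \<in> space N. \<bar>z * H \<omega> - \<kappa>\<bar> > \<epsilon>}"
      have "\<epsilon> / 2 \<le> \<bar>z * H \<omega> - z * h0\<bar>" using \<omega> y unfolding mem_Collect_eq by linarith
      also have "\<dots> = z * \<bar>H \<omega> - h0\<bar>" using z by (simp add: right_diff_distrib[symmetric] abs_mult)
      finally have "\<delta> \<le> \<bar>H \<omega> - h0\<bar>" using z by (simp add: \<delta>_def field_simps)
      then show "\<omega> \<in> {\<omega> \<in> space N. \<delta> \<le> \<bar>H \<omega> - h0\<bar>}" using \<omega> by simp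
    qed
  qed measurable
  also have "\<dots> \<le> (1 + real (n - d) * (h0 * (hazard d 0 - hazard d h0))) / ((real d - 1)\<^sup>2 * \<delta>\<^sup>2)"
    by (rule typical_height_concentration[OF d iid tH h0 h1 _ \<delta>]) (simp only: m eq)
  also have "\<dots> \<le> (1 + (real d - 1)\<^sup>2 * h0\<^sup>2 * (1 - L)) / ((real d - 1)\<^sup>2 * \<delta>\<^sup>2)"
  proof (rule divide_right_mono)
    have "m * (h0 * (hazard d 0 - hazard d h0)) \<le> m * (h0 * (hazard d 0 - L * hazard d 0))"
      using m h0 L by (intro mult_left_mono) auto
    also have "\<dots> = (m * hazard d 0) * h0 * (1 - L)" by (simp add: algebra_simps)
    also have "\<dots> = (real d - 1)\<^sup>2 * h0\<^sup>2 * (1 - L)" unfolding eq[symmetric]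
        by (simp add: power2_eq_square)
    finally show "1 + real (n - d) * (h0 * (hazard d 0 - hazard d h0)) \<le> 1 + (real d - 1)\<^sup>2 * h0\<^sup>2 *
        (1 - L)"
      unfolding m(2) by simp
  qed simp
  also have "\<dots> = 4 / \<epsilon>\<^sup>2 * (z\<^sup>2 / (real d - 1)\<^sup>2 + (z * h0)\<^sup>2 * (1 - L))"
  proof -
    have \<delta>2: "1 / \<delta>\<^sup>2 = 4 / \<epsilon>\<^sup>2 * z\<^sup>2" by (simp add: \<delta>_def power_divide power_mult_distrib)
    have gen: "(1 + D * h0\<^sup>2 * (1 - L)) / (D * \<delta>\<^sup>2) = 1 / \<delta>\<^sup>2 * (1 / D + h0\<^sup>2 * (1 - L))" if "D \<noteq> 0"
        for D
      using that \<delta> by (simp add: field_simps)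
    have "(1 + (real d - 1)\<^sup>2 * h0\<^sup>2 * (1 - L)) / ((real d - 1)\<^sup>2 * \<delta>\<^sup>2) =
        4 / \<epsilon>\<^sup>2 * z\<^sup>2 * (1 / (real d - 1)\<^sup>2 + h0\<^sup>2 * (1 - L))"
      using gen[of "(real d - 1)\<^sup>2"] d1 unfolding \<delta>2 by simp
    also have "\<dots> = 4 / \<epsilon>\<^sup>2 * (z\<^sup>2 / (real d - 1)\<^sup>2 + (z * h0)\<^sup>2 * (1 - L))"
      by (simp only: power_mult_distrib distrib_left times_divide_eq_right mult_1_right mult.assoc)
    finally show ?thesis .
  qed
  also have "z\<^sup>2 / (real d - 1)\<^sup>2 = (sqrt (real d) / m)\<^sup>2 * (real d / (real d - 1))\<^sup>2"
  proof -
    have "real d powr (3 / 2) = real d powr (1 + 1 / 2)" by simp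
    also have "\<dots> = real d * sqrt (real d)" using d by (simp only: powr_add) (simp add: powr_half_sqrt)
    finally show ?thesis unfolding z_def by (simp add: power_mult_distrib power_divide)
  qed
  finally show ?thesis unfolding L_def .
qed

theorem theorem2:
  fixes d :: "nat \<Rightarrow> nat"
    and M :: "nat \<Rightarrow> 'a measure" and X :: "nat \<Rightarrow> nat \<Rightarrow> 'a \<Rightarrow> nat \<Rightarrow> real"
    and N :: "nat \<Rightarrow> 'b measure" and H_typ :: "nat \<Rightarrow> 'b \<Rightarrow> real"
  assumes "\<forall>\<^sub>F n in sequentially. d n \<in> {2..n - 1}"
    and "(\<exists>c. \<forall>\<^sub>F n in sequentially. d n = c) \<or> filterlim d at_top sequentially"
    and "\<forall>\<^sub>F n in sequentially. iid_uniform_sphere n (d n) (M n) (X n)"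
    and "\<forall>\<^sub>F n in sequentially. typical_height n (d n) (M n) (X n) (N n) (H_typ n)"
    and "(\<lambda>n. sqrt (real (d n)) / (real n - real (d n))) \<longlonglongrightarrow> 0"
    and "(\<lambda>n. (real n - real (d n)) / real (d n)) \<longlonglongrightarrow> 0"
  shows "\<forall>\<epsilon>>0. (\<lambda>n. \<P>(\<omega> in N n.
           \<bar>real (d n) powr (3 / 2) / (real n - real (d n)) * H_typ n \<omega> - sqrt (2 / pi)\<bar> > \<epsilon>))
           \<longlonglongrightarrow> 0"
proof (intro allI impI)
  fix \<epsilon> :: real assume \<epsilon>: "0 < \<epsilon>"
  \<comment> \<open>Once \<open>(n - d) / d < 1\<close>, the dimension exceeds
    \<open>n / 2\<close>.\<close>
  have dinf: "filterlim d at_top sequentially"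
    unfolding filterlim_at_top
  proof
    fix k
    have "\<forall>\<^sub>F n in sequentially. (real n - real (d n)) / real (d n) < 1"
      using assms(6) by (rule order_tendstoD) simp
    then show "\<forall>\<^sub>F n in sequentially. k \<le> d n"
      using assms(1) eventually_ge_at_top[of "2 * k"]
    proof eventually_elim
      case (elim n)
      then have "0 < real (d n)" by simp
      then have "real n - real (d n) < real (d n)" using elim(1) by (simp add: pos_divide_less_eq)
      then show ?case using elim(3) by simp
    qed
  qed
  define m where "m n = real n - real (d n)" for n
  define h where "h n = m n * hazard (d n) 0 / (real (d n) - 1)\<^sup>2" for n
  define z where "z n = real (d n) powr (3 / 2) / m n" for n
  define s where "s n = snorm (d n) * sqrt (real (d n))" for n
  define r where "r n = m n / real (d n)" for n
  define \<rho> where "\<rho> n = real (d n) / (real (d n) - 1)" for n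
  \<comment> \<open>The rescaled centre \<open>z n * h n\<close>, written with
    \<open>hazard d 0 = 2 / snorm d\<close> as a combination of convergent factors. Its limit
    \<open>2 / sqrt (2 * pi)\<close> is the constant of the theorem.\<close>
  define y where "y n = 2 * (\<rho> n)\<^sup>2 / s n" for n
  have ev: "\<forall>\<^sub>F n in sequentially. 4 \<le> d n \<and> d n < n"
  proof -
    have "\<forall>\<^sub>F n in sequentially. 4 \<le> d n" using dinf unfolding filterlim_at_top by blast
    then show ?thesis using assms(1) by eventually_elim auto
  qed
  have rd: "filterlim (\<lambda>n. real (d n)) at_top sequentially"
    by (rule filterlim_compose[OF filterlim_real_sequentially dinf])
  have inv: "(\<lambda>n. 1 / real (d n)) \<longlonglongrightarrow> 0"
    by (rule filterlim_compose[OF lim_1_over_n dinf])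
  have invs: "(\<lambda>n. 1 / sqrt (real (d n))) \<longlonglongrightarrow> 0"
    using tendsto_real_sqrt[OF inv] by (simp add: real_sqrt_divide)
  have r0: "r \<longlonglongrightarrow> 0" using assms(6) by (simp add: r_def[abs_def] m_def)
  have m0: "(\<lambda>n. sqrt (real (d n)) / m n) \<longlonglongrightarrow> 0" using assms(5) by (simp add: m_def)
  have s_lim: "s \<longlonglongrightarrow> sqrt (2 * pi)"
    unfolding s_def[abs_def] by (rule filterlim_compose[OF snorm_asymp dinf])
  have \<rho>_lim: "\<rho> \<longlonglongrightarrow> 1"
  proof -
    have "(\<lambda>n. 1 / (1 - 1 / real (d n))) \<longlonglongrightarrow> 1 / (1 - 0)"
      by (intro tendsto_intros inv) simp
    moreover have "\<forall>\<^sub>F n in sequentially. 1 / (1 - 1 / real (d n)) = \<rho> n"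
      using ev by eventually_elim (simp add: \<rho>_def field_simps)
    ultimately show ?thesis by (simp add: Lim_transform_eventually)
  qed
  have \<kappa>: "2 / sqrt (2 * pi) = sqrt (2 / pi)"
  proof -
    have "2 / sqrt (2 * pi) = 2 / sqrt 2 / sqrt pi" by (simp add: real_sqrt_mult)
    also have "2 / sqrt 2 = sqrt 2" by (rule real_div_sqrt) simp
    finally show ?thesis by (simp add: real_sqrt_divide)
  qed
  have y_lim: "y \<longlonglongrightarrow> sqrt (2 / pi)"
  proof -
    have "y \<longlonglongrightarrow> 2 * 1\<^sup>2 / sqrt (2 * pi)"
      unfolding y_def[abs_def] by (intro tendsto_intros \<rho>_lim s_lim) simp
    then show ?thesis by (simp add: \<kappa>)
  qed
  \<comment> \<open>Everything in the deviation bound is expressed through \<open>y\<close>,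
    \<open>r\<close> and \<open>s\<close>, whose limits are known. In particular
    \<open>d * h^2\<close> and \<open>h / snorm d\<close> are governed by \<open>r\<close>, the
    ratio of \<open>n - d\<close> to \<open>d\<close>.\<close>
  have eqs: "\<forall>\<^sub>F n in sequentially. z n * h n = y n \<and> h n = y n * r n * (1 / sqrt (real (d n))) \<and>
      real (d n) * (h n)\<^sup>2 = (y n)\<^sup>2 * (r n)\<^sup>2 \<and> h n / snorm (d n) = y n * r n / s n"
    using ev
  proof eventually_elim
    case (elim n)
    then have d: "4 \<le> d n" by simp
    define q where "q = sqrt (real (d n))"
    have q: "0 < q" "real (d n) = q * q" using d by (auto simp: q_def)
    have m: "0 < m n" using elim by (simp add: m_def)
    have S: "0 < snorm (d n)" by (rule snorm_pos[OF d])
    have p: "real (d n) powr (3 / 2) = real (d n) * q"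
    proof -
      have "real (d n) powr (3 / 2) = real (d n) powr (1 + 1 / 2)" by simp
      also have "\<dots> = real (d n) * q" using d by (simp only: powr_add) (simp add: powr_half_sqrt q_def)
      finally show ?thesis .
    qed
    have d1: "real (d n) - 1 \<noteq> 0" using d by simp
    have h: "h n = m n * 2 / (snorm (d n) * (real (d n) - 1)\<^sup>2)"
      unfolding h_def hazard_0[OF d] by simp
    have y: "y n = 2 * (q * q) * q / (snorm (d n) * (real (d n) - 1)\<^sup>2)"
      unfolding y_def \<rho>_def s_def q_def[symmetric] power_divide using q(1) S d1
      by (simp add: q(2) power2_eq_square mult_ac)
    have zh: "z n * h n = y n"
      unfolding z_def p h y using m by (simp add: q(2))
    have hy: "h n = y n * r n * (1 / q)"
      unfolding h y r_def using q(1) by (simp add: q(2))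
    have "real (d n) * (h n)\<^sup>2 = (y n)\<^sup>2 * (r n)\<^sup>2"
      unfolding hy q(2) using q(1) by (simp add: power2_eq_square)
    moreover have "h n / snorm (d n) = y n * r n / s n"
      unfolding hy s_def q_def[symmetric] by simp
    ultimately show ?case using zh hy by (simp add: q_def)
  qed
  have h_lim: "h \<longlonglongrightarrow> 0"
  proof -
    have "(\<lambda>n. y n * r n * (1 / sqrt (real (d n)))) \<longlonglongrightarrow> sqrt (2 / pi) * 0 * 0"
      by (intro tendsto_intros y_lim r0 invs)
    moreover have "\<forall>\<^sub>F n in sequentially. y n * r n * (1 / sqrt (real (d n))) = h n"
      using eqs by eventually_elim simp
    ultimately show ?thesis by (simp add: Lim_transform_eventually)
  qed
  \<comment> \<open>Of the two summands, the first vanishes in the limit through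
    \<open>sqrt d / m\<close>, the second through \<open>r\<close>.\<close>
  let ?b = "\<lambda>n. 4 / \<epsilon>\<^sup>2 * ((sqrt (real (d n)) / m n)\<^sup>2 * (\<rho> n)\<^sup>2 +
      (y n)\<^sup>2 * (1 - (1 - (y n)\<^sup>2 * (r n)\<^sup>2) / (1 + 2 * (y n * r n / s n))))"
  have b_lim: "?b \<longlonglongrightarrow> 0"
  proof -
    have "?b \<longlonglongrightarrow> 4 / \<epsilon>\<^sup>2 * (0\<^sup>2 * 1\<^sup>2 + (sqrt (2 / pi))\<^sup>2 *
        (1 - (1 - (sqrt (2 / pi))\<^sup>2 * 0\<^sup>2) / (1 + 2 * (sqrt (2 / pi) * 0 / sqrt (2 * pi)))))"
      by (intro tendsto_intros m0 \<rho>_lim y_lim r0 s_lim) simp_all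
    then show ?thesis by simp
  qed
  have close: "\<forall>\<^sub>F n in sequentially. \<bar>y n - sqrt (2 / pi)\<bar> < \<epsilon> / 2"
    using tendstoD[OF y_lim, of "\<epsilon> / 2"] \<epsilon> by (simp add: dist_real_def)
  have small: "\<forall>\<^sub>F n in sequentially. h n < 1"
    using h_lim by (rule order_tendstoD) simp
  have bound: "\<forall>\<^sub>F n in sequentially. \<P>(\<omega> in N n.
      \<bar>real (d n) powr (3 / 2) / (real n - real (d n)) * H_typ n \<omega> - sqrt (2 / pi)\<bar> > \<epsilon>) \<le> ?b n"
    using ev assms(3,4) eqs close small
  proof eventually_elim
    case (elim n)
    have d: "4 \<le> d n" "d n < n" using elim(1) by auto
    have e: "z n * h n = y n" "real (d n) * (h n)\<^sup>2 = (y n)\<^sup>2 * (r n)\<^sup>2" "h n / snorm (d n) =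
        y n * r n / s n"
      using elim(4) by auto
    have "measure (N n) {\<omega> \<in> space (N n). \<bar>z n * H_typ n \<omega> - sqrt (2 / pi)\<bar> > \<epsilon>} \<le>
        4 / \<epsilon>\<^sup>2 * ((sqrt (real (d n)) / m n)\<^sup>2 * (real (d n) / (real (d n) - 1))\<^sup>2 +
        (z n * h n)\<^sup>2 * (1 - (1 - real (d n) * (h n)\<^sup>2) / (1 + 2 * h n / snorm (d n))))"
      unfolding z_def h_def m_def
      by (rule typical_height_deviation[OF d elim(2,3) \<epsilon>])
         (use elim(5,6) e(1) in \<open>simp_all only: z_def h_def m_def\<close>)
    also have "2 * h n / snorm (d n) = 2 * (y n * r n / s n)" using e(3) by simp
    finally show ?case unfolding e(1,2) \<rho>_def[symmetric] by (simp only: z_def m_def)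
  qed
  show "(\<lambda>n. \<P>(\<omega> in N n.
      \<bar>real (d n) powr (3 / 2) / (real n - real (d n)) * H_typ n \<omega> - sqrt (2 / pi)\<bar> > \<epsilon>)) \<longlonglongrightarrow> 0"
    by (rule tendsto_sandwich[OF _ bound tendsto_const b_lim]) simp
qed

end
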